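(* Let $X$ be a reflexive Banach space and let $A\colon D(A)\to X$, $D(A)\subseteq X$, be the generator of a $C_0$-semigroup on $X$ such that $A\colon D(A)\to X$ is bijective with $A^{-1}\in L(X)$. Let $X_{-n}$ denote the $n$-th extrapolation space of $A$. Then the inductive limit $\operatorname{ind}_{n\in\mathbb{N}}X_{-n}$ is complete, and the universal extrapolation space $X_{-\infty}$ satisfies $X_{-\infty}=\operatorname{ind}_{n\in\mathbb{N}}X_{-n}$ (that is, the inductive limit is Hausdorff, so that $X_{-\infty}$ is defined, and it coincides with its completion $X_{-\infty}$).
   Context: $L(X)$ denotes the bounded linear operators on $X$. Extrapolation spaces: for $n\ge 1$, $X_{-n}$ is the completion of $X$ with respect to the norm $\|x\|_{-n}=\|A^{-n}x\|_X$, where $A^{-n}=(A^{-1})^n$. The linking map $X_{-n}\to X_{-(n+1)}$ is the unique continuous linear extension of the identity $\mathrm{id}_X$ (it exists since $\|x\|_{-(n+1)}\leq\|A^{-1}\|\,\|x\|_{-n}$); it is injective, so $X_{-n}$ is regarded as a subspace of $X_{-(n+1)}$. Inductive limit: $\operatorname{ind}_{n\in\mathbb{N}}X_{-n}$ is the union $\bigcup_nX_{-n}$ (the algebraic direct limit along the linking maps) with the finest linear topology making all canonical maps from $X_{-k}$, $k\in\mathbb{N}$, continuous. Universal extrapolation space: $X_{-\infty}$ is defined as the completion of the topological vector space $\operatorname{ind}_{n\in\mathbb{N}}X_{-n}$, provided that the latter is Hausdorff. *)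

theory Defs
  imports "HOL-Analysis.Analysis"
begin

section \<open>Banach spaces over the real or complex numbers\<close>

text \<open>
  Up to isomorphism the fields of class \<open>{real_normed_field, euclidean_space}\<close> are exactly the
  real and the complex numbers (Gelfand--Mazur), so both kinds of Banach spaces are covered.
  The real structure that the type class of the space provides has to agree with the given scalars.
\<close>

locale normed_scalars = vector_space scl
  for scl :: "'k::{real_normed_field,euclidean_space} \<Rightarrow> 'a::real_normed_vector \<Rightarrow> 'a" +
  assumes norm_scl: "norm (scl c x) = norm c * norm x"
    and scl_of_real: "scl (of_real r) x = r *\<^sub>R x"

definition bounded_maps ::
  "('k::real_normed_field \<Rightarrow> 'a::real_normed_vector \<Rightarrow> 'a) \<Rightarrow>
   ('k \<Rightarrow> 'b::real_normed_vector \<Rightarrow> 'b) \<Rightarrow> ('a \<Rightarrow> 'b) set" where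
  "bounded_maps s1 s2 =
     {B. Vector_Spaces.linear s1 s2 B \<and> (\<exists>K. \<forall>x. norm (B x) \<le> K * norm x)}"

abbreviation dual_space ::
  "('k::real_normed_field \<Rightarrow> 'a::real_normed_vector \<Rightarrow> 'a) \<Rightarrow> ('a \<Rightarrow> 'k) set" where
  "dual_space scl \<equiv> bounded_maps scl (*)"

definition bidual_space ::
  "('k::real_normed_field \<Rightarrow> 'a::real_normed_vector \<Rightarrow> 'a) \<Rightarrow> (('a \<Rightarrow> 'k) \<Rightarrow> 'k) set" where
  "bidual_space scl =
     {\<Phi>. (\<forall>f\<in>dual_space scl. \<forall>g\<in>dual_space scl. \<Phi> (\<lambda>x. f x + g x) = \<Phi> f + \<Phi> g) \<and>
         (\<forall>c. \<forall>f\<in>dual_space scl. \<Phi> (\<lambda>x. c * f x) = c * \<Phi> f) \<and>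
         (\<exists>K. \<forall>f\<in>dual_space scl. norm (\<Phi> f) \<le> K * onorm f)}"

text \<open>Only the values of a bidual element on the dual space matter.\<close>

definition reflexive_space ::
  "('k::real_normed_field \<Rightarrow> 'a::real_normed_vector \<Rightarrow> 'a) \<Rightarrow> bool" where
  "reflexive_space scl \<longleftrightarrow>
     (\<forall>\<Phi>\<in>bidual_space scl. \<exists>x. \<forall>f\<in>dual_space scl. \<Phi> f = f x)"


section \<open>Strongly continuous semigroups\<close>

definition C0_semigroup ::
  "('k::real_normed_field \<Rightarrow> 'a::real_normed_vector \<Rightarrow> 'a) \<Rightarrow> (real \<Rightarrow> 'a \<Rightarrow> 'a) \<Rightarrow> bool" where
  "C0_semigroup scl T \<longleftrightarrow>
     (\<forall>t\<ge>0. T t \<in> bounded_maps scl scl) \<and>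
     T 0 = id \<and>
     (\<forall>s\<ge>0. \<forall>t\<ge>0. T (s + t) = T s \<circ> T t) \<and>
     (\<forall>x. ((\<lambda>t. T t x) \<longlongrightarrow> x) (at_right 0))"

text \<open>A partially defined operator is given by its domain \<open>D\<close> and a function \<open>A\<close> whose values
  outside of \<open>D\<close> are irrelevant.\<close>

definition is_generator ::
  "(real \<Rightarrow> 'a::real_normed_vector \<Rightarrow> 'a) \<Rightarrow> 'a set \<Rightarrow> ('a \<Rightarrow> 'a) \<Rightarrow> bool" where
  "is_generator T D A \<longleftrightarrow>
     D = {x. \<exists>y. ((\<lambda>t. (1 / t) *\<^sub>R (T t x - x)) \<longlongrightarrow> y) (at_right 0)} \<and>
     (\<forall>x\<in>D. ((\<lambda>t. (1 / t) *\<^sub>R (T t x - x)) \<longlongrightarrow> A x) (at_right 0))"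

definition generates_C0_semigroup ::
  "('k::real_normed_field \<Rightarrow> 'a::real_normed_vector \<Rightarrow> 'a) \<Rightarrow> 'a set \<Rightarrow> ('a \<Rightarrow> 'a) \<Rightarrow> bool" where
  "generates_C0_semigroup scl D A \<longleftrightarrow> (\<exists>T. C0_semigroup scl T \<and> is_generator T D A)"


section \<open>Vector spaces on a carrier set, with a norm or a topology\<close>

record ('k, 'v) vec_space =
  points :: "'v set"
  vzero :: 'v
  vadd :: "'v \<Rightarrow> 'v \<Rightarrow> 'v"
  vscale :: "'k \<Rightarrow> 'v \<Rightarrow> 'v"

record ('k, 'v) norm_space = "('k, 'v) vec_space" +
  vnorm :: "'v \<Rightarrow> real"

record ('k, 'v) top_space = "('k, 'v) vec_space" +
  vtop :: "'v topology"

definition vdiff :: "('k::ring_1, 'v, 'm) vec_space_scheme \<Rightarrow> 'v \<Rightarrow> 'v \<Rightarrow> 'v" where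
  "vdiff V x y = vadd V x (vscale V (- 1) y)"

definition linear_on ::
  "('k, 'v, 'm) vec_space_scheme \<Rightarrow> ('k, 'w, 'n) vec_space_scheme \<Rightarrow> ('v \<Rightarrow> 'w) \<Rightarrow> bool" where
  "linear_on V W f \<longleftrightarrow>
     f \<in> points V \<rightarrow> points W \<and>
     (\<forall>x\<in>points V. \<forall>y\<in>points V. f (vadd V x y) = vadd W (f x) (f y)) \<and>
     (\<forall>c. \<forall>x\<in>points V. f (vscale V c x) = vscale W c (f x))"

text \<open>The locale \<open>Metric_space\<close> wants symmetry and nonnegativity also off the carrier,
  hence the case distinction.\<close>

definition norm_dist :: "('k::ring_1, 'v, 'm) norm_space_scheme \<Rightarrow> 'v \<Rightarrow> 'v \<Rightarrow> real" where
  "norm_dist V x y = (if x \<in> points V \<and> y \<in> points V then vnorm V (vdiff V x y) else 0)"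

definition norm_topology :: "('k::ring_1, 'v, 'm) norm_space_scheme \<Rightarrow> 'v topology" where
  "norm_topology V = Metric_space.mtopology (points V) (norm_dist V)"

definition linear_topology ::
  "('k::real_normed_field, 'v, 'm) vec_space_scheme \<Rightarrow> 'v topology \<Rightarrow> bool" where
  "linear_topology V \<tau> \<longleftrightarrow>
     topspace \<tau> = points V \<and>
     continuous_map (prod_topology \<tau> \<tau>) \<tau> (\<lambda>(x, y). vadd V x y) \<and>
     continuous_map (prod_topology euclidean \<tau>) \<tau> (\<lambda>(c, x). vscale V c x)"

definition tvs_isomorphism ::
  "('k, 'v, 'm) top_space_scheme \<Rightarrow> ('k, 'w, 'n) top_space_scheme \<Rightarrow> ('v \<Rightarrow> 'w) \<Rightarrow> bool" where
  "tvs_isomorphism V W f \<longleftrightarrow>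
     linear_on V W f \<and> bij_betw f (points V) (points W) \<and> homeomorphic_map (vtop V) (vtop W) f"


section \<open>Completion of a normed space\<close>

text \<open>Cauchy sequences modulo null sequences, for the norm \<open>p\<close> on the type of the space
  (which need not be the norm of the type class).\<close>

definition Cauchy_seqs :: "('a::ab_group_add \<Rightarrow> real) \<Rightarrow> (nat \<Rightarrow> 'a) set" where
  "Cauchy_seqs p = {f. \<forall>e>0. \<exists>N. \<forall>i\<ge>N. \<forall>j\<ge>N. p (f i - f j) < e}"

definition seq_rel :: "('a::ab_group_add \<Rightarrow> real) \<Rightarrow> ((nat \<Rightarrow> 'a) \<times> (nat \<Rightarrow> 'a)) set" where
  "seq_rel p =
     {(f, g). f \<in> Cauchy_seqs p \<and> g \<in> Cauchy_seqs p \<and> (\<lambda>i. p (f i - g i)) \<longlonglongrightarrow> 0}"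

definition completion_embedding :: "('a::ab_group_add \<Rightarrow> real) \<Rightarrow> 'a \<Rightarrow> (nat \<Rightarrow> 'a) set" where
  "completion_embedding p x = seq_rel p `` {\<lambda>_. x}"

definition norm_completion ::
  "('k \<Rightarrow> 'a::ab_group_add \<Rightarrow> 'a) \<Rightarrow> ('a \<Rightarrow> real) \<Rightarrow> ('k, (nat \<Rightarrow> 'a) set) norm_space" where
  "norm_completion scl p =
     \<lparr>points = Cauchy_seqs p // seq_rel p,
      vzero = completion_embedding p 0,
      vadd = (\<lambda>\<xi> \<eta>. \<Union>f\<in>\<xi>. \<Union>g\<in>\<eta>. seq_rel p `` {\<lambda>i. f i + g i}),
      vscale = (\<lambda>c \<xi>. \<Union>f\<in>\<xi>. seq_rel p `` {\<lambda>i. scl c (f i)}),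
      vnorm = (\<lambda>\<xi>. THE r. \<exists>f\<in>\<xi>. (\<lambda>i. p (f i)) \<longlonglongrightarrow> r)\<rparr>"


section \<open>Inductive limit of a sequence of normed spaces\<close>

text \<open>\<open>link_iter l n i\<close> is the composition of the linking maps \<open>l n\<close>, \dots, \<open>l (n + i - 1)\<close>,
  where \<open>l n\<close> leads from the \<open>n\<close>-th space to the next one.\<close>

primrec link_iter :: "(nat \<Rightarrow> 'v \<Rightarrow> 'v) \<Rightarrow> nat \<Rightarrow> nat \<Rightarrow> 'v \<Rightarrow> 'v" where
  "link_iter l n 0 x = x"
| "link_iter l n (Suc i) x = l (n + i) (link_iter l n i x)"

definition limit_rel ::
  "(nat \<Rightarrow> ('k, 'v, 'm) norm_space_scheme) \<Rightarrow> (nat \<Rightarrow> 'v \<Rightarrow> 'v) \<Rightarrow> ((nat \<times> 'v) \<times> (nat \<times> 'v)) set"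
  where
  "limit_rel E l =
     {((n, x), (m, y)). x \<in> points (E n) \<and> y \<in> points (E m) \<and>
        (\<exists>i j. n + i = m + j \<and> link_iter l n i x = link_iter l m j y)}"

definition limit_map ::
  "(nat \<Rightarrow> ('k, 'v, 'm) norm_space_scheme) \<Rightarrow> (nat \<Rightarrow> 'v \<Rightarrow> 'v) \<Rightarrow> nat \<Rightarrow> 'v \<Rightarrow> (nat \<times> 'v) set" where
  "limit_map E l n x = limit_rel E l `` {(n, x)}"

definition direct_limit ::
  "(nat \<Rightarrow> ('k, 'v, 'm) norm_space_scheme) \<Rightarrow> (nat \<Rightarrow> 'v \<Rightarrow> 'v) \<Rightarrow>
   ('k, (nat \<times> 'v) set) vec_space" where
  "direct_limit E l =
     \<lparr>points = (SIGMA n:UNIV. points (E n)) // limit_rel E l,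
      vzero = limit_map E l 0 (vzero (E 0)),
      vadd = (\<lambda>\<xi> \<eta>. \<Union>{limit_map E l n (vadd (E n) x y) | n x y. (n, x) \<in> \<xi> \<and> (n, y) \<in> \<eta>}),
      vscale = (\<lambda>c \<xi>. \<Union>{limit_map E l n (vscale (E n) c x) | n x. (n, x) \<in> \<xi>})\<rparr>"

definition admissible_topology ::
  "(nat \<Rightarrow> ('k::real_normed_field, 'v, 'm) norm_space_scheme) \<Rightarrow> (nat \<Rightarrow> 'v \<Rightarrow> 'v) \<Rightarrow>
   (nat \<times> 'v) set topology \<Rightarrow> bool" where
  "admissible_topology E l \<tau> \<longleftrightarrow>
     linear_topology (direct_limit E l) \<tau> \<and>
     (\<forall>n. continuous_map (norm_topology (E n)) \<tau> (limit_map E l n))"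

text \<open>The topology generated by all admissible topologies is again admissible (the indiscrete
  topology being one of them), so it is the finest linear topology for which all canonical maps
  are continuous. Local convexity is not demanded.\<close>

definition limit_topology ::
  "(nat \<Rightarrow> ('k::real_normed_field, 'v, 'm) norm_space_scheme) \<Rightarrow> (nat \<Rightarrow> 'v \<Rightarrow> 'v) \<Rightarrow>
   (nat \<times> 'v) set topology" where
  "limit_topology E l =
     topology_generated_by {U. \<exists>\<tau>. admissible_topology E l \<tau> \<and> openin \<tau> U}"

definition inductive_limit ::
  "(nat \<Rightarrow> ('k::real_normed_field, 'v, 'm) norm_space_scheme) \<Rightarrow> (nat \<Rightarrow> 'v \<Rightarrow> 'v) \<Rightarrow>
   ('k, (nat \<times> 'v) set) top_space" where
  "inductive_limit E l =
     \<lparr>points = points (direct_limit E l),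
      vzero = vzero (direct_limit E l),
      vadd = vadd (direct_limit E l),
      vscale = vscale (direct_limit E l),
      vtop = limit_topology E l\<rparr>"

lemma limit_topology_finest:
  assumes "admissible_topology E l \<tau>" "openin \<tau> U"
  shows "openin (limit_topology E l) U"
  unfolding limit_topology_def using assms by (intro topology_generated_by_Basis) blast

lemma limit_topology_admissible:
  assumes "admissible_topology E l \<tau>0"
  shows "admissible_topology E l (limit_topology E l)"
proof -
  let ?V = "direct_limit E l"
  let ?S = "limit_topology E l"
  let ?B = "{U. \<exists>\<tau>. admissible_topology E l \<tau> \<and> openin \<tau> U}"
  have sp: "topspace \<tau> = points ?V" if "admissible_topology E l \<tau>" for \<tau>
    using that by (simp add: admissible_topology_def linear_topology_def)
  have top: "topspace ?S = points ?V"
  proof -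
    have "\<Union>?B = points ?V"
    proof
      show "\<Union>?B \<subseteq> points ?V" using sp openin_subset by blast
      show "points ?V \<subseteq> \<Union>?B" using assms sp[OF assms] openin_topspace by blast
    qed
    then show ?thesis by (simp add: limit_topology_def)
  qed
  have coarser: "continuous_map ?S \<tau> (\<lambda>x. x)" if "admissible_topology E l \<tau>" for \<tau>
  proof -
    have "openin ?S {x \<in> topspace ?S. x \<in> U}" if "openin \<tau> U" for U
    proof -
      have "U \<subseteq> topspace ?S"
        using openin_subset[OF that] sp[OF \<open>admissible_topology E l \<tau>\<close>] top by simp
      then have "{x \<in> topspace ?S. x \<in> U} = U" by blast
      then show ?thesis
        using limit_topology_finest[OF \<open>admissible_topology E l \<tau>\<close> that] by simp
    qed
    then show ?thesis
      using sp[OF that] top by (auto simp: continuous_map_def)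
  qed
  have gen: "continuous_map Z ?S f"
    if cont: "\<And>\<tau>. admissible_topology E l \<tau> \<Longrightarrow> continuous_map Z \<tau> f" for Z and f :: "'z \<Rightarrow> _"
    unfolding limit_topology_def
  proof (rule continuous_on_generated_topo)
    show "openin Z (f -` U \<inter> topspace Z)" if "U \<in> ?B" for U
      using that cont by (auto simp: continuous_map_alt)
    have "f ` topspace Z \<subseteq> topspace ?S"
      using cont[OF assms] sp[OF assms] top by (auto simp: continuous_map_def)
    then show "f ` topspace Z \<subseteq> \<Union>?B"
      by (simp add: limit_topology_def)
  qed
  have "continuous_map (prod_topology ?S ?S) ?S (\<lambda>(x, y). vadd ?V x y)"
  proof (rule gen)
    fix \<tau> assume \<tau>: "admissible_topology E l \<tau>"
    then have c: "continuous_map (prod_topology \<tau> \<tau>) \<tau> (\<lambda>(x, y). vadd ?V x y)"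
      by (simp add: admissible_topology_def linear_topology_def)
    have "continuous_map (prod_topology ?S ?S) (prod_topology \<tau> \<tau>) (\<lambda>(x, y). (x, y))"
      by (rule iffD2[OF continuous_map_prod_top]) (simp add: coarser[OF \<tau>])
    from continuous_map_compose[OF this c]
    show "continuous_map (prod_topology ?S ?S) \<tau> (\<lambda>(x, y). vadd ?V x y)"
      by (simp add: o_def case_prod_unfold)
  qed
  moreover have "continuous_map (prod_topology euclidean ?S) ?S (\<lambda>(c, x). vscale ?V c x)"
  proof (rule gen)
    fix \<tau> assume \<tau>: "admissible_topology E l \<tau>"
    then have c: "continuous_map (prod_topology euclidean \<tau>) \<tau> (\<lambda>(c, x). vscale ?V c x)"
      by (simp add: admissible_topology_def linear_topology_def)
    have "continuous_map (prod_topology euclidean ?S) (prod_topology euclidean \<tau>) (\<lambda>(c, x). (c, x))"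
      by (rule iffD2[OF continuous_map_prod_top]) (simp add: coarser[OF \<tau>])
    from continuous_map_compose[OF this c]
    show "continuous_map (prod_topology euclidean ?S) \<tau> (\<lambda>(c, x). vscale ?V c x)"
      by (simp add: o_def case_prod_unfold)
  qed
  moreover have "continuous_map (norm_topology (E n)) ?S (limit_map E l n)" for n
    by (rule gen) (simp add: admissible_topology_def)
  ultimately show ?thesis
    using top by (simp add: admissible_topology_def linear_topology_def)
qed


section \<open>Completion of a topological vector space\<close>

definition Cauchy_filter ::
  "('k::real_normed_field, 'v, 'm) top_space_scheme \<Rightarrow> 'v filter \<Rightarrow> bool" where
  "Cauchy_filter V F \<longleftrightarrow>
     F \<noteq> bot \<and> (\<forall>\<^sub>F x in F. x \<in> points V) \<and>
     (\<forall>U. openin (vtop V) U \<and> vzero V \<in> U \<longrightarrow> (\<forall>\<^sub>F (x, y) in F \<times>\<^sub>F F. vdiff V x y \<in> U))"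

definition complete_tvs :: "('k::real_normed_field, 'v, 'm) top_space_scheme \<Rightarrow> bool" where
  "complete_tvs V \<longleftrightarrow> (\<forall>F. Cauchy_filter V F \<longrightarrow> (\<exists>x. limitin (vtop V) (\<lambda>y. y) x F))"

text \<open>
  The points of the completion are the minimal Cauchy filters (\<open>F \<le> G\<close> means that \<open>G\<close> is coarser
  than \<open>F\<close>), and a point of the space is identified with its neighbourhood filter. Adding the
  neighbourhood filter of \<open>0\<close> to a Cauchy filter gives the only minimal Cauchy filter that is
  coarser than it.
\<close>

definition minimal_Cauchy_filter ::
  "('k::real_normed_field, 'v, 'm) top_space_scheme \<Rightarrow> 'v filter \<Rightarrow> bool" where
  "minimal_Cauchy_filter V F \<longleftrightarrow>
     Cauchy_filter V F \<and> (\<forall>G. Cauchy_filter V G \<and> F \<le> G \<longrightarrow> G = F)"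

definition filter_add ::
  "('k, 'v, 'm) vec_space_scheme \<Rightarrow> 'v filter \<Rightarrow> 'v filter \<Rightarrow> 'v filter" where
  "filter_add V F G = filtermap (\<lambda>(x, y). vadd V x y) (F \<times>\<^sub>F G)"

definition minimal_hull :: "('k, 'v, 'm) top_space_scheme \<Rightarrow> 'v filter \<Rightarrow> 'v filter" where
  "minimal_hull V F = filter_add V F (nhdsin (vtop V) (vzero V))"

definition tvs_completion ::
  "('k::real_normed_field, 'v, 'm) top_space_scheme \<Rightarrow> ('k, 'v filter) top_space" where
  "tvs_completion V =
     \<lparr>points = Collect (minimal_Cauchy_filter V),
      vzero = nhdsin (vtop V) (vzero V),
      vadd = (\<lambda>F G. minimal_hull V (filter_add V F G)),
      vscale = (\<lambda>c F. minimal_hull V (filtermap (vscale V c) F)),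
      vtop = topology_generated_by
        {{F. minimal_Cauchy_filter V F \<and> (\<forall>\<^sub>F x in F. x \<in> U)} | U. openin (vtop V) U}\<rparr>"

definition tvs_completion_embedding :: "('k, 'v, 'm) top_space_scheme \<Rightarrow> 'v \<Rightarrow> 'v filter" where
  "tvs_completion_embedding V = nhdsin (vtop V)"


section \<open>Extrapolation spaces\<close>

definition extrapolation_norm ::
  "'a set \<Rightarrow> ('a \<Rightarrow> 'a::real_normed_vector) \<Rightarrow> nat \<Rightarrow> 'a \<Rightarrow> real" where
  "extrapolation_norm D A n x = norm ((the_inv_into D A ^^ n) x)"

definition extrapolation_space ::
  "('k \<Rightarrow> 'a::real_normed_vector \<Rightarrow> 'a) \<Rightarrow> 'a set \<Rightarrow> ('a \<Rightarrow> 'a) \<Rightarrow> nat \<Rightarrow>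
   ('k, (nat \<Rightarrow> 'a) set) norm_space" where
  "extrapolation_space scl D A n = norm_completion scl (extrapolation_norm D A n)"

definition extrapolation_link ::
  "('k::real_normed_field \<Rightarrow> 'a::real_normed_vector \<Rightarrow> 'a) \<Rightarrow> 'a set \<Rightarrow> ('a \<Rightarrow> 'a) \<Rightarrow> nat \<Rightarrow>
   (nat \<Rightarrow> 'a) set \<Rightarrow> (nat \<Rightarrow> 'a) set" where
  "extrapolation_link scl D A n =
     (THE L. L \<in> extensional (points (extrapolation_space scl D A n)) \<and>
        linear_on (extrapolation_space scl D A n) (extrapolation_space scl D A (Suc n)) L \<and>
        continuous_map (norm_topology (extrapolation_space scl D A n))
          (norm_topology (extrapolation_space scl D A (Suc n))) L \<and>
        (\<forall>x. L (completion_embedding (extrapolation_norm D A n) x) =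
             completion_embedding (extrapolation_norm D A (Suc n)) x))"

text \<open>The inductive limit starts with the first extrapolation space.\<close>

definition extrapolation_limit ::
  "('k::real_normed_field \<Rightarrow> 'a::real_normed_vector \<Rightarrow> 'a) \<Rightarrow> 'a set \<Rightarrow> ('a \<Rightarrow> 'a) \<Rightarrow>
   ('k, (nat \<times> (nat \<Rightarrow> 'a) set) set) top_space" where
  "extrapolation_limit scl D A =
     inductive_limit (\<lambda>n. extrapolation_space scl D A (Suc n))
       (\<lambda>n. extrapolation_link scl D A (Suc n))"

definition universal_extrapolation_space ::
  "('k::real_normed_field \<Rightarrow> 'a::real_normed_vector \<Rightarrow> 'a) \<Rightarrow> 'a set \<Rightarrow> ('a \<Rightarrow> 'a) \<Rightarrow>
   ('k, (nat \<times> (nat \<Rightarrow> 'a) set) set filter) top_space" where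
  "universal_extrapolation_space scl D A = tvs_completion (extrapolation_limit scl D A)"

end

(* The completion of X in the norm |B^n x|, B = A^{-1}, is the closure R n of the range of B^n: a class of
   Cauchy sequences f is identified with lim B^n f. The linking maps then become restrictions of B, and the
   inductive limit is the union of the increasing Banach spaces e n ` R n, where e n a = e (n + 1) (B a).
   A basis of zero neighbourhoods is given by the sets U eps of all finite sums of elements e n a with
   |a| < eps n; they are convex.
   Reflexivity enters through the following consequence of Hahn-Banach and of the existence of ultrafilters:
   a downward directed family of nonempty bounded closed convex sets has a common point.
   - Hausdorff: B maps bounded closed convex sets to closed sets, so for d <> 0 one can choose eps n one after
     the other such that d stays outside the closed hulls of the partial sums; then d is not in U eps.
   - Complete: a diagonal argument shows that a Cauchy filter comes arbitrarily close to one fixed ball of one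
     step. A common point of the closed convex hulls of the elements of this ball that are close to the members
     of the filter is its limit, because the sets U eps are convex. *)
theory Submission
  imports Defs
begin

section \<open>The Hahn-Banach theorem and ultrafilters\<close>

text \<open>The obstacle is that a bounded operator need not map closed balls to closed sets: a zero
  neighbourhood that keeps a given point out in one step may have that point in the closure of its
  image in the next. Bounded closed convex sets in a reflexive space behave like compact sets in
  this respect. Weak compactness is never stated as such: an ultrafilter assigns to every functional
  its limit, this assignment is an element of the bidual, reflexivity turns it into a point, and
  separation of points from closed convex sets places that point. Filters take the place of
  sequences because the zero neighbourhoods are indexed by all positive sequences and have no
  countable base in general. The topology in question is the finest linear one, which could be finer
  than the finest locally convex one. For countably many steps they agree: halving an arbitrary zero
  neighbourhood again and again leaves room for a whole convex set
  \<open>U \<epsilon>\<close>.\<close>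

definition sublinear :: "('a::real_vector \<Rightarrow> real) \<Rightarrow> bool" where
  "sublinear p \<longleftrightarrow> (\<forall>x y. p (x + y) \<le> p x + p y) \<and> (\<forall>t>0. \<forall>x. p (t *\<^sub>R x) = t * p x)"

lemma sublinear_zero: "sublinear p \<Longrightarrow> p 0 = 0"
proof -
  assume "sublinear p"
  then have "p ((2::real) *\<^sub>R 0) = 2 * p 0" unfolding sublinear_def by (meson zero_less_numeral)
  then show ?thesis by simp
qed

lemma sublinear_lower: "sublinear p \<Longrightarrow> - p (- x) \<le> p x"
proof -
  assume p: "sublinear p"
  then have "p (x + - x) \<le> p x + p (- x)" unfolding sublinear_def by blast
  then show ?thesis using sublinear_zero[OF p] by simp
qed

text \<open>The members \<open>g i\<close> need not be sublinear themselves; it is enough that sums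
  and multiples of their values dominate the value of some other member. The lemma serves three
  constructions: lowering a functional in one direction, the lower bound of a chain in Zorn's lemma,
  and the functional that yields separation.\<close>

lemma sublinear_INF:
  fixes g :: "'i \<Rightarrow> 'a::real_vector \<Rightarrow> real"
  assumes I: "I \<noteq> {}" and bdd: "\<And>x. bdd_below ((\<lambda>i. g i x) ` I)"
    and add: "\<And>i j x y. i \<in> I \<Longrightarrow> j \<in> I \<Longrightarrow> \<exists>k\<in>I. g k (x + y) \<le> g i x + g j y"
    and scale: "\<And>i t x. i \<in> I \<Longrightarrow> t > 0 \<Longrightarrow> \<exists>k\<in>I. g k (t *\<^sub>R x) \<le> t * g i x"
  shows "sublinear (\<lambda>x. INF i\<in>I. g i x)"
proof -
  let ?p = "\<lambda>x. INF i\<in>I. g i x"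
  have low: "?p x \<le> g i x" if "i \<in> I" for i x
    using cINF_lower[OF bdd that] .
  have "?p (x + y) \<le> ?p x + ?p y" for x y
  proof -
    have "?p (x + y) - g i x \<le> ?p y" if "i \<in> I" for i
    proof (rule cINF_greatest[OF I])
      fix j assume "j \<in> I"
      obtain k where "k \<in> I" "g k (x + y) \<le> g i x + g j y"
        using add[OF \<open>i \<in> I\<close> \<open>j \<in> I\<close>] by blast
      then show "?p (x + y) - g i x \<le> g j y" using low[of k "x + y"] by linarith
    qed
    then have "?p (x + y) - ?p y \<le> ?p x"
      by (intro cINF_greatest[OF I]) (simp add: algebra_simps)
    then show ?thesis by linarith
  qed
  moreover have le: "?p (t *\<^sub>R x) \<le> t * ?p x" if "t > 0" for t x
  proof -
    have "?p (t *\<^sub>R x) / t \<le> ?p x"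
    proof (rule cINF_greatest[OF I])
      fix i assume "i \<in> I"
      obtain k where "k \<in> I" "g k (t *\<^sub>R x) \<le> t * g i x" using scale[OF \<open>i \<in> I\<close> \<open>t > 0\<close>] by blast
      then have "?p (t *\<^sub>R x) \<le> t * g i x" using low[of k "t *\<^sub>R x"] by linarith
      then show "?p (t *\<^sub>R x) / t \<le> g i x" using \<open>t > 0\<close> by (simp add: field_simps)
    qed
    then show ?thesis using that by (simp add: field_simps)
  qed
  \<comment> \<open>The converse inequality is the first one for the factor \<open>1 / t\<close> at
    the point \<open>t *\<^sub>R x\<close>.\<close>
  moreover have "t * ?p x \<le> ?p (t *\<^sub>R x)" if "t > 0" for t x
    using le[of "1 / t" "t *\<^sub>R x"] that by (simp add: field_simps)
  ultimately show ?thesis unfolding sublinear_def by (auto intro: antisym)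
qed

text \<open>Minimality replaces the usual extension argument: no partially defined functionals are needed.\<close>

lemma minimal_sublinear_linear:
  assumes q: "sublinear q" and min: "\<And>r. sublinear r \<Longrightarrow> (\<And>x. r x \<le> q x) \<Longrightarrow> r = q"
  shows "linear q"
proof -
  have sub: "q (x + y) \<le> q x + q y" for x y using q unfolding sublinear_def by blast
  have hom: "q (t *\<^sub>R x) = t * q x" if "t > 0" for t x using q that unfolding sublinear_def by blast
  have hom0: "q (t *\<^sub>R x) = t * q x" if "t \<ge> 0" for t x
    using hom[of t x] that sublinear_zero[OF q] by (cases "t = 0") auto
  have neg: "q (- z) = - q z" for z
  proof -
    \<comment> \<open>\<open>r\<close> is the lowering of \<open>q\<close> in the direction
      \<open>z\<close>. Taking \<open>t = 0\<close> shows \<open>r \<le> q\<close>, and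
      \<open>t = 1\<close> shows \<open>r (- z) \<le> - q z\<close>, so minimality makes
      \<open>q\<close> odd.\<close>
    define g where "g t y = q (y + t *\<^sub>R z) - t * q z" for t y
    define r where "r y = (INF t\<in>{0..}. g t y)" for y
    have bdd: "bdd_below ((\<lambda>t. g t y) ` {0..})" for y
    proof (rule bdd_belowI2)
      fix t :: real assume "t \<in> {0..}"
      then show "- q (- y) \<le> g t y"
        using sub[of "y + t *\<^sub>R z" "- y"] hom0[of t z] by (simp add: g_def)
    qed
    have "sublinear r" unfolding r_def
    proof (rule sublinear_INF)
      fix s t :: real and x y assume "s \<in> {0..}" "t \<in> {0..}"
      show "\<exists>k\<in>{0..}. g k (x + y) \<le> g s x + g t y"
      proof
        show "g (s + t) (x + y) \<le> g s x + g t y"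
          using sub[of "x + s *\<^sub>R z" "y + t *\<^sub>R z"] by (simp add: g_def algebra_simps)
        show "s + t \<in> {0..}" using \<open>s \<in> _\<close> \<open>t \<in> _\<close> by simp
      qed
    next
      fix s t :: real and x assume "s \<in> {0..}" "0 < t"
      show "\<exists>k\<in>{0..}. g k (t *\<^sub>R x) \<le> t * g s x"
      proof
        show "g (t * s) (t *\<^sub>R x) \<le> t * g s x"
          using hom[OF \<open>0 < t\<close>, of "x + s *\<^sub>R z"] by (simp add: g_def algebra_simps)
        show "t * s \<in> {0..}" using \<open>s \<in> _\<close> \<open>0 < t\<close> by simp
      qed
    qed (simp_all add: bdd)
    moreover have low: "r y \<le> g t y" if "t \<ge> 0" for t y
      unfolding r_def using that by (intro cINF_lower[OF bdd]) simp
    have "r y \<le> q y" for y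
      using low[of 0 y] by (simp add: g_def)
    ultimately have "r = q" by (rule min)
    then have "q (- z) \<le> - q z"
      using low[of 1 "- z"] sublinear_zero[OF q] by (simp add: g_def)
    then show ?thesis using sublinear_lower[OF q, of z] by linarith
  qed
  show ?thesis
  proof (rule linearI)
    fix x y show "q (x + y) = q x + q y"
      using sub[of x y] sub[of "- x" "- y"] neg[of x] neg[of y] neg[of "x + y"] by simp
  next
    fix t x show "q (t *\<^sub>R x) = t *\<^sub>R q x"
    proof (cases "t \<ge> 0")
      case False
      then show ?thesis using hom0[of "- t" x] neg[of "t *\<^sub>R x"] by simp
    qed (simp add: hom0)
  qed
qed

text \<open>Zorn's lemma on all sublinear functionals below \<open>p\<close>, ordered downwards. The
  infimum over a chain is finite because each member satisfies
  \<open>q x \<ge> - q (- x) \<ge> - p (- x)\<close>.\<close>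

theorem Hahn_Banach_sublinear:
  fixes p :: "'a::real_vector \<Rightarrow> real"
  assumes p: "sublinear p"
  obtains u where "linear u" "\<And>x. u x \<le> p x"
proof -
  define Q where "Q = {q. sublinear q \<and> (\<forall>x. q x \<le> p x)}"
  define P where "P q r \<longleftrightarrow> (\<forall>x. r x \<le> q x)" for q r :: "'a \<Rightarrow> real"
  have "partial_order_on Q (relation_of P Q)"
    unfolding P_def partial_order_on_def preorder_on_def refl_on_def trans_def antisym_def relation_of_def
    by (auto intro!: ext intro: order_trans antisym)
  moreover have "\<exists>u\<in>Q. \<forall>a\<in>C. P a u" if C: "C \<in> Chains (relation_of P Q)" for C
  proof (cases "C = {}")
    case True then show ?thesis using p unfolding Q_def by auto
  next
    case False
    have CQ: "C \<subseteq> Q" and ch: "\<And>q r. q \<in> C \<Longrightarrow> r \<in> C \<Longrightarrow> P q r \<or> P r q"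
      using C unfolding Chains_def relation_of_def by auto
    have bdd: "bdd_below ((\<lambda>q. q x) ` C)" for x
    proof (rule bdd_belowI2)
      fix q assume "q \<in> C"
      then have "sublinear q" "q (- x) \<le> p (- x)" using CQ unfolding Q_def by auto
      then show "- p (- x) \<le> q x" using sublinear_lower[of q x] by linarith
    qed
    let ?u = "\<lambda>x. INF q\<in>C. q x"
    have low: "?u x \<le> q x" if "q \<in> C" for q x using cINF_lower[OF bdd that] .
    have "sublinear ?u"
    proof (rule sublinear_INF[OF False bdd])
      fix q r x y assume "q \<in> C" "r \<in> C"
      then have "sublinear q" "sublinear r" using CQ unfolding Q_def by auto
      then have "q (x + y) \<le> q x + q y" "r (x + y) \<le> r x + r y" unfolding sublinear_def by auto
      with ch[OF \<open>q \<in> C\<close> \<open>r \<in> C\<close>] show "\<exists>k\<in>C. k (x + y) \<le> q x + r y"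
        using \<open>q \<in> C\<close> \<open>r \<in> C\<close> unfolding P_def by (smt (verit))
    next
      fix q x and t :: real assume "q \<in> C" "0 < t"
      then have "q (t *\<^sub>R x) = t * q x" using CQ unfolding Q_def sublinear_def by blast
      then show "\<exists>k\<in>C. k (t *\<^sub>R x) \<le> t * q x" using \<open>q \<in> C\<close> by (metis order_refl)
    qed
    moreover have "?u x \<le> p x" for x
    proof -
      obtain q where "q \<in> C" using False by blast
      then have "?u x \<le> q x" "q x \<le> p x" using low CQ unfolding Q_def by auto
      then show ?thesis by linarith
    qed
    ultimately have "?u \<in> Q" unfolding Q_def by blast
    then show ?thesis using low unfolding P_def by (intro bexI[of _ ?u]) auto
  qed
  ultimately obtain m where m: "m \<in> Q" "\<forall>a\<in>Q. P m a \<longrightarrow> a = m"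
    using predicate_Zorn[of Q P] by blast
  have "linear m"
  proof (rule minimal_sublinear_linear)
    show "sublinear m" using m(1) unfolding Q_def by blast
    fix r assume "sublinear r" "\<And>x. r x \<le> m x"
    moreover from this have "r \<in> Q" using m(1) unfolding Q_def by (auto intro: order_trans)
    ultimately show "r = m" using m(2) unfolding P_def by blast
  qed
  moreover have "\<And>x. m x \<le> p x" using m(1) unfolding Q_def by blast
  ultimately show ?thesis by (rule that)
qed

section \<open>Strict separation of a point from a closed convex set\<close>

text \<open>Hahn-Banach is applied to the largest sublinear functional that lies below the norm and
  has value at most \<open>- d\<close> at every \<open>x - c\<close>. Such a functional exists
  because \<open>d\<close> is a lower bound for the distance from \<open>x\<close> to
  \<open>C\<close>: this keeps the infimum above \<open>- norm y\<close>.\<close>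

lemma separate_closed_convex_point:
  fixes C :: "'a::real_normed_vector set"
  assumes C: "closed C" "convex C" and x: "x \<notin> C"
  shows "\<exists>(u :: 'a \<Rightarrow> real) d. bounded_linear u \<and> d > 0 \<and> (\<forall>c\<in>C. u x + d \<le> u c)"
proof (cases "C = {}")
  case True
  show ?thesis by (intro exI[of _ "\<lambda>_. 0"] exI[of _ 1]) (simp add: True bounded_linear_zero)
next
  case False
  obtain d where d: "d > 0" "\<And>c. c \<in> C \<Longrightarrow> d \<le> dist x c"
  proof -
    obtain d where "d > 0" "ball x d \<subseteq> - C"
      using C(1) x by (metis ComplI open_Compl open_contains_ball)
    then show ?thesis by (intro that[of d]) (auto simp: subset_iff not_less[symmetric])
  qed
  \<comment> \<open>The infimum of the \<open>g i\<close> is below the norm and at most \<open>- d\<close> at \<open>x - c\<close> for \<open>c \<in> C\<close>.\<close>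
  define I where "I = {0::real..} \<times> C"
  define g where "g = (\<lambda>(t, c) y. norm (y + t *\<^sub>R (c - x)) - t * d)"
  let ?p = "\<lambda>y. INF i\<in>I. g i y"
  have bdd: "bdd_below ((\<lambda>i. g i y) ` I)" for y
  proof (rule bdd_belowI2)
    fix i assume "i \<in> I"
    then obtain t c where i: "i = (t, c)" "t \<ge> 0" "c \<in> C" unfolding I_def by auto
    have "t * d \<le> t * norm (c - x)"
      using i d(2)[of c] by (intro mult_left_mono) (auto simp: dist_norm norm_minus_commute)
    also have "\<dots> = norm (t *\<^sub>R (c - x))" using i by simp
    also have "\<dots> \<le> norm (y + t *\<^sub>R (c - x)) + norm y"
      using norm_triangle_ineq4[of "y + t *\<^sub>R (c - x)" y] by simp
    finally show "- norm y \<le> g i y" using i unfolding g_def by simp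
  qed
  have "sublinear ?p"
  proof (rule sublinear_INF[OF _ bdd])
    show "I \<noteq> {}" using False unfolding I_def by auto
  next
    fix i j y z assume "i \<in> I" "j \<in> I"
    then obtain s b t c where i: "i = (s, b)" "s \<ge> 0" "b \<in> C" and j: "j = (t, c)" "t \<ge> 0" "c \<in> C"
      unfolding I_def by auto
    \<comment> \<open>Convexity enters here: weights proportional to \<open>s\<close> and
      \<open>t\<close> make \<open>(s + t) *\<^sub>R (a - x)\<close> the sum of the two given
      shifts. If both parameters vanish, any point of \<open>C\<close> would do.\<close>
    define a where "a = (if s + t = 0 then b else (s / (s + t)) *\<^sub>R b + (t / (s + t)) *\<^sub>R c)"
    have "a \<in> C"
      using i j convexD[OF C(2), of b c "s / (s + t)" "t / (s + t)"]
      by (auto simp: a_def add_divide_distrib[symmetric])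
    have "(s + t) *\<^sub>R a = s *\<^sub>R b + t *\<^sub>R c"
      using i j by (auto simp: a_def scaleR_add_right add_nonneg_eq_0_iff)
    then have eq: "y + z + (s + t) *\<^sub>R (a - x) = (y + s *\<^sub>R (b - x)) + (z + t *\<^sub>R (c - x))"
      by (simp add: algebra_simps)
    have "g (s + t, a) (y + z) \<le> g i y + g j z"
      using norm_triangle_ineq[of "y + s *\<^sub>R (b - x)" "z + t *\<^sub>R (c - x)"]
      unfolding g_def i j prod.case eq distrib_right by linarith
    moreover have "(s + t, a) \<in> I" using i j \<open>a \<in> C\<close> unfolding I_def by simp
    ultimately show "\<exists>k\<in>I. g k (y + z) \<le> g i y + g j z" by blast
  next
    fix i y and t :: real assume "i \<in> I" "0 < t"
    then obtain s b where i: "i = (s, b)" "s \<ge> 0" "b \<in> C" unfolding I_def by auto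
    have "norm (t *\<^sub>R y + (t * s) *\<^sub>R (b - x)) = norm (t *\<^sub>R (y + s *\<^sub>R (b - x)))"
      by (simp add: algebra_simps)
    also have "\<dots> = t * norm (y + s *\<^sub>R (b - x))" using \<open>0 < t\<close> by simp
    finally have "g (t * s, b) (t *\<^sub>R y) \<le> t * g i y"
      unfolding g_def i by (simp add: algebra_simps)
    moreover have "(t * s, b) \<in> I" using i \<open>0 < t\<close> unfolding I_def by simp
    ultimately show "\<exists>k\<in>I. g k (t *\<^sub>R y) \<le> t * g i y" by blast
  qed
  then obtain u where u: "linear u" "\<And>y. u y \<le> ?p y" using Hahn_Banach_sublinear by blast
  have low: "u y \<le> g i y" if "i \<in> I" for i y
    using u(2)[of y] cINF_lower[OF bdd that, of y] by linarith
  \<comment> \<open>The parameter \<open>t = 0\<close> of the family gives the bound by the norm;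
    the parameter \<open>t = 1\<close> at the point \<open>x - c\<close> will give the
    separation.\<close>
  have le: "u y \<le> norm y" for y
  proof -
    obtain c where "c \<in> C" using False by blast
    then show ?thesis using low[of "(0, c)" y] unfolding g_def I_def by simp
  qed
  have "bounded_linear u"
  proof (rule bounded_linear_intro[where K = 1])
    show "u (y + z) = u y + u z" for y z using u(1) by (rule linear_add)
    show "u (t *\<^sub>R y) = t *\<^sub>R u y" for t y using u(1) by (rule linear_cmul)
    show "norm (u y) \<le> norm y * 1" for y
      using le[of y] le[of "- y"] linear_neg[OF u(1), of y] by simp
  qed
  moreover have "u x + d \<le> u c" if "c \<in> C" for c
  proof -
    have "u (x - c) \<le> - d" using low[of "(1, c)" "x - c"] that unfolding g_def I_def by simp
    then show ?thesis using linear_diff[OF u(1), of x c] by simp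
  qed
  ultimately show ?thesis using d(1) by blast
qed

section \<open>Ultrafilters and their limits\<close>

text \<open>Zorn's lemma for proper filters below \<open>F\<close>. Along a chain, a predicate that
  holds eventually for the infimum already does so for one member, hence the infimum stays proper. A
  minimal proper filter decides every \<open>P\<close>: unless \<open>P\<close> fails eventually,
  restricting the filter to \<open>P\<close> keeps it proper and so does not change it.\<close>

lemma ultrafilter_below:
  fixes F :: "'a filter"
  assumes "F \<noteq> bot"
  obtains U where "U \<noteq> bot" "U \<le> F" "\<And>P. eventually P U \<or> eventually (\<lambda>x. \<not> P x) U"
proof -
  define Q where "Q = {G. G \<noteq> bot \<and> G \<le> F}"
  have "partial_order_on Q (relation_of (\<lambda>G H. H \<le> G) Q)"
    unfolding partial_order_on_def preorder_on_def refl_on_def trans_def antisym_def relation_of_def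
    by auto
  moreover have "\<exists>u\<in>Q. \<forall>a\<in>C. u \<le> a" if C: "C \<in> Chains (relation_of (\<lambda>G H. H \<le> G) Q)" for C
  proof (cases "C = {}")
    case True then show ?thesis using assms unfolding Q_def by auto
  next
    case False
    have CQ: "C \<subseteq> Q" and ch: "\<And>q r. q \<in> C \<Longrightarrow> r \<in> C \<Longrightarrow> r \<le> q \<or> q \<le> r"
      using C unfolding Chains_def relation_of_def by auto
    have "eventually P (Inf C) \<longleftrightarrow> (\<exists>b\<in>C. eventually P b)" for P
    proof (rule eventually_Inf_base[OF False])
      fix F G assume "F \<in> C" "G \<in> C"
      then show "\<exists>x\<in>C. x \<le> inf F G" using ch[of F G] by (metis inf.bounded_iff order_refl)
    qed
    then have "Inf C \<noteq> bot" using CQ by (auto simp: Q_def trivial_limit_def)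
    moreover have "Inf C \<le> F" using False CQ unfolding Q_def by (auto intro: Inf_lower2)
    ultimately show ?thesis unfolding Q_def by (auto intro: Inf_lower)
  qed
  ultimately obtain m where m: "m \<in> Q" "\<forall>a\<in>Q. a \<le> m \<longrightarrow> a = m"
    using predicate_Zorn[of Q "\<lambda>G H. H \<le> G"] by blast
  have "eventually P m \<or> eventually (\<lambda>x. \<not> P x) m" for P
  proof (cases "eventually (\<lambda>x. \<not> P x) m")
    case False
    let ?m = "inf m (principal {x. P x})"
    have "?m \<noteq> bot" using False by (simp add: trivial_limit_def eventually_inf_principal)
    then have "?m \<in> Q" using m(1) unfolding Q_def by (auto intro: le_infI1)
    then have "?m = m" using m(2) by auto
    moreover have "eventually P ?m" by (simp add: eventually_inf_principal)
    ultimately show ?thesis by simp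
  qed simp
  then show ?thesis using m(1) that unfolding Q_def by blast
qed

text \<open>Compactness provides a cluster point. An ultrafilter decides every neighbourhood of it,
  and deciding against one would contradict clustering.\<close>

lemma ultrafilter_converges_compact:
  fixes f :: "'a \<Rightarrow> 'b::topological_space"
  assumes U: "U \<noteq> bot" "\<And>P. eventually P U \<or> eventually (\<lambda>x. \<not> P x) U"
    and K: "compact K" "eventually (\<lambda>x. f x \<in> K) U"
  obtains l where "(f \<longlongrightarrow> l) U"
proof -
  have "filtermap f U \<noteq> bot" using U(1) by (simp add: filtermap_bot_iff)
  moreover have "eventually (\<lambda>y. y \<in> K) (filtermap f U)" using K(2) by (simp add: eventually_filtermap)
  ultimately obtain l where l: "inf (nhds l) (filtermap f U) \<noteq> bot"
    using K(1) unfolding compact_filter by blast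
  have "(f \<longlongrightarrow> l) U"
  proof (rule topological_tendstoI)
    fix S assume S: "open S" "l \<in> S"
    show "eventually (\<lambda>x. f x \<in> S) U"
    proof (rule ccontr)
      assume "\<not> ?thesis"
      then have "eventually (\<lambda>x. f x \<notin> S) U" using U(2)[of "\<lambda>x. f x \<in> S"] by blast
      then have "eventually (\<lambda>y. False) (inf (nhds l) (filtermap f U))"
        unfolding eventually_inf eventually_filtermap
        using S eventually_nhds by (intro exI[of _ "\<lambda>y. y \<in> S"] exI[of _ "\<lambda>y. y \<notin> S"]) auto
      then show False using l by (simp add: trivial_limit_def)
    qed
  qed
  then show ?thesis by (rule that)
qed


section \<open>Reflexive spaces\<close>

lemma normed_scalars_mult: "normed_scalars ((*) :: 'k \<Rightarrow> 'k::{real_normed_field,euclidean_space} \<Rightarrow> 'k)"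
  by unfold_locales (simp_all add: algebra_simps norm_mult scaleR_conv_of_real)

lemma bounded_maps_imp_bounded_linear:
  assumes "normed_scalars s1" "normed_scalars s2" "f \<in> bounded_maps s1 s2"
  shows "bounded_linear f"
proof -
  interpret f: Vector_Spaces.linear s1 s2 f using assms(3) unfolding bounded_maps_def by blast
  obtain K where "\<forall>x. norm (f x) \<le> K * norm x" using assms(3) unfolding bounded_maps_def by blast
  moreover have "f (r *\<^sub>R x) = r *\<^sub>R f x" for r x
    using f.scale[of "of_real r" x]
    by (simp add: normed_scalars.scl_of_real[OF assms(1)] normed_scalars.scl_of_real[OF assms(2)])
  ultimately show ?thesis
    using f.add by (intro bounded_linear_intro[where K = K]) (simp_all add: mult.commute)
qed

text \<open>The real linear form \<open>c \<mapsto> u (scl c x)\<close> on the finite-dimensional scalar field is \<open>c \<mapsto> (c * d) \<bullet> 1\<close>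
  for a unique scalar \<open>d = f x\<close>; this avoids a case distinction between real and complex scalars.\<close>

lemma scalar_valued_functional:
  fixes scl :: "'k::{real_normed_field,euclidean_space} \<Rightarrow> 'a::real_normed_vector \<Rightarrow> 'a"
  assumes scl: "normed_scalars scl" and u: "bounded_linear u"
  obtains f where "f \<in> dual_space scl" "\<And>x. u x = f x \<bullet> 1"
proof -
  interpret normed_scalars scl by (rule scl)
  \<comment> \<open>\<open>T d\<close> represents the real linear form
    \<open>c \<mapsto> (c * d) \<bullet> 1\<close> in the inner product of the scalar field. Finite
    dimension turns injectivity of \<open>T\<close> into surjectivity, so every real linear form on
    the scalars arises in this way.\<close>
  define T :: "'k \<Rightarrow> 'k" where "T d = adjoint (\<lambda>c. c * d) 1" for d
  have T: "c \<bullet> T d = (c * d) \<bullet> 1" for c d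
    unfolding T_def by (intro adjoint_works bounded_linear.linear bounded_linear_mult_left)
  have one: "(1::'k) \<bullet> 1 > 0" by simp
  \<comment> \<open>Otherwise the factor \<open>inverse (d - d')\<close> would give
    \<open>1 \<bullet> 1 = 0\<close>. This yields the injectivity of \<open>T\<close> as well as the
    linearity of \<open>f\<close> over the scalars.\<close>
  have uniq: "d = d'" if "\<And>c. (c * d) \<bullet> 1 = (c * d') \<bullet> 1" for d d' :: 'k
  proof (rule ccontr)
    assume "d \<noteq> d'"
    have "(inverse (d - d') * (d - d')) \<bullet> 1 = 0"
      using that[of "inverse (d - d')"] by (simp add: algebra_simps)
    then show False using \<open>d \<noteq> d'\<close> one by simp
  qed
  have "linear T"
    by (rule linearI; rule iffD1[OF vector_eq_ldot]) (simp_all add: T algebra_simps)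
  moreover have "inj T"
  proof (rule injI)
    fix d d' assume "T d = T d'"
    then show "d = d'" by (intro uniq) (simp add: T[symmetric])
  qed
  ultimately have "surj T" by (rule linear_inj_imp_surj)
  have lin: "linear (\<lambda>c. u (scl c x))" for x
  proof (rule linearI)
    fix c d show "u (scl (c + d) x) = u (scl c x) + u (scl d x)"
      using bounded_linear.linear[OF u] by (simp add: scale_left_distrib linear_add)
    fix r :: real
    have "scl (r *\<^sub>R c) x = r *\<^sub>R scl c x"
      by (simp only: scaleR_conv_of_real scale_scale[symmetric] scl_of_real)
    then show "u (scl (r *\<^sub>R c) x) = r *\<^sub>R u (scl c x)"
      using bounded_linear.linear[OF u] by (simp add: linear_cmul)
  qed
  have "\<exists>d. \<forall>c. (c * d) \<bullet> 1 = u (scl c x)" for x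
  proof -
    obtain d where "T d = adjoint (\<lambda>c. u (scl c x)) 1" using \<open>surj T\<close> by (metis surj_def)
    then have "c \<bullet> T d = u (scl c x) \<bullet> 1" for c using adjoint_works[OF lin, of c x 1] by simp
    then show ?thesis unfolding T by auto
  qed
  then obtain f where f: "\<And>x c. (c * f x) \<bullet> 1 = u (scl c x)" by metis
  have "Vector_Spaces.linear scl (*) f"
  proof -
    have add: "f (x + y) = f x + f y" for x y
      using bounded_linear.linear[OF u]
      by (intro uniq) (simp add: f distrib_left inner_add_left scale_right_distrib linear_add)
    have scale: "f (scl b x) = b * f x" for b x
    proof (rule uniq)
      fix c
      have "(c * (b * f x)) \<bullet> 1 = ((c * b) * f x) \<bullet> 1" by (simp only: mult.assoc)
      then show "(c * f (scl b x)) \<bullet> 1 = (c * (b * f x)) \<bullet> 1" by (simp only: f scale_scale)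
    qed
    show ?thesis by unfold_locales (simp_all add: add scale algebra_simps)
  qed
  moreover
  obtain K where K: "K \<ge> 0" "\<And>x. norm (u x) \<le> K * norm x"
    using bounded_linear.nonneg_bounded[OF u] by (auto simp: mult.commute)
  \<comment> \<open>Testing with the factor \<open>inverse (f x)\<close> normalises the value of
    \<open>f\<close> to \<open>1\<close> and leaves a vector of norm
    \<open>norm x / norm (f x)\<close> to which the bound for \<open>u\<close> applies.\<close>
  have "norm (f x) \<le> (K / (1 \<bullet> (1::'k))) * norm x" for x
  proof (cases "f x = 0")
    case False
    have "(1::'k) \<bullet> 1 = u (scl (inverse (f x)) x)" using f[of "inverse (f x)" x] False by simp
    also have "\<dots> \<le> K * norm (scl (inverse (f x)) x)"
      using K(2) abs_ge_self by (metis order_trans real_norm_def)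
    also have "\<dots> = K * (norm x / norm (f x))"
      by (simp add: norm_scl norm_inverse divide_inverse mult.commute)
    finally show ?thesis using False one by (simp add: field_simps)
  qed (use K one in simp)
  ultimately have "f \<in> dual_space scl" unfolding bounded_maps_def by blast
  moreover have "u x = f x \<bullet> 1" for x using f[of 1 x] by simp
  ultimately show ?thesis by (rule that)
qed

text \<open>Weak compactness in the form of the finite intersection property. Directedness makes the
  sets a filter base; an ultrafilter that contains all of them has a limit along every functional
  because these are bounded on one of the sets and closed balls of scalars are compact. Reflexivity
  represents these limits by a point.\<close>

theorem reflexive_common_point:
  fixes scl :: "'k::{real_normed_field,euclidean_space} \<Rightarrow> 'a::real_normed_vector \<Rightarrow> 'a"
  assumes scl: "normed_scalars scl" and refl: "reflexive_space scl"
    and ne: "(\<C> :: 'a set set) \<noteq> {}" and sets: "\<And>C. C \<in> \<C> \<Longrightarrow> closed C \<and> convex C \<and> bounded C \<and> C \<noteq> {}"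
    and directed: "\<And>C D. C \<in> \<C> \<Longrightarrow> D \<in> \<C> \<Longrightarrow> \<exists>E\<in>\<C>. E \<subseteq> C \<inter> D"
  shows "\<Inter>\<C> \<noteq> {}"
proof -
  define F where "F = (INF C\<in>\<C>. principal C)"
  have ev: "eventually P F \<longleftrightarrow> (\<exists>C\<in>\<C>. eventually P (principal C))" for P
    unfolding F_def using directed by (intro eventually_INF_base[OF ne]) simp
  have "F \<noteq> bot" using sets by (auto simp: trivial_limit_def ev eventually_principal)
  then obtain U where U: "U \<noteq> bot" "U \<le> F" "\<And>P. eventually P U \<or> eventually (\<lambda>x. \<not> P x) U"
    using ultrafilter_below by blast
  have inC: "eventually (\<lambda>x. x \<in> C) U" if "C \<in> \<C>" for C
    using that by (intro filter_leD[OF U(2)]) (auto simp: ev eventually_principal)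
  obtain r where r: "eventually (\<lambda>x. norm x \<le> r) U"
  proof -
    obtain C where "C \<in> \<C>" using ne by blast
    moreover then obtain r where "\<forall>x\<in>C. norm x \<le> r" using sets bounded_iff by blast
    with inC[OF \<open>C \<in> \<C>\<close>] have "eventually (\<lambda>x. norm x \<le> r) U" by (auto elim: eventually_mono)
    then show ?thesis by (rule that)
  qed
  have bl: "bounded_linear f" if "f \<in> dual_space scl" for f
    using bounded_maps_imp_bounded_linear[OF scl normed_scalars_mult that] .
  have bound: "eventually (\<lambda>x. norm (f x) \<le> r * onorm f) U" if "f \<in> dual_space scl" for f
    using r
  proof (rule eventually_mono)
    fix x :: 'a assume "norm x \<le> r"
    have "norm (f x) \<le> onorm f * norm x" by (rule onorm[OF bl[OF that]])
    also have "\<dots> \<le> onorm f * r"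
      using \<open>norm x \<le> r\<close> onorm_pos_le[OF bl[OF that]] by (rule mult_left_mono)
    finally show "norm (f x) \<le> r * onorm f" by (simp add: mult.commute)
  qed
  have "\<exists>l. (f \<longlongrightarrow> l) U" if "f \<in> dual_space scl" for f
  proof -
    have "eventually (\<lambda>x. f x \<in> cball 0 (r * onorm f)) U" using bound[OF that] by simp
    then show ?thesis using ultrafilter_converges_compact[OF U(1) U(3) compact_cball] by blast
  qed
  then obtain \<Phi> where \<Phi>: "\<And>f. f \<in> dual_space scl \<Longrightarrow> (f \<longlongrightarrow> \<Phi> f) U" by metis
  have eq: "\<Phi> h = l" if "h \<in> dual_space scl" "(h \<longlongrightarrow> l) U" for h l
    using tendsto_unique[OF U(1) \<Phi>[OF that(1)] that(2)] .
  \<comment> \<open>Additivity and homogeneity hold because limits along \<open>U\<close> are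
    unique; the bound is the radius \<open>r\<close> of one bounded member of the family.\<close>
  have "\<Phi> \<in> bidual_space scl"
    unfolding bidual_space_def mem_Collect_eq
  proof (intro conjI ballI allI exI)
    fix f g assume f: "f \<in> dual_space scl" and g: "g \<in> dual_space scl"
    interpret f: Vector_Spaces.linear scl "(*)" f using f unfolding bounded_maps_def by blast
    interpret g: Vector_Spaces.linear scl "(*)" g using g unfolding bounded_maps_def by blast
    have "Vector_Spaces.linear scl (*) (\<lambda>x. f x + g x)"
      by unfold_locales (simp_all add: f.add g.add f.scale g.scale algebra_simps)
    moreover obtain K where "\<And>x. norm (f x + g x) \<le> K * norm x"
      using bounded_linear.bounded[OF bounded_linear_add[OF bl[OF f] bl[OF g]]]
      by (auto simp: mult.commute)
    ultimately have "(\<lambda>x. f x + g x) \<in> dual_space scl" unfolding bounded_maps_def by blast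
    then show "\<Phi> (\<lambda>x. f x + g x) = \<Phi> f + \<Phi> g"
      by (rule eq) (intro tendsto_add \<Phi> f g)
  next
    fix c f assume f: "f \<in> dual_space scl"
    interpret f: Vector_Spaces.linear scl "(*)" f using f unfolding bounded_maps_def by blast
    have "Vector_Spaces.linear scl (*) (\<lambda>x. c * f x)"
      by unfold_locales (simp_all add: f.add f.scale algebra_simps)
    moreover obtain K where "\<And>x. norm (c * f x) \<le> K * norm x"
      using bounded_linear.bounded[OF bounded_linear_compose[OF bounded_linear_mult_right bl[OF f]]]
      by (auto simp: mult.commute)
    ultimately have "(\<lambda>x. c * f x) \<in> dual_space scl" unfolding bounded_maps_def by blast
    then show "\<Phi> (\<lambda>x. c * f x) = c * \<Phi> f"
      by (rule eq) (intro tendsto_mult_left \<Phi> f)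
  next
    fix f assume f: "f \<in> dual_space scl"
    show "norm (\<Phi> f) \<le> r * onorm f"
      using tendsto_upperbound[OF tendsto_norm[OF \<Phi>[OF f]] bound[OF f] U(1)] .
  qed
  then obtain x where x: "\<And>f. f \<in> dual_space scl \<Longrightarrow> \<Phi> f = f x"
    using refl unfolding reflexive_space_def by blast
  \<comment> \<open>A separating functional would stay at least \<open>d\<close> above
    \<open>u x\<close> on \<open>C\<close>, hence eventually along \<open>U\<close>, while its limit
    along \<open>U\<close> is \<open>u x\<close>.\<close>
  have "x \<in> C" if C: "C \<in> \<C>" for C
  proof (rule ccontr)
    assume "x \<notin> C"
    have "closed C" "convex C" using sets[OF C] by simp_all
    from separate_closed_convex_point[OF this \<open>x \<notin> C\<close>]
    obtain u :: "'a \<Rightarrow> real" and d where u: "bounded_linear u" "d > 0" "\<forall>c\<in>C. u x + d \<le> u c" by blast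
    obtain f where f: "f \<in> dual_space scl" "\<And>x. u x = f x \<bullet> 1"
      using scalar_valued_functional[OF scl u(1)] by blast
    have "((\<lambda>c. f c \<bullet> 1) \<longlongrightarrow> \<Phi> f \<bullet> 1) U" by (intro tendsto_intros \<Phi> f)
    then have "(u \<longlongrightarrow> u x) U" by (simp add: f(2)[abs_def] x[OF f(1)])
    moreover have "eventually (\<lambda>c. u x + d \<le> u c) U"
      using inC[OF C] by (rule eventually_mono) (simp add: u(3))
    ultimately have "u x + d \<le> u x" using U(1) by (rule tendsto_lowerbound)
    then show False using \<open>d > 0\<close> by simp
  qed
  then have "x \<in> \<Inter>\<C>" by (rule InterI)
  then show ?thesis by blast
qed

text \<open>The preimages in \<open>C\<close> of the closed balls around a limit point
  \<open>y\<close> of the image are nonempty, bounded, closed, convex and nested. Any point that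
  they share is mapped to \<open>y\<close>.\<close>

lemma closed_image_reflexive:
  fixes scl :: "'k::{real_normed_field,euclidean_space} \<Rightarrow> 'a::real_normed_vector \<Rightarrow> 'a"
    and B :: "'a \<Rightarrow> 'b::real_normed_vector"
  assumes scl: "normed_scalars scl" "reflexive_space scl" and B: "bounded_linear B"
    and C: "closed C" "convex C" "bounded C"
  shows "closed (B ` C)"
proof -
  have "y \<in> B ` C" if y: "y \<in> closure (B ` C)" for y
  proof -
    define K where "K \<eta> = {c \<in> C. B c \<in> cball y \<eta>}" for \<eta>
    have K: "closed (K \<eta>) \<and> convex (K \<eta>) \<and> bounded (K \<eta>) \<and> K \<eta> \<noteq> {}" if \<eta>: "\<eta> > 0" for \<eta>
    proof (intro conjI)
      have K_eq: "K \<eta> = C \<inter> B -` cball y \<eta>" unfolding K_def by blast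
      show "closed (K \<eta>)"
        unfolding K_eq
        by (intro closed_Int C(1) closed_vimage[OF closed_cball] linear_continuous_on B)
      show "convex (K \<eta>)"
        unfolding K_eq
        by (intro convex_Int C(2) convex_linear_vimage[OF bounded_linear.linear[OF B] convex_cball])
      show "bounded (K \<eta>)" unfolding K_eq by (rule bounded_subset[OF C(3)]) blast
      obtain c where "c \<in> C" "dist (B c) y < \<eta>"
        using y \<eta> unfolding closure_approachable by blast
      then have "c \<in> K \<eta>" unfolding K_def by (simp add: dist_commute)
      then show "K \<eta> \<noteq> {}" by blast
    qed
    have dir: "\<exists>G\<in>K ` {0<..}. G \<subseteq> D \<inter> E" if "D \<in> K ` {0<..}" "E \<in> K ` {0<..}" for D E
    proof -
      from that obtain \<delta> \<eta> where "D = K \<delta>" "E = K \<eta>" "\<delta> > 0" "\<eta> > 0" by auto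
      moreover from this have "K (min \<delta> \<eta>) \<in> K ` {0<..}" by simp
      moreover have "K (min \<delta> \<eta>) \<subseteq> K \<delta> \<inter> K \<eta>" by (auto simp: K_def)
      ultimately show ?thesis by blast
    qed
    have ne: "K ` {0<..} \<noteq> {}" by simp
    have sets: "closed D \<and> convex D \<and> bounded D \<and> D \<noteq> {}" if "D \<in> K ` {0<..}" for D
    proof -
      from that obtain \<eta> where "\<eta> > 0" "D = K \<eta>" by auto
      then show ?thesis using K by blast
    qed
    have "\<Inter>(K ` {0<..}) \<noteq> {}" by (rule reflexive_common_point[OF scl ne sets dir])
    then obtain x where x: "x \<in> \<Inter>(K ` {0<..})" by blast
    have xK: "x \<in> K \<eta>" if "\<eta> > 0" for \<eta> using x that by blast
    have "x \<in> C" using xK[of 1] unfolding K_def by simp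
    have "dist y (B x) \<le> 0" 
    proof (rule dense_ge)
      fix \<eta> :: real assume "0 < \<eta>"
      then show "dist y (B x) \<le> \<eta>" using xK[of \<eta>] unfolding K_def by simp
    qed
    then have "y = B x" by simp
    then show ?thesis using \<open>x \<in> C\<close> by (rule image_eqI)
  qed
  then have "closure (B ` C) \<subseteq> B ` C" by blast
  then show ?thesis by (simp add: closure_subset_eq)
qed


section \<open>Extrapolation spaces as closed subspaces\<close>

lemma (in normed_scalars) bounded_linear_scl: "bounded_linear (scl c)"
proof (rule bounded_linear_intro)
  show "scl c (r *\<^sub>R x) = r *\<^sub>R scl c x" for r x
    by (simp only: scl_of_real[symmetric] scale_left_commute)
  show "norm (scl c x) \<le> norm x * norm c" for x by (simp add: norm_scl)
qed (rule scale_right_distrib)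

lemma (in normed_scalars) closed_subspace_closure_range:
  assumes T: "T \<in> bounded_maps scl scl"
  shows "0 \<in> closure (range T)"
    and "a \<in> closure (range T) \<Longrightarrow> b \<in> closure (range T) \<Longrightarrow> a + b \<in> closure (range T)"
    and "a \<in> closure (range T) \<Longrightarrow> scl c a \<in> closure (range T)"
proof -
  interpret T: Vector_Spaces.linear scl scl T using T unfolding bounded_maps_def by blast
  have sub: "range T \<subseteq> closure (range T)" by (rule closure_subset)
  show "0 \<in> closure (range T)"
    using subsetD[OF sub rangeI, of 0] by (simp add: T.zero)
  show "a + b \<in> closure (range T)" if "a \<in> closure (range T)" "b \<in> closure (range T)"
  proof -
    obtain f g where f: "\<forall>n. f n \<in> range T" "f \<longlonglongrightarrow> a" and g: "\<forall>n. g n \<in> range T" "g \<longlonglongrightarrow> b"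
      using \<open>a \<in> _\<close> \<open>b \<in> _\<close> unfolding closure_sequential by blast
    have "f n + g n \<in> range T" for n
    proof -
      obtain x y where "f n = T x" "g n = T y" using f(1) g(1) by blast
      then show ?thesis by (simp flip: T.add)
    qed
    then show ?thesis
      unfolding closure_sequential using tendsto_add[OF f(2) g(2)]
      by (intro exI[of _ "\<lambda>n. f n + g n"]) simp
  qed
  show "scl c a \<in> closure (range T)" if "a \<in> closure (range T)"
  proof -
    have "scl c ` range T \<subseteq> range T" by (auto simp flip: T.scale)
    then have "closure (scl c ` range T) \<subseteq> closure (range T)" by (rule closure_mono)
    then show ?thesis
      using closure_bounded_linear_image_subset[OF bounded_linear_scl, of c "range T"] that by blast
  qed
qed

section \<open>The completion in the norm pulled back by an operator\<close>

text \<open>Setting for a single extrapolation space, with \<open>T\<close> a power of the inverse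
  operator. By construction \<open>T\<close> is isometric from the pulled-back norm to the original
  one, so it extends to an isometry of the completion onto the closure of its range.\<close>

locale pullback_norm = normed_scalars scl
  for scl :: "'k::{real_normed_field,euclidean_space} \<Rightarrow> 'a::banach \<Rightarrow> 'a" +
  fixes T :: "'a \<Rightarrow> 'a"
  assumes T: "T \<in> bounded_maps scl scl"
begin

sublocale T: Vector_Spaces.linear scl scl T
  using T unfolding bounded_maps_def by blast

definition p :: "'a \<Rightarrow> real" where "p x = norm (T x)"

definition R :: "'a set" where "R = closure (range T)"

text \<open>The inverse of that isometry. Outside \<open>R\<close> it gives the empty set, which is
  no point of the completion.\<close>

definition cls :: "'a \<Rightarrow> (nat \<Rightarrow> 'a) set" where
  "cls a = {f. (\<lambda>i. T (f i)) \<longlonglongrightarrow> a}"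

abbreviation E :: "('k, (nat \<Rightarrow> 'a) set) norm_space" where
  "E \<equiv> norm_completion scl p"

lemmas R_subspace = closed_subspace_closure_range[OF T, folded R_def]

lemma R_diff: "a \<in> R \<Longrightarrow> b \<in> R \<Longrightarrow> a - b \<in> R"
  using R_subspace(2)[OF _ R_subspace(3)[of b "- 1"], of a] by simp

lemma T_in_R: "T x \<in> R"
  unfolding R_def by (rule subsetD[OF closure_subset rangeI])

lemma cls_nonempty:
  assumes "a \<in> R"
  shows "\<exists>f. f \<in> cls a"
proof -
  obtain x where x: "\<forall>n. x n \<in> range T" "x \<longlonglongrightarrow> a"
    using assms unfolding R_def closure_sequential by blast
  have "\<forall>n. \<exists>y. x n = T y" using x(1) by blast
  then obtain f where "\<forall>n. x n = T (f n)" by (rule choice[THEN exE])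
  then have "x = (\<lambda>n. T (f n))" by (simp add: fun_eq_iff)
  then show ?thesis using x(2) unfolding cls_def by blast
qed

lemma cls_in_R: "f \<in> cls a \<Longrightarrow> a \<in> R"
  unfolding R_def cls_def closure_sequential mem_Collect_eq
  by (rule exI[of _ "\<lambda>i. T (f i)"]) blast

lemma cls_unique: "f \<in> cls a \<Longrightarrow> f \<in> cls b \<Longrightarrow> a = b"
  unfolding cls_def by (simp add: LIMSEQ_unique)

lemma cls_eq_iff: "a \<in> R \<Longrightarrow> cls a = cls b \<longleftrightarrow> a = b"
  using cls_nonempty cls_unique by metis

text \<open>Completeness of the space enters here: it gives every Cauchy sequence for
  \<open>p\<close> a coordinate, namely the limit of its image under \<open>T\<close>.\<close>

lemma Cauchy_seqs_iff: "f \<in> Cauchy_seqs p \<longleftrightarrow> (\<exists>a. f \<in> cls a)"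
proof -
  have "f \<in> Cauchy_seqs p \<longleftrightarrow> Cauchy (\<lambda>i. T (f i))"
    unfolding Cauchy_seqs_def Cauchy_def p_def by (simp add: T.diff dist_norm)
  then show ?thesis by (simp add: Cauchy_convergent_iff convergent_def cls_def)
qed

lemma seq_rel_iff: "(f, g) \<in> seq_rel p \<longleftrightarrow> (\<exists>a. f \<in> cls a \<and> g \<in> cls a)"
proof
  assume "(f, g) \<in> seq_rel p"
  then obtain a b where ab: "f \<in> cls a" "g \<in> cls b" "(\<lambda>i. norm (T (f i - g i))) \<longlonglongrightarrow> 0"
    unfolding seq_rel_def by (auto simp: Cauchy_seqs_iff p_def)
  then have "(\<lambda>i. T (f i) - T (g i)) \<longlonglongrightarrow> 0" by (simp add: tendsto_norm_zero_iff T.diff)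
  moreover have "(\<lambda>i. T (f i) - T (g i)) \<longlonglongrightarrow> a - b"
    using ab unfolding cls_def by (simp add: tendsto_diff)
  ultimately have "a - b = 0" by (rule LIMSEQ_unique[symmetric])
  then show "\<exists>a. f \<in> cls a \<and> g \<in> cls a" using ab by auto
next
  assume "\<exists>a. f \<in> cls a \<and> g \<in> cls a"
  then obtain a where a: "f \<in> cls a" "g \<in> cls a" by blast
  then have "(\<lambda>i. T (f i) - T (g i)) \<longlonglongrightarrow> a - a"
    unfolding cls_def mem_Collect_eq by (rule tendsto_diff)
  then have "(\<lambda>i. p (f i - g i)) \<longlonglongrightarrow> 0"
    unfolding p_def by (simp add: T.diff tendsto_norm_zero)
  then show "(f, g) \<in> seq_rel p" unfolding seq_rel_def using a by (auto simp: Cauchy_seqs_iff)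
qed

lemma seq_rel_image: "f \<in> cls a \<Longrightarrow> seq_rel p `` {f} = cls a"
  by (auto simp: seq_rel_iff dest: cls_unique)

lemma points_E: "points E = cls ` R"
proof -
  have "points E = {seq_rel p `` {f} | f. \<exists>a. f \<in> cls a}"
    unfolding norm_completion_def quotient_def by (auto simp: Cauchy_seqs_iff[symmetric])
  also have "\<dots> = {cls a | a. \<exists>f. f \<in> cls a}"
    using seq_rel_image by blast
  also have "\<dots> = cls ` R"
    using cls_in_R cls_nonempty by blast
  finally show ?thesis .
qed

lemma inj_on_cls: "inj_on cls R"
  by (rule inj_onI) (simp add: cls_eq_iff)

lemma embedding: "completion_embedding p x = cls (T x)"
  unfolding completion_embedding_def by (rule seq_rel_image) (simp add: cls_def)

lemma vzero_E: "vzero E = cls 0"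
  using embedding[of 0] by (simp add: norm_completion_def T.zero)

lemma vadd_E:
  assumes "a \<in> R" "b \<in> R"
  shows "vadd E (cls a) (cls b) = cls (a + b)"
proof -
  have "seq_rel p `` {\<lambda>i. f i + g i} = cls (a + b)" if "f \<in> cls a" "g \<in> cls b" for f g
    using that by (intro seq_rel_image) (simp add: cls_def T.add tendsto_add)
  then have "vadd E (cls a) (cls b) = (\<Union>f\<in>cls a. \<Union>g\<in>cls b. cls (a + b))"
    by (simp add: norm_completion_def)
  also have "\<dots> = cls (a + b)" using assms[THEN cls_nonempty] by auto
  finally show ?thesis .
qed

lemma vscale_E:
  assumes "a \<in> R"
  shows "vscale E c (cls a) = cls (scl c a)"
proof -
  have "seq_rel p `` {\<lambda>i. scl c (f i)} = cls (scl c a)" if "f \<in> cls a" for f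
    using that by (intro seq_rel_image)
      (simp add: cls_def T.scale bounded_linear.tendsto[OF bounded_linear_scl])
  then have "vscale E c (cls a) = (\<Union>f\<in>cls a. cls (scl c a))"
    by (simp add: norm_completion_def)
  also have "\<dots> = cls (scl c a)" using assms[THEN cls_nonempty] by auto
  finally show ?thesis .
qed

lemma vnorm_E:
  assumes "a \<in> R"
  shows "vnorm E (cls a) = norm a"
proof -
  have "(\<lambda>i. p (f i)) \<longlonglongrightarrow> norm a" if "f \<in> cls a" for f
    using that unfolding cls_def p_def by (simp add: tendsto_norm)
  then have "(THE r. \<exists>f\<in>cls a. (\<lambda>i. p (f i)) \<longlonglongrightarrow> r) = norm a"
    using cls_nonempty[OF assms] LIMSEQ_unique by (intro the_equality) blast+
  then show ?thesis by (simp add: norm_completion_def)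
qed

lemma norm_dist_E:
  assumes "a \<in> R" "b \<in> R"
  shows "norm_dist E (cls a) (cls b) = dist a b"
proof -
  have "vdiff E (cls a) (cls b) = vadd E (cls a) (cls (scl (- 1) b))"
    unfolding vdiff_def vscale_E[OF assms(2)] ..
  also have "\<dots> = cls (a + scl (- 1) b)" by (rule vadd_E[OF assms(1) R_subspace(3)[OF assms(2)]])
  also have "a + scl (- 1) b = a - b" by simp
  finally have "vdiff E (cls a) (cls b) = cls (a - b)" .
  moreover have "cls a \<in> points E" "cls b \<in> points E" using assms by (simp_all add: points_E)
  ultimately show ?thesis
    unfolding norm_dist_def using vnorm_E[OF R_diff[OF assms]] by (simp add: dist_norm)
qed

sublocale E: Metric_space "points E" "norm_dist E"
proof
  fix \<xi> \<eta> \<zeta>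
  have off: "norm_dist E \<xi> \<eta> = 0" if "\<not> (\<xi> \<in> points E \<and> \<eta> \<in> points E)" for \<xi> \<eta>
    using that unfolding norm_dist_def by auto
  show "0 \<le> norm_dist E \<xi> \<eta>"
    by (cases "\<xi> \<in> points E \<and> \<eta> \<in> points E") (auto simp: points_E norm_dist_E, auto simp: off points_E)
  show "norm_dist E \<xi> \<eta> = norm_dist E \<eta> \<xi>"
    by (cases "\<xi> \<in> points E \<and> \<eta> \<in> points E")
      (auto simp: points_E norm_dist_E dist_commute, auto simp: off points_E)
  show "norm_dist E \<xi> \<eta> = 0 \<longleftrightarrow> \<xi> = \<eta>" if "\<xi> \<in> points E" "\<eta> \<in> points E"
    using that by (auto simp: points_E norm_dist_E)
  show "norm_dist E \<xi> \<zeta> \<le> norm_dist E \<xi> \<eta> + norm_dist E \<eta> \<zeta>"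
    if "\<xi> \<in> points E" "\<eta> \<in> points E" "\<zeta> \<in> points E"
    using that by (auto simp: points_E norm_dist_E dist_triangle)
qed

text \<open>By \<open>norm_dist_E\<close> the map is an isometry and takes balls of \<open>R\<close>
  to balls of \<open>E\<close>. Only the topological form is passed on: continuity of a map out of
  \<open>E\<close> can then be tested after composition with \<open>cls\<close>.\<close>

lemma homeomorphic_cls: "homeomorphic_map (top_of_set R) (norm_topology E) cls"
proof -
  have top: "topspace (norm_topology E) = cls ` R"
    unfolding norm_topology_def E.topspace_mtopology by (rule points_E)
  have ball: "E.mball (cls a) r = cls ` (R \<inter> ball a r)" if "a \<in> R" for a r
    unfolding E.mball_def using that by (auto simp: points_E norm_dist_E)
  have op: "openin (norm_topology E) (cls ` W) \<longleftrightarrow> openin (top_of_set R) W" if "W \<subseteq> R" for W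
  proof -
    have "openin (norm_topology E) (cls ` W) \<longleftrightarrow> (\<forall>a\<in>W. \<exists>r>0. E.mball (cls a) r \<subseteq> cls ` W)"
      using that unfolding norm_topology_def E.openin_mtopology by (auto simp: points_E)
    also have "\<dots> \<longleftrightarrow> (\<forall>a\<in>W. \<exists>r>0. R \<inter> ball a r \<subseteq> W)"
    proof (intro ball_cong refl ex_cong1 conj_cong)
      fix a r assume "a \<in> W"
      then have "a \<in> R" using that by blast
      have "E.mball (cls a) r \<subseteq> cls ` W \<longleftrightarrow> cls ` (R \<inter> ball a r) \<subseteq> cls ` W"
        by (simp only: ball[OF \<open>a \<in> R\<close>])
      also have "\<dots> \<longleftrightarrow> R \<inter> ball a r \<subseteq> W"
        by (rule inj_on_image_subset_iff[OF inj_on_cls]) (use that in auto)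
      finally show "E.mball (cls a) r \<subseteq> cls ` W \<longleftrightarrow> R \<inter> ball a r \<subseteq> W" .
    qed
    also have "\<dots> \<longleftrightarrow> openin (top_of_set R) W"
      using that unfolding openin_contains_ball by (auto simp: Int_commute)
    finally show ?thesis .
  qed
  show ?thesis
  proof (rule bijective_open_imp_homeomorphic_map)
    show "continuous_map (top_of_set R) (norm_topology E) cls"
      unfolding continuous_map_def
    proof (intro conjI allI impI)
      fix U assume U: "openin (norm_topology E) U"
      let ?W = "{a \<in> topspace (top_of_set R). cls a \<in> U}"
      have "cls ` ?W = U" using openin_subset[OF U] top by auto
      then show "openin (top_of_set R) ?W" using U op[of ?W] by auto
    qed (use top in auto)
    show "open_map (top_of_set R) (norm_topology E) cls"
      unfolding open_map_def using op openin_imp_subset by blast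
  qed (use top inj_on_cls in auto)
qed

lemma Hausdorff_E: "Hausdorff_space (norm_topology E)"
  unfolding norm_topology_def by (rule E.Hausdorff_space_mtopology)

end

section \<open>Linking maps between consecutive extrapolation spaces\<close>

locale injective_operator = normed_scalars scl
  for scl :: "'k::{real_normed_field,euclidean_space} \<Rightarrow> 'a::banach \<Rightarrow> 'a" +
  fixes B :: "'a \<Rightarrow> 'a"
  assumes B: "B \<in> bounded_maps scl scl" and inj_B: "inj B"
begin

lemma funpow_bounded: "B ^^ n \<in> bounded_maps scl scl"
proof (induction n)
  case 0
  show ?case unfolding bounded_maps_def
    by (auto intro!: exI[of _ 1] linear_id simp: id_def[symmetric])
next
  case (Suc n)
  then have lin: "Vector_Spaces.linear scl scl (B ^^ n)" "Vector_Spaces.linear scl scl B"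
    using B unfolding bounded_maps_def by blast+
  note bl = bounded_maps_imp_bounded_linear[OF normed_scalars_axioms normed_scalars_axioms]
  have "bounded_linear (\<lambda>x. B ((B ^^ n) x))"
    by (rule bounded_linear_compose[OF bl[OF B] bl[OF Suc]])
  then obtain K where "\<forall>x. norm (B ((B ^^ n) x)) \<le> norm x * K"
    using bounded_linear.bounded by blast
  then have "\<forall>x. norm ((B ^^ Suc n) x) \<le> K * norm x" by (simp add: mult.commute)
  moreover have "Vector_Spaces.linear scl scl (B ^^ Suc n)"
    using Vector_Spaces.linear_compose[OF lin] by simp
  ultimately show ?case unfolding bounded_maps_def by blast
qed

sublocale pw: pullback_norm scl "B ^^ n" for n
  by unfold_locales (rule funpow_bounded)

lemma bounded_linear_B: "bounded_linear B"
  using bounded_maps_imp_bounded_linear[OF normed_scalars_axioms normed_scalars_axioms B] .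

lemma B_in_R: "a \<in> pw.R n \<Longrightarrow> B a \<in> pw.R (Suc n)"
proof -
  assume "a \<in> pw.R n"
  moreover have "B ` closure (range (B ^^ n)) \<subseteq> closure (B ` range (B ^^ n))"
    using closure_bounded_linear_image_subset[OF bounded_linear_B] .
  moreover have "B ` range (B ^^ n) = range (B ^^ Suc n)" by (simp add: image_comp)
  ultimately show ?thesis unfolding pw.R_def by auto
qed

text \<open>An element \<open>x\<close> of the original space has the coordinate
  \<open>(B ^^ n) x\<close> in step \<open>n\<close> and \<open>(B ^^ Suc n) x\<close> in the next
  step, so the identity on it acts on coordinates as \<open>B\<close>. The linking map is a definite
  description; its existence comes from continuity of \<open>B\<close>, its uniqueness from
  density.\<close>

lemma extrapolation_link_cls:
  assumes inv: "the_inv_into D A = B" and a: "a \<in> pw.R n"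
  shows "extrapolation_link scl D A n (pw.cls n a) = pw.cls (Suc n) (B a)"
proof -
  note funpow.simps [simp del]
  have sp: "extrapolation_space scl D A m = pw.E m" for m
    unfolding extrapolation_space_def extrapolation_norm_def inv pw.p_def ..
  have emb: "completion_embedding (extrapolation_norm D A m) x = pw.cls m ((B ^^ m) x)" for m x
    using pw.embedding unfolding extrapolation_norm_def inv pw.p_def .
  interpret B: Vector_Spaces.linear scl scl B using B unfolding bounded_maps_def by blast
  \<comment> \<open>Restricted to the carrier because the description asks for an extensional
    map.\<close>
  define L where "L = (\<lambda>\<xi>\<in>points (pw.E n). pw.cls (Suc n) (B (inv_into (pw.R n) (pw.cls n) \<xi>)))"
  have L: "L (pw.cls n a) = pw.cls (Suc n) (B a)" if "a \<in> pw.R n" for a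
    using that by (simp add: L_def pw.points_E inv_into_f_f[OF pw.inj_on_cls])
  have quot: "quotient_map (top_of_set (pw.R n)) (norm_topology (pw.E n)) (pw.cls n)"
    using pw.homeomorphic_cls unfolding homeomorphic_map_def by blast
  have "extrapolation_link scl D A n = L"
    unfolding extrapolation_link_def sp emb
  proof (rule the_equality, intro conjI allI)
    show "L \<in> extensional (points (pw.E n))" unfolding L_def by simp
    show "linear_on (pw.E n) (pw.E (Suc n)) L"
      unfolding linear_on_def
      by (auto simp: pw.points_E L pw.vadd_E pw.vscale_E B_in_R pw.R_subspace B.add B.scale)
    have "continuous_on (pw.R n) B" by (rule linear_continuous_on[OF bounded_linear_B])
    then have "continuous_map (top_of_set (pw.R n)) (top_of_set (pw.R (Suc n))) B"
      by (simp add: continuous_map_in_subtopology B_in_R Pi_iff)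
    then have "continuous_map (top_of_set (pw.R n)) (norm_topology (pw.E (Suc n))) (pw.cls (Suc n) \<circ> B)"
      using homeomorphic_imp_continuous_map[OF pw.homeomorphic_cls] by (rule continuous_map_compose)
    then have "continuous_map (top_of_set (pw.R n)) (norm_topology (pw.E (Suc n))) (L \<circ> pw.cls n)"
      by (rule continuous_map_eq) (simp add: L)
    then show "continuous_map (norm_topology (pw.E n)) (norm_topology (pw.E (Suc n))) L"
      by (simp add: continuous_compose_quotient_map_eq[OF quot])
    show "L (pw.cls n ((B ^^ n) x)) = pw.cls (Suc n) ((B ^^ Suc n) x)" for x
      by (simp add: L pw.T_in_R funpow.simps(2))
    note L_cont = \<open>continuous_map (norm_topology (pw.E n)) (norm_topology (pw.E (Suc n))) L\<close>
    fix M assume M: "M \<in> extensional (points (pw.E n)) \<and>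
      linear_on (pw.E n) (pw.E (Suc n)) M \<and>
      continuous_map (norm_topology (pw.E n)) (norm_topology (pw.E (Suc n))) M \<and>
      (\<forall>x. M (pw.cls n ((B ^^ n) x)) = pw.cls (Suc n) ((B ^^ Suc n) x))"
    \<comment> \<open>Two continuous maps into a Hausdorff space that agree on
      \<open>range (B ^^ n)\<close> agree on its closure \<open>pw.R n\<close>.\<close>
    have "(M \<circ> pw.cls n) a = (L \<circ> pw.cls n) a" if "a \<in> pw.R n" for a
    proof (rule forall_in_closure_of_eq[where f = "M \<circ> pw.cls n" and g = "L \<circ> pw.cls n"])
      have "top_of_set (pw.R n) closure_of range (B ^^ n) = pw.R n"
        unfolding closure_of_subtopology pw.R_def
        using closure_subset[of "range (B ^^ n)"] by (auto simp: inf.absorb2)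
      then show "a \<in> top_of_set (pw.R n) closure_of range (B ^^ n)" using that by simp
      show "Hausdorff_space (norm_topology (pw.E (Suc n)))" by (rule pw.Hausdorff_E)
      show "continuous_map (top_of_set (pw.R n)) (norm_topology (pw.E (Suc n))) (M \<circ> pw.cls n)"
        "continuous_map (top_of_set (pw.R n)) (norm_topology (pw.E (Suc n))) (L \<circ> pw.cls n)"
        using M L_cont by (simp_all add: continuous_compose_quotient_map_eq[OF quot])
    qed (use M in \<open>auto simp: L pw.T_in_R funpow.simps(2)\<close>)
    then show "M = L"
      using M by (intro extensionalityI[of M "points (pw.E n)"]) (auto simp: L_def pw.points_E)
  qed
  then show ?thesis using L[OF a] by simp
qed

end


section \<open>The algebraic inductive limit\<close>

text \<open>The maps \<open>\<kappa> n\<close> identify the spaces \<open>E n\<close> with closed subspaces of one Banach space, on which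
  all linking maps are given by the same operator.\<close>

locale injective_sequence = normed_scalars scl
  for scl :: "'k::{real_normed_field,euclidean_space} \<Rightarrow> 'a::banach \<Rightarrow> 'a" +
  fixes B :: "'a \<Rightarrow> 'a" and R :: "nat \<Rightarrow> 'a set"
    and E :: "nat \<Rightarrow> ('k, 'v, 'm) norm_space_scheme" and l :: "nat \<Rightarrow> 'v \<Rightarrow> 'v"
    and \<kappa> :: "nat \<Rightarrow> 'a \<Rightarrow> 'v"
  assumes B: "B \<in> bounded_maps scl scl" and inj_B: "inj B"
    and closed_R: "closed (R n)" and R_zero: "0 \<in> R n"
    and R_add: "a \<in> R n \<Longrightarrow> b \<in> R n \<Longrightarrow> a + b \<in> R n"
    and R_scl: "a \<in> R n \<Longrightarrow> scl c a \<in> R n"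
    and B_R: "a \<in> R n \<Longrightarrow> B a \<in> R (Suc n)"
    and points_E: "points (E n) = \<kappa> n ` R n"
    and homeo_\<kappa>: "homeomorphic_map (top_of_set (R n)) (norm_topology (E n)) (\<kappa> n)"
    and vadd_\<kappa>: "a \<in> R n \<Longrightarrow> b \<in> R n \<Longrightarrow> vadd (E n) (\<kappa> n a) (\<kappa> n b) = \<kappa> n (a + b)"
    and vscale_\<kappa>: "a \<in> R n \<Longrightarrow> vscale (E n) c (\<kappa> n a) = \<kappa> n (scl c a)"
    and vzero_\<kappa>: "vzero (E 0) = \<kappa> 0 0"
    and link_\<kappa>: "a \<in> R n \<Longrightarrow> l n (\<kappa> n a) = \<kappa> (Suc n) (B a)"
begin

sublocale B: Vector_Spaces.linear scl scl B
  using B unfolding bounded_maps_def by blast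

lemma bounded_linear_B: "bounded_linear B"
  by (rule bounded_maps_imp_bounded_linear[OF normed_scalars_axioms normed_scalars_axioms B])

lemma pow_add: "(B ^^ i) (a + b) = (B ^^ i) a + (B ^^ i) b"
  by (induction i) (simp_all add: B.add)

lemma pow_scl: "(B ^^ i) (scl c a) = scl c ((B ^^ i) a)"
  by (induction i) (simp_all add: B.scale)

lemma pow_zero: "(B ^^ i) 0 = 0"
  by (induction i) (simp_all add: B.zero)

lemma pow_inj: "(B ^^ i) a = (B ^^ i) b \<longleftrightarrow> a = b"
  by (induction i) (use inj_B in \<open>auto dest: injD\<close>)

lemma pow_R: "a \<in> R n \<Longrightarrow> (B ^^ i) a \<in> R (n + i)"
  by (induction i) (simp_all add: B_R)

lemma R_minus: "a \<in> R n \<Longrightarrow> - a \<in> R n"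
  using R_scl[of a n "- 1"] by simp

lemma R_diff: "a \<in> R n \<Longrightarrow> b \<in> R n \<Longrightarrow> a - b \<in> R n"
  using R_add[OF _ R_minus, of a n b] by simp

lemma R_scaleR: "a \<in> R n \<Longrightarrow> r *\<^sub>R a \<in> R n"
  using R_scl[of a n "of_real r"] by (simp add: scl_of_real)

lemma convex_R: "convex (R n)"
  unfolding convex_def by (simp add: R_add R_scaleR)

lemma inj_on_\<kappa>: "inj_on (\<kappa> n) (R n)"
  using homeo_\<kappa>[of n] unfolding homeomorphic_map_def by simp

definition rel :: "nat \<Rightarrow> 'a \<Rightarrow> nat \<Rightarrow> 'a \<Rightarrow> bool" where
  "rel n a m b \<longleftrightarrow> (\<exists>i j. n + i = m + j \<and> (B ^^ i) a = (B ^^ j) b)"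

text \<open>As \<open>B\<close> is injective, two elements that become equal in some later step are
  equal in every common step. Hence the comparison may be made in whichever step \<open>N\<close> is
  convenient, and transitivity is a matter of choosing \<open>N\<close> large enough.\<close>

lemma rel_iff:
  assumes "n \<le> N" "m \<le> N"
  shows "rel n a m b \<longleftrightarrow> (B ^^ (N - n)) a = (B ^^ (N - m)) b"
proof
  assume "rel n a m b"
  then obtain i j where ij: "n + i = m + j" "(B ^^ i) a = (B ^^ j) b" unfolding rel_def by blast
  \<comment> \<open>Both sides are pushed forward by \<open>n + i\<close> further powers, where the
    exponents can be rearranged to use the given equation; injectivity then removes these
    powers.\<close>
  have "(B ^^ (n + i)) ((B ^^ (N - n)) a) = (B ^^ (n + i + (N - n))) a" by (simp add: funpow_add)
  also have "n + i + (N - n) = N + i" using assms by simp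
  also have "(B ^^ (N + i)) a = (B ^^ (N + j)) b" by (simp add: funpow_add ij(2))
  also have "N + j = n + i + (N - m)" using assms ij(1) by simp
  also have "(B ^^ (n + i + (N - m))) b = (B ^^ (n + i)) ((B ^^ (N - m)) b)" by (simp add: funpow_add)
  finally show "(B ^^ (N - n)) a = (B ^^ (N - m)) b" by (simp only: pow_inj)
next
  assume "(B ^^ (N - n)) a = (B ^^ (N - m)) b"
  then show "rel n a m b"
    unfolding rel_def using assms by (intro exI[of _ "N - n"] exI[of _ "N - m"]) simp
qed

lemma rel_refl: "rel n a n a"
  by (simp add: rel_iff[of n n])

lemma rel_sym: "rel n a m b \<Longrightarrow> rel m b n a"
  unfolding rel_def by metis

lemma rel_trans:
  assumes "rel n a m b" "rel m b k c"
  shows "rel n a k c"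
proof -
  define N where "N = max n (max m k)"
  have "n \<le> N" "m \<le> N" "k \<le> N" unfolding N_def by auto
  with assms show ?thesis by (simp add: rel_iff[of _ N])
qed

lemma link_iter_\<kappa>: "a \<in> R n \<Longrightarrow> link_iter l n i (\<kappa> n a) = \<kappa> (n + i) ((B ^^ i) a)"
  by (induction i) (simp_all add: link_\<kappa> pow_R)

lemma limit_rel_iff:
  assumes "a \<in> R n"
  shows "((n, \<kappa> n a), (m, y)) \<in> limit_rel E l \<longleftrightarrow> (\<exists>b\<in>R m. y = \<kappa> m b \<and> rel n a m b)"
proof -
  have *: "(\<exists>i j. n + i = m + j \<and> link_iter l n i (\<kappa> n a) = link_iter l m j (\<kappa> m b)) \<longleftrightarrow> rel n a m b"
    if "b \<in> R m" for b
    unfolding rel_def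
  proof (intro ex_cong1 conj_cong refl)
    fix i j assume ij: "n + i = m + j"
    have "\<kappa> (n + i) ((B ^^ i) a) = \<kappa> (n + i) ((B ^^ j) b) \<longleftrightarrow> (B ^^ i) a = (B ^^ j) b"
      using pow_R[OF assms, of i] pow_R[OF that, of j] ij by (simp add: inj_on_eq_iff[OF inj_on_\<kappa>])
    then show "link_iter l n i (\<kappa> n a) = link_iter l m j (\<kappa> m b) \<longleftrightarrow> (B ^^ i) a = (B ^^ j) b"
      using ij by (simp add: link_iter_\<kappa> assms that)
  qed
  show ?thesis
    unfolding limit_rel_def using assms * by (auto simp: points_E)
qed

definition V :: "('k, (nat \<times> 'v) set) vec_space" where
  "V = direct_limit E l"

text \<open>The canonical map of step \<open>n\<close> into the limit, read in the coordinates
  \<open>R n\<close>.\<close>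

definition e :: "nat \<Rightarrow> 'a \<Rightarrow> (nat \<times> 'v) set" where
  "e n a = limit_map E l n (\<kappa> n a)"

lemma mem_e: "a \<in> R n \<Longrightarrow> (m, y) \<in> e n a \<longleftrightarrow> (\<exists>b\<in>R m. y = \<kappa> m b \<and> rel n a m b)"
  unfolding e_def limit_map_def by (simp add: limit_rel_iff)

lemma e_eq_rel:
  assumes "a \<in> R n" "b \<in> R m"
  shows "e n a = e m b \<longleftrightarrow> rel n a m b"
proof
  assume "e n a = e m b"
  moreover have "(m, \<kappa> m b) \<in> e m b" using assms rel_refl by (auto simp: mem_e)
  ultimately have "(m, \<kappa> m b) \<in> e n a" by simp
  then obtain b' where "b' \<in> R m" "\<kappa> m b = \<kappa> m b'" "rel n a m b'"
    unfolding mem_e[OF assms(1)] by blast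
  then show "rel n a m b" using assms inj_on_eq_iff[OF inj_on_\<kappa>] by metis
next
  assume "rel n a m b"
  then have "(k, y) \<in> e n a \<longleftrightarrow> (k, y) \<in> e m b" for k y
    unfolding mem_e[OF assms(1)] mem_e[OF assms(2)] using rel_sym rel_trans by blast
  then show "e n a = e m b" by auto
qed

lemma e_inj: "a \<in> R n \<Longrightarrow> b \<in> R n \<Longrightarrow> e n a = e n b \<longleftrightarrow> a = b"
  by (simp add: e_eq_rel rel_iff[of n n])

lemma e_up: "a \<in> R n \<Longrightarrow> e (n + i) ((B ^^ i) a) = e n a"
  by (simp add: e_eq_rel pow_R rel_iff[of _ "n + i"])

lemma e_Suc: "a \<in> R n \<Longrightarrow> e (Suc n) (B a) = e n a"
  using e_up[of a n 1] by simp

lemma points_V: "points V = (\<Union>n. e n ` R n)"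
  unfolding V_def direct_limit_def e_def limit_map_def quotient_def by (auto simp: points_E)

lemma e_in_V [simp]: "a \<in> R n \<Longrightarrow> e n a \<in> points V"
  by (auto simp: points_V)

text \<open>The steps increase, so finitely many points have coordinates in one common step. Stated
  with \<open>eventually\<close>, this is a mere conjunction, and algebraic identities in the limit
  reduce to identities in the Banach space.\<close>

lemma eventually_representable:
  assumes "x \<in> points V"
  shows "eventually (\<lambda>N. \<exists>a\<in>R N. x = e N a) sequentially"
proof -
  obtain n a where "a \<in> R n" "x = e n a" using assms by (auto simp: points_V)
  then have "\<exists>a\<in>R N. x = e N a" if "n \<le> N" for N
    using that pow_R[of a n "N - n"] e_up[of a n "N - n"] by (intro bexI[of _ "(B ^^ (N - n)) a"]) simp_all
  then show ?thesis by (auto simp: eventually_sequentially)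
qed

lemma obtain_rep:
  assumes "x \<in> points V"
  obtains n a where "a \<in> R n" "x = e n a"
  using assms by (auto simp: points_V)

lemma obtain_rep2:
  assumes "x \<in> points V" "y \<in> points V"
  obtains n a b where "a \<in> R n" "b \<in> R n" "x = e n a" "y = e n b"
proof -
  have "eventually (\<lambda>N. (\<exists>a\<in>R N. x = e N a) \<and> (\<exists>b\<in>R N. y = e N b)) sequentially"
    using assms[THEN eventually_representable] by (rule eventually_conj)
  then show ?thesis using that eventually_happens'[OF sequentially_bot] by blast
qed

lemma obtain_rep3:
  assumes "x \<in> points V" "y \<in> points V" "z \<in> points V"
  obtains n a b c where "a \<in> R n" "b \<in> R n" "c \<in> R n" "x = e n a" "y = e n b" "z = e n c"
proof -
  have "eventually (\<lambda>N. (\<exists>a\<in>R N. x = e N a) \<and> (\<exists>b\<in>R N. y = e N b) \<and> (\<exists>c\<in>R N. z = e N c)) sequentially"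
    using assms[THEN eventually_representable] by (intro eventually_conj)
  then show ?thesis using that eventually_happens'[OF sequentially_bot] by blast
qed

lemma e_add:
  assumes ab: "a \<in> R n" "b \<in> R n"
  shows "vadd V (e n a) (e n b) = e n (a + b)"
proof -
  \<comment> \<open>The sum in the direct limit is a union over all pairs of representatives in a
    common step. All of them give the same class and at least one pair exists, so the family is a
    singleton.\<close>
  let ?S = "{limit_map E l k (vadd (E k) x y) | k x y. (k, x) \<in> e n a \<and> (k, y) \<in> e n b}"
  have "limit_map E l k (vadd (E k) x y) = e n (a + b)" if kx: "(k, x) \<in> e n a" and ky: "(k, y) \<in> e n b" for k x y
  proof -
    obtain c where c: "c \<in> R k" "x = \<kappa> k c" "rel n a k c" using kx unfolding mem_e[OF ab(1)] by blast
    obtain d where d: "d \<in> R k" "y = \<kappa> k d" "rel n b k d" using ky unfolding mem_e[OF ab(2)] by blast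
    have "rel k (c + d) n (a + b)"
      using c(3) d(3) by (simp add: rel_iff[of _ "max n k"] pow_add)
    then have "e k (c + d) = e n (a + b)" using ab c d by (simp add: e_eq_rel R_add)
    then show ?thesis using c d by (simp add: vadd_\<kappa> e_def)
  qed
  moreover have "(n, \<kappa> n a) \<in> e n a" "(n, \<kappa> n b) \<in> e n b" using ab rel_refl by (auto simp: mem_e)
  ultimately have "?S = {e n (a + b)}" by blast
  then have "\<Union>?S = e n (a + b)" by simp
  then show ?thesis unfolding V_def direct_limit_def by simp
qed

lemma e_scale:
  assumes a: "a \<in> R n"
  shows "vscale V c (e n a) = e n (scl c a)"
proof -
  let ?S = "{limit_map E l k (vscale (E k) c x) | k x. (k, x) \<in> e n a}"
  have "limit_map E l k (vscale (E k) c x) = e n (scl c a)" if kx: "(k, x) \<in> e n a" for k x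
  proof -
    obtain d where d: "d \<in> R k" "x = \<kappa> k d" "rel n a k d" using kx unfolding mem_e[OF a] by blast
    have "rel k (scl c d) n (scl c a)"
      using d(3) by (simp add: rel_iff[of _ "max n k"] pow_scl)
    then have "e k (scl c d) = e n (scl c a)" using a d by (simp add: e_eq_rel R_scl)
    then show ?thesis using d by (simp add: vscale_\<kappa> e_def)
  qed
  moreover have "(n, \<kappa> n a) \<in> e n a" using a rel_refl by (auto simp: mem_e)
  ultimately have "?S = {e n (scl c a)}" by blast
  then have "\<Union>?S = e n (scl c a)" by simp
  then show ?thesis unfolding V_def direct_limit_def by simp
qed

lemma e_zero: "e n 0 = vzero V"
proof -
  have "e 0 0 = vzero V" unfolding e_def V_def direct_limit_def by (simp add: vzero_\<kappa>)
  then show ?thesis using e_up[OF R_zero, of 0 n] by (simp add: pow_zero)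
qed

lemma e_diff: "a \<in> R n \<Longrightarrow> b \<in> R n \<Longrightarrow> vdiff V (e n a) (e n b) = e n (a - b)"
  unfolding vdiff_def by (simp add: e_scale e_add R_minus)

lemma zero_in_V [simp]: "vzero V \<in> points V"
  using e_in_V[OF R_zero] by (simp add: e_zero)

lemma vadd_in_V [simp]:
  assumes "x \<in> points V" "y \<in> points V"
  shows "vadd V x y \<in> points V"
  using assms by (rule obtain_rep2) (simp add: e_add R_add)

lemma vscale_in_V [simp]: "x \<in> points V \<Longrightarrow> vscale V c x \<in> points V"
  by (elim obtain_rep) (simp add: e_scale R_scl)

lemma vdiff_in_V [simp]: "x \<in> points V \<Longrightarrow> y \<in> points V \<Longrightarrow> vdiff V x y \<in> points V"
  by (simp add: vdiff_def)

lemma vadd_assoc: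
  assumes "x \<in> points V" "y \<in> points V" "z \<in> points V"
  shows "vadd V (vadd V x y) z = vadd V x (vadd V y z)"
  using assms by (rule obtain_rep3) (simp add: e_add R_add add.assoc)

lemma vadd_zero: "x \<in> points V \<Longrightarrow> vadd V x (vzero V) = x"
  using e_add[OF _ R_zero] by (elim obtain_rep) (simp add: e_zero)

lemma vdiff_self: "x \<in> points V \<Longrightarrow> vdiff V x x = vzero V"
  by (elim obtain_rep) (simp add: e_diff e_zero)

lemma vadd_vdiff:
  assumes "x \<in> points V" "y \<in> points V"
  shows "vadd V x (vdiff V y x) = y"
  using assms by (rule obtain_rep2) (simp add: e_diff e_add R_diff)

section \<open>The topology of the inductive limit\<close>

text \<open>\<open>S \<epsilon> N\<close> consists of the sums \<open>e 0 a\<^sub>0 + \<dots> + e N a\<^sub>N\<close> with \<open>norm a\<^sub>n < \<epsilon> n\<close>, expressed in step \<open>N\<close>.\<close>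

primrec S :: "(nat \<Rightarrow> real) \<Rightarrow> nat \<Rightarrow> 'a set" where
  "S \<epsilon> 0 = {a \<in> R 0. norm a < \<epsilon> 0}"
| "S \<epsilon> (Suc N) = {B s + a | s a. s \<in> S \<epsilon> N \<and> a \<in> R (Suc N) \<and> norm a < \<epsilon> (Suc N)}"

abbreviation pos :: "(nat \<Rightarrow> real) \<Rightarrow> bool" where
  "pos \<epsilon> \<equiv> \<forall>n. 0 < \<epsilon> n"

lemma S_R: "s \<in> S \<epsilon> N \<Longrightarrow> s \<in> R N"
  by (induction N arbitrary: s) (auto intro: R_add B_R)

lemma S_zero: "pos \<epsilon> \<Longrightarrow> 0 \<in> S \<epsilon> N"
proof (induction N)
  case (Suc N)
  then show ?case using R_zero by (auto intro!: exI[of _ 0] simp: B.zero)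
qed (simp add: R_zero)

lemma S_B: "pos \<epsilon> \<Longrightarrow> s \<in> S \<epsilon> N \<Longrightarrow> B s \<in> S \<epsilon> (Suc N)"
  unfolding S.simps mem_Collect_eq by (intro exI[of _ s] exI[of _ 0]) (simp add: R_zero)

lemma S_pow: "pos \<epsilon> \<Longrightarrow> s \<in> S \<epsilon> N \<Longrightarrow> (B ^^ i) s \<in> S \<epsilon> (N + i)"
proof (induction i)
  case (Suc i)
  then show ?case using S_B[of \<epsilon> "(B ^^ i) s" "N + i"] by simp
qed simp

lemma S_ball:
  assumes "pos \<epsilon>" "a \<in> R N" "norm a < \<epsilon> N"
  shows "a \<in> S \<epsilon> N"
proof (cases N)
  case (Suc M)
  have "B 0 + a \<in> S \<epsilon> (Suc M)"
    using assms S_zero[OF assms(1), of M] unfolding Suc S.simps by blast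
  then show ?thesis by (simp add: Suc B.zero)
qed (use assms in simp)

lemma S_mono: "(\<And>n. n \<le> N \<Longrightarrow> \<epsilon> n \<le> \<delta> n) \<Longrightarrow> s \<in> S \<epsilon> N \<Longrightarrow> s \<in> S \<delta> N"
proof (induction N arbitrary: s)
  case 0
  then show ?case using order_less_le_trans[of "norm s" "\<epsilon> 0" "\<delta> 0"] by simp
next
  case (Suc N)
  then obtain t a where ta: "s = B t + a" "t \<in> S \<epsilon> N" "a \<in> R (Suc N)" "norm a < \<epsilon> (Suc N)" by auto
  moreover have "t \<in> S \<delta> N" using Suc.IH[OF _ ta(2)] Suc.prems(1) by simp
  moreover have "norm a < \<delta> (Suc N)" using ta(4) Suc.prems(1)[of "Suc N"] by simp
  ultimately show ?case by auto
qed

lemma S_add: "s \<in> S \<epsilon> N \<Longrightarrow> t \<in> S \<delta> N \<Longrightarrow> s + t \<in> S (\<lambda>n. \<epsilon> n + \<delta> n) N"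
proof (induction N arbitrary: s t)
  case 0
  then show ?case using norm_triangle_ineq[of s t] by (simp add: R_add)
next
  case (Suc N)
  obtain s' a where s: "s = B s' + a" "s' \<in> S \<epsilon> N" "a \<in> R (Suc N)" "norm a < \<epsilon> (Suc N)"
    using Suc.prems(1) by auto
  obtain t' b where t: "t = B t' + b" "t' \<in> S \<delta> N" "b \<in> R (Suc N)" "norm b < \<delta> (Suc N)"
    using Suc.prems(2) by auto
  have "s + t = B (s' + t') + (a + b)" by (simp add: s(1) t(1) B.add)
  moreover have "s' + t' \<in> S (\<lambda>n. \<epsilon> n + \<delta> n) N" by (rule Suc.IH[OF s(2) t(2)])
  moreover have "norm (a + b) < \<epsilon> (Suc N) + \<delta> (Suc N)"
    using norm_triangle_ineq[of a b] s(4) t(4) by linarith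
  ultimately show ?case using R_add[OF s(3) t(3)] unfolding S.simps mem_Collect_eq by blast
qed

lemma S_scl: "s \<in> S \<epsilon> N \<Longrightarrow> c \<noteq> 0 \<Longrightarrow> scl c s \<in> S (\<lambda>n. norm c * \<epsilon> n) N"
proof (induction N arbitrary: s)
  case 0
  then show ?case by (simp add: R_scl norm_scl)
next
  case (Suc N)
  obtain s' a where s: "s = B s' + a" "s' \<in> S \<epsilon> N" "a \<in> R (Suc N)" "norm a < \<epsilon> (Suc N)"
    using Suc.prems(1) by auto
  have "scl c s = B (scl c s') + scl c a" by (simp add: s(1) B.scale scale_right_distrib)
  moreover have "scl c s' \<in> S (\<lambda>n. norm c * \<epsilon> n) N" by (rule Suc.IH[OF s(2) Suc.prems(2)])
  moreover have "norm (scl c a) < norm c * \<epsilon> (Suc N)" using s(4) Suc.prems(2) by (simp add: norm_scl)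
  ultimately show ?case using R_scl[OF s(3)] unfolding S.simps mem_Collect_eq by blast
qed

text \<open>The weights scale the radii to \<open>u * \<epsilon> n\<close> and
  \<open>v * \<epsilon> n\<close>, which add up to \<open>\<epsilon> n\<close> again. Vanishing
  weights are treated apart, since scaling the strict bounds requires a nonzero factor.\<close>

lemma convex_S: "convex (S \<epsilon> N)"
proof (rule convexI)
  fix s t and u v :: real
  assume st: "s \<in> S \<epsilon> N" "t \<in> S \<epsilon> N" and uv: "0 \<le> u" "0 \<le> v" "u + v = 1"
  show "u *\<^sub>R s + v *\<^sub>R t \<in> S \<epsilon> N"
  proof (cases "u = 0 \<or> v = 0")
    case True
    then show ?thesis using st uv by auto
  next
    case False
    have "scl (of_real u) s + scl (of_real v) t \<in> S (\<lambda>n. norm (of_real u :: 'k) * \<epsilon> n + norm (of_real v :: 'k) * \<epsilon> n) N"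
      using False by (intro S_add S_scl st) auto
    also have "(\<lambda>n. norm (of_real u :: 'k) * \<epsilon> n + norm (of_real v :: 'k) * \<epsilon> n) = \<epsilon>"
      using uv by (simp add: distrib_right[symmetric])
    finally show ?thesis by (simp add: scl_of_real)
  qed
qed

definition U :: "(nat \<Rightarrow> real) \<Rightarrow> (nat \<times> 'v) set set" where
  "U \<epsilon> = (\<Union>N. e N ` S \<epsilon> N)"

lemma U_I: "s \<in> S \<epsilon> N \<Longrightarrow> e N s \<in> U \<epsilon>"
  unfolding U_def by blast

lemma U_rep:
  assumes "pos \<epsilon>" "x \<in> U \<epsilon>"
  obtains N where "\<And>M. N \<le> M \<Longrightarrow> \<exists>s\<in>S \<epsilon> M. x = e M s"
proof -
  obtain N s where N: "s \<in> S \<epsilon> N" "x = e N s" using assms(2) unfolding U_def by auto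
  have "\<exists>s\<in>S \<epsilon> M. x = e M s" if "N \<le> M" for M
  proof
    show "(B ^^ (M - N)) s \<in> S \<epsilon> M" using S_pow[OF assms(1) N(1), of "M - N"] that by simp
    show "x = e M ((B ^^ (M - N)) s)"
      using e_up[OF S_R[OF N(1)], of "M - N"] that N(2) by simp
  qed
  then show ?thesis by (rule that)
qed

lemma U_rep2:
  assumes "pos \<epsilon>" "x \<in> U \<epsilon>" "pos \<delta>" "y \<in> U \<delta>"
  obtains N s t where "s \<in> S \<epsilon> N" "t \<in> S \<delta> N" "x = e N s" "y = e N t"
proof -
  obtain N where N: "\<And>M. N \<le> M \<Longrightarrow> \<exists>s\<in>S \<epsilon> M. x = e M s" using U_rep assms(1,2) by metis
  obtain K where K: "\<And>M. K \<le> M \<Longrightarrow> \<exists>s\<in>S \<delta> M. y = e M s" using U_rep assms(3,4) by metis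
  show ?thesis using N[of "max N K"] K[of "max N K"] that by auto
qed

text \<open>An element with coordinate \<open>a\<close> in step \<open>N\<close> can lie in
  \<open>U \<epsilon>\<close> although \<open>a\<close> is not in \<open>S \<epsilon> N\<close>:
  summands from later steps may contribute. Membership therefore has to be tested in all later
  steps.\<close>

lemma U_e_iff:
  assumes "pos \<epsilon>" "a \<in> R N"
  shows "e N a \<in> U \<epsilon> \<longleftrightarrow> (\<exists>i. (B ^^ i) a \<in> S \<epsilon> (N + i))"
proof
  assume "e N a \<in> U \<epsilon>"
  then obtain K where "\<And>M. K \<le> M \<Longrightarrow> \<exists>s\<in>S \<epsilon> M. e N a = e M s" using U_rep assms(1) by metis
  from this[of "N + K"] obtain s where s: "s \<in> S \<epsilon> (N + K)" "e N a = e (N + K) s" by auto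
  then have "s = (B ^^ K) a"
    using e_up[OF assms(2), of K] e_inj[OF pow_R[OF assms(2), of K] S_R[OF s(1)]] by simp
  then show "\<exists>i. (B ^^ i) a \<in> S \<epsilon> (N + i)" using s(1) by blast
next
  assume "\<exists>i. (B ^^ i) a \<in> S \<epsilon> (N + i)"
  then obtain i where "(B ^^ i) a \<in> S \<epsilon> (N + i)" by blast
  then show "e N a \<in> U \<epsilon>" unfolding U_def e_up[OF assms(2), of i, symmetric] by blast
qed

lemma U_ball: "pos \<epsilon> \<Longrightarrow> a \<in> R N \<Longrightarrow> norm a < \<epsilon> N \<Longrightarrow> e N a \<in> U \<epsilon>"
  by (rule U_I[OF S_ball])

lemma U_zero: "pos \<epsilon> \<Longrightarrow> vzero V \<in> U \<epsilon>"
  using U_ball[OF _ R_zero, of \<epsilon> 0] by (simp add: e_zero)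

lemma U_mono: "(\<And>n. \<epsilon> n \<le> \<delta> n) \<Longrightarrow> x \<in> U \<epsilon> \<Longrightarrow> x \<in> U \<delta>"
proof -
  assume "\<And>n. \<epsilon> n \<le> \<delta> n" "x \<in> U \<epsilon>"
  then obtain N s where "s \<in> S \<epsilon> N" "x = e N s" unfolding U_def by auto
  then show ?thesis using U_I[OF S_mono[of N \<epsilon> \<delta> s]] \<open>\<And>n. \<epsilon> n \<le> \<delta> n\<close> by simp
qed

lemma U_add:
  assumes "pos \<epsilon>" "x \<in> U \<epsilon>" "pos \<delta>" "y \<in> U \<delta>"
  shows "vadd V x y \<in> U (\<lambda>n. \<epsilon> n + \<delta> n)"
  using assms
proof (rule U_rep2)
  fix N s t assume "s \<in> S \<epsilon> N" "t \<in> S \<delta> N" "x = e N s" "y = e N t"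
  then show ?thesis using U_I[OF S_add] S_R by (simp add: e_add)
qed

lemma U_scl: "x \<in> U \<epsilon> \<Longrightarrow> c \<noteq> 0 \<Longrightarrow> vscale V c x \<in> U (\<lambda>n. norm c * \<epsilon> n)"
  using U_I[OF S_scl] S_R unfolding U_def by (auto simp: e_scale)

lemma U_half:
  assumes "pos \<epsilon>" "x \<in> U (\<lambda>n. \<epsilon> n / 2)" "y \<in> U (\<lambda>n. \<epsilon> n / 2)"
  shows "vadd V x y \<in> U \<epsilon>"
  using U_add[OF _ assms(2) _ assms(3)] assms(1) by simp

lemma vdiff_swap:
  assumes "x \<in> points V" "y \<in> points V"
  shows "vdiff V x y = vscale V (- 1) (vdiff V y x)"
  using assms by (rule obtain_rep2) (simp add: e_diff e_scale R_diff)

lemma U_sym: "x \<in> points V \<Longrightarrow> y \<in> points V \<Longrightarrow> vdiff V x y \<in> U \<epsilon> \<Longrightarrow> vdiff V y x \<in> U \<epsilon>"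
  using U_scl[of "vdiff V x y" \<epsilon> "- 1"] by (simp add: vdiff_swap[of y x])

lemma vdiff_triangle:
  assumes "x \<in> points V" "y \<in> points V" "z \<in> points V"
  shows "vdiff V x z = vadd V (vdiff V x y) (vdiff V y z)"
  using assms by (rule obtain_rep3) (simp add: e_diff e_add R_diff)

lemma U_triangle:
  assumes "pos \<epsilon>" "x \<in> points V" "y \<in> points V" "z \<in> points V"
    "vdiff V x y \<in> U (\<lambda>n. \<epsilon> n / 2)" "vdiff V y z \<in> U (\<lambda>n. \<epsilon> n / 2)"
  shows "vdiff V x z \<in> U \<epsilon>"
  using U_half[OF assms(1,5,6)] vdiff_triangle[OF assms(2-4)] by simp

section \<open>The linear topology with the zero neighbourhoods \<open>U \<epsilon>\<close>\<close>

definition \<tau> :: "(nat \<times> 'v) set topology" where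
  "\<tau> = topology (\<lambda>W. W \<subseteq> points V \<and>
     (\<forall>w\<in>W. \<exists>\<epsilon>. pos \<epsilon> \<and> (\<forall>x\<in>points V. vdiff V x w \<in> U \<epsilon> \<longrightarrow> x \<in> W)))"

lemma openin_\<tau>: "openin \<tau> W \<longleftrightarrow> W \<subseteq> points V \<and>
     (\<forall>w\<in>W. \<exists>\<epsilon>. pos \<epsilon> \<and> (\<forall>x\<in>points V. vdiff V x w \<in> U \<epsilon> \<longrightarrow> x \<in> W))"
proof -
  have "istopology (\<lambda>W. W \<subseteq> points V \<and>
     (\<forall>w\<in>W. \<exists>\<epsilon>. pos \<epsilon> \<and> (\<forall>x\<in>points V. vdiff V x w \<in> U \<epsilon> \<longrightarrow> x \<in> W)))"
    (is "istopology ?P")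
    unfolding istopology_def
  proof (rule conjI; intro allI impI)
    fix X Y assume X: "?P X" and Y: "?P Y"
    show "?P (X \<inter> Y)"
    proof (intro conjI ballI)
      fix w assume "w \<in> X \<inter> Y"
      then obtain \<epsilon> \<delta> where \<epsilon>: "pos \<epsilon>" "\<forall>x\<in>points V. vdiff V x w \<in> U \<epsilon> \<longrightarrow> x \<in> X"
        and \<delta>: "pos \<delta>" "\<forall>x\<in>points V. vdiff V x w \<in> U \<delta> \<longrightarrow> x \<in> Y"
      proof -
        have "w \<in> X" "w \<in> Y" using \<open>w \<in> X \<inter> Y\<close> by blast+
        then obtain \<epsilon> \<delta> where "pos \<epsilon>" "\<forall>x\<in>points V. vdiff V x w \<in> U \<epsilon> \<longrightarrow> x \<in> X"
          "pos \<delta>" "\<forall>x\<in>points V. vdiff V x w \<in> U \<delta> \<longrightarrow> x \<in> Y"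
          using X Y by blast
        then show ?thesis by (rule that)
      qed
      have "x \<in> U \<epsilon> \<and> x \<in> U \<delta>" if "x \<in> U (\<lambda>n. min (\<epsilon> n) (\<delta> n))" for x
        using that by (auto intro: U_mono[rotated])
      then show "\<exists>\<epsilon>. pos \<epsilon> \<and> (\<forall>x\<in>points V. vdiff V x w \<in> U \<epsilon> \<longrightarrow> x \<in> X \<inter> Y)"
        using \<epsilon> \<delta> by (intro exI[of _ "\<lambda>n. min (\<epsilon> n) (\<delta> n)"]) auto
    qed (use X in blast)
  next
    fix \<K> assume K: "\<forall>K\<in>\<K>. ?P K"
    show "?P (\<Union>\<K>)"
    proof (intro conjI ballI)
      show "\<Union>\<K> \<subseteq> points V" using K by blast
      fix w assume "w \<in> \<Union>\<K>"
      then obtain K where "K \<in> \<K>" "w \<in> K" by blast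
      then obtain \<epsilon> where "pos \<epsilon>" "\<forall>x\<in>points V. vdiff V x w \<in> U \<epsilon> \<longrightarrow> x \<in> K" using K by blast
      then show "\<exists>\<epsilon>. pos \<epsilon> \<and> (\<forall>x\<in>points V. vdiff V x w \<in> U \<epsilon> \<longrightarrow> x \<in> \<Union>\<K>)"
        using \<open>K \<in> \<K>\<close> by blast
    qed
  qed
  then show ?thesis unfolding \<tau>_def by (simp add: topology_inverse')
qed

lemma openin_\<tau>_points: "openin \<tau> (points V)"
  unfolding openin_\<tau> by (auto intro!: exI[of _ "\<lambda>_. 1"])

lemma topspace_\<tau>: "topspace \<tau> = points V"
  using openin_\<tau>_points openin_subset[OF openin_topspace, of \<tau>] openin_subset[OF openin_\<tau>_points]
  by (meson antisym openin_\<tau> openin_topspace)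

text \<open>The sets \<open>U \<epsilon>\<close> are not themselves assumed open. \<open>W\<close>
  is the interior of the translate to \<open>w\<close>: it collects the points around which some
  smaller translate still fits. Halving the radii shows that it is open.\<close>

lemma \<tau>_neighbourhood:
  assumes "pos \<epsilon>" "w \<in> points V"
  obtains W where "openin \<tau> W" "w \<in> W" "\<And>x. x \<in> W \<Longrightarrow> vdiff V x w \<in> U \<epsilon>"
proof -
  define W where "W = {x \<in> points V. \<exists>\<delta>. pos \<delta> \<and>
    (\<forall>y\<in>points V. vdiff V y x \<in> U \<delta> \<longrightarrow> vdiff V y w \<in> U \<epsilon>)}"
  have "openin \<tau> W"
    unfolding openin_\<tau>
  proof (intro conjI ballI)
    fix x assume "x \<in> W"
    then obtain \<delta> where x: "x \<in> points V" and \<delta>: "pos \<delta>"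
      "\<And>y. y \<in> points V \<Longrightarrow> vdiff V y x \<in> U \<delta> \<Longrightarrow> vdiff V y w \<in> U \<epsilon>"
      unfolding W_def by blast
    have "y \<in> W" if y: "y \<in> points V" "vdiff V y x \<in> U (\<lambda>n. \<delta> n / 2)" for y
      unfolding W_def
    proof (intro CollectI conjI exI[of _ "\<lambda>n. \<delta> n / 2"] ballI impI y(1))
      show "pos (\<lambda>n. \<delta> n / 2)" using \<delta>(1) by simp
      fix z assume z: "z \<in> points V" "vdiff V z y \<in> U (\<lambda>n. \<delta> n / 2)"
      show "vdiff V z w \<in> U \<epsilon>"
        by (rule \<delta>(2)[OF z(1)]) (rule U_triangle[OF \<delta>(1) z(1) y(1) x z(2) y(2)])
    qed
    then show "\<exists>\<delta>. pos \<delta> \<and> (\<forall>y\<in>points V. vdiff V y x \<in> U \<delta> \<longrightarrow> y \<in> W)"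
      using \<delta>(1) by (intro exI[of _ "\<lambda>n. \<delta> n / 2"]) simp
  qed (auto simp: W_def)
  moreover have "w \<in> W" unfolding W_def using assms by blast
  moreover have "vdiff V x w \<in> U \<epsilon>" if x: "x \<in> W" for x
  proof -
    obtain \<delta> where \<delta>: "x \<in> points V" "pos \<delta>"
      "\<forall>y\<in>points V. vdiff V y x \<in> U \<delta> \<longrightarrow> vdiff V y w \<in> U \<epsilon>"
      using x unfolding W_def by blast
    then show ?thesis using U_zero[OF \<delta>(2)] vdiff_self[OF \<delta>(1)] by simp
  qed
  ultimately show ?thesis by (rule that)
qed

lemma vadd_vdiff_vadd:
  assumes "x \<in> points V" "y \<in> points V" "x' \<in> points V" "y' \<in> points V"
  shows "vdiff V (vadd V x' y') (vadd V x y) = vadd V (vdiff V x' x) (vdiff V y' y)"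
proof -
  have "eventually (\<lambda>N. (\<exists>a\<in>R N. x = e N a) \<and> (\<exists>b\<in>R N. y = e N b) \<and>
      (\<exists>a\<in>R N. x' = e N a) \<and> (\<exists>b\<in>R N. y' = e N b)) sequentially"
    using assms[THEN eventually_representable] by (intro eventually_conj)
  then obtain n a b a' b' where "a \<in> R n" "b \<in> R n" "a' \<in> R n" "b' \<in> R n"
    "x = e n a" "y = e n b" "x' = e n a'" "y' = e n b'"
    using eventually_happens'[OF sequentially_bot] by blast
  then show ?thesis by (simp add: e_add e_diff R_add R_diff algebra_simps)
qed

lemma continuous_vadd_\<tau>: "continuous_map (prod_topology \<tau> \<tau>) \<tau> (\<lambda>(x, y). vadd V x y)"
  unfolding continuous_map_def
proof (intro conjI allI impI)
  show "(\<lambda>(x, y). vadd V x y) \<in> topspace (prod_topology \<tau> \<tau>) \<rightarrow> topspace \<tau>"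
    by (auto simp: topspace_\<tau>)
  fix W assume W: "openin \<tau> W"
  let ?P = "{p \<in> topspace (prod_topology \<tau> \<tau>). (case p of (x, y) \<Rightarrow> vadd V x y) \<in> W}"
  show "openin (prod_topology \<tau> \<tau>) ?P"
    unfolding openin_prod_topology_alt
  proof (intro allI impI)
    fix x y assume "(x, y) \<in> ?P"
    then have xy: "x \<in> points V" "y \<in> points V" "vadd V x y \<in> W" by (auto simp: topspace_\<tau>)
    obtain \<epsilon> where \<epsilon>: "pos \<epsilon>" "\<And>z. z \<in> points V \<Longrightarrow> vdiff V z (vadd V x y) \<in> U \<epsilon> \<Longrightarrow> z \<in> W"
      using W xy(3) unfolding openin_\<tau> by blast
    have half: "pos (\<lambda>n. \<epsilon> n / 2)" using \<epsilon>(1) by simp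
    obtain X where X: "openin \<tau> X" "x \<in> X" "\<And>z. z \<in> X \<Longrightarrow> vdiff V z x \<in> U (\<lambda>n. \<epsilon> n / 2)"
      using \<tau>_neighbourhood[OF half xy(1)] by blast
    obtain Y where Y: "openin \<tau> Y" "y \<in> Y" "\<And>z. z \<in> Y \<Longrightarrow> vdiff V z y \<in> U (\<lambda>n. \<epsilon> n / 2)"
      using \<tau>_neighbourhood[OF half xy(2)] by blast
    have sub: "X \<subseteq> points V" "Y \<subseteq> points V" using X(1) Y(1) openin_subset topspace_\<tau> by blast+
    have "vadd V x' y' \<in> W" if xy': "x' \<in> X" "y' \<in> Y" for x' y'
    proof (rule \<epsilon>(2))
      have in_V: "x' \<in> points V" "y' \<in> points V" using xy' sub by blast+
      then show "vadd V x' y' \<in> points V" by simp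
      show "vdiff V (vadd V x' y') (vadd V x y) \<in> U \<epsilon>"
        unfolding vadd_vdiff_vadd[OF xy(1,2) in_V]
        by (rule U_half[OF \<epsilon>(1) X(3)[OF xy'(1)] Y(3)[OF xy'(2)]])
    qed
    then have "X \<times> Y \<subseteq> ?P" using sub by (auto simp: topspace_\<tau>)
    then show "\<exists>X Y. openin \<tau> X \<and> openin \<tau> Y \<and> x \<in> X \<and> y \<in> Y \<and> X \<times> Y \<subseteq> ?P"
      using X(1,2) Y(1,2) by blast
  qed
qed

lemma vscale_vdiff_vscale:
  assumes "x \<in> points V" "y \<in> points V"
  shows "vdiff V (vscale V d y) (vscale V c x) = vadd V (vscale V d (vdiff V y x)) (vscale V (d - c) x)"
  using assms by (rule obtain_rep2)
    (simp add: e_scale e_diff e_add R_scl R_diff scale_right_diff_distrib scale_left_diff_distrib)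

lemma continuous_vscale_\<tau>: "continuous_map (prod_topology euclidean \<tau>) \<tau> (\<lambda>(c, x). vscale V c x)"
  unfolding continuous_map_def
proof (intro conjI allI impI)
  show "(\<lambda>(c, x). vscale V c x) \<in> topspace (prod_topology euclidean \<tau>) \<rightarrow> topspace \<tau>"
    by (auto simp: topspace_\<tau>)
  fix W assume W: "openin \<tau> W"
  let ?P = "{p \<in> topspace (prod_topology euclidean \<tau>). (case p of (c, x) \<Rightarrow> vscale V c x) \<in> W}"
  show "openin (prod_topology euclidean \<tau>) ?P"
    unfolding openin_prod_topology_alt
  proof (intro allI impI)
    fix c x assume "(c, x) \<in> ?P"
    then have x: "x \<in> points V" "vscale V c x \<in> W" by (auto simp: topspace_\<tau>)
    obtain \<epsilon> where \<epsilon>: "pos \<epsilon>" "\<And>z. z \<in> points V \<Longrightarrow> vdiff V z (vscale V c x) \<in> U \<epsilon> \<Longrightarrow> z \<in> W"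
      using W x(2) unfolding openin_\<tau> by blast
    \<comment> \<open>The difference is split as \<open>d (y - x) + (d - c) x\<close>. For the first
      part, \<open>M\<close> bounds all factors \<open>d\<close> at distance less than
      \<open>1\<close> from \<open>c\<close>; for the second, a coordinate \<open>a\<close> of
      \<open>x\<close> in one fixed step \<open>n\<close> is enough. The summand \<open>1\<close>
      added to \<open>norm a\<close> avoids a division by zero.\<close>
    obtain n a where a: "a \<in> R n" "x = e n a" using x(1) by (rule obtain_rep)
    define M where "M = norm c + 1"
    have M: "M > 0" unfolding M_def by (simp add: add_nonneg_pos)
    define r where "r = min 1 (\<epsilon> n / (2 * (norm a + 1)))"
    have na: "norm a + 1 > 0" by (simp add: add_nonneg_pos)
    have \<epsilon>n: "0 < \<epsilon> n" using \<epsilon>(1) by blast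
    then have r: "r > 0" "r \<le> 1" using na by (simp_all add: r_def)
    have small: "pos (\<lambda>n. \<epsilon> n / (2 * M))" using \<epsilon>(1) M by simp
    obtain X where X: "openin \<tau> X" "x \<in> X" "\<And>z. z \<in> X \<Longrightarrow> vdiff V z x \<in> U (\<lambda>n. \<epsilon> n / (2 * M))"
      using \<tau>_neighbourhood[OF small x(1)] by blast
    have sub: "X \<subseteq> points V" using X(1) openin_subset topspace_\<tau> by blast
    have "vscale V d y \<in> W" if d: "d \<in> ball c r" and y: "y \<in> X" for d y
    proof (rule \<epsilon>(2))
      have y_V: "y \<in> points V" using y sub by blast
      then show "vscale V d y \<in> points V" by simp
      have dc: "norm (d - c) < r" using d by (simp add: dist_norm norm_minus_commute)
      have "norm d \<le> M" unfolding M_def using dc r(2) norm_triangle_ineq[of "d - c" c] by simp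
      have "vscale V d (vdiff V y x) \<in> U (\<lambda>n. \<epsilon> n / 2)"
      proof (cases "d = 0")
        case True
        have "vscale V d (vdiff V y x) = vzero V"
          using y_V x(1) by (rule obtain_rep2) (simp add: True e_diff e_scale R_diff e_zero)
        then show ?thesis using U_zero[of "\<lambda>n. \<epsilon> n / 2"] \<epsilon>(1) by simp
      next
        case False
        show ?thesis
        proof (rule U_mono[OF _ U_scl[OF X(3)[OF y] False]])
          fix n
          have "norm d * (\<epsilon> n / (2 * M)) \<le> M * (\<epsilon> n / (2 * M))"
            using \<open>norm d \<le> M\<close> small by (intro mult_right_mono) (auto intro: less_imp_le)
          also have "\<dots> = \<epsilon> n / 2" using M by simp
          finally show "norm d * (\<epsilon> n / (2 * M)) \<le> \<epsilon> n / 2" .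
        qed
      qed
      moreover have "vscale V (d - c) x \<in> U (\<lambda>n. \<epsilon> n / 2)"
      proof -
        have "norm (d - c) * norm a \<le> r * norm a" using dc by (intro mult_right_mono) auto
        also have "\<dots> < r * (norm a + 1)" using r(1) by simp
        also have "\<dots> \<le> \<epsilon> n / (2 * (norm a + 1)) * (norm a + 1)"
          using na by (intro mult_right_mono) (simp_all add: r_def)
        also have "\<dots> = \<epsilon> n / 2" using na by (simp add: divide_simps)
        finally have "norm (scl (d - c) a) < \<epsilon> n / 2" by (simp add: norm_scl)
        then show ?thesis
          using U_ball[of "\<lambda>n. \<epsilon> n / 2" "scl (d - c) a" n] \<epsilon>(1) a by (simp add: e_scale R_scl)
      qed
      ultimately show "vdiff V (vscale V d y) (vscale V c x) \<in> U \<epsilon>"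
        unfolding vscale_vdiff_vscale[OF x(1) y_V] by (rule U_half[OF \<epsilon>(1)])
    qed
    then have "ball c r \<times> X \<subseteq> ?P" using sub by (auto simp: topspace_\<tau>)
    then show "\<exists>C X. openin euclidean C \<and> openin \<tau> X \<and> c \<in> C \<and> x \<in> X \<and> C \<times> X \<subseteq> ?P"
      using X(1,2) r(1) by (intro exI[of _ "ball c r"] exI[of _ X]) simp
  qed
qed

lemma continuous_limit_map_iff:
  "continuous_map (norm_topology (E n)) \<sigma> (limit_map E l n) \<longleftrightarrow> continuous_map (top_of_set (R n)) \<sigma> (e n)"
proof -
  have "quotient_map (top_of_set (R n)) (norm_topology (E n)) (\<kappa> n)"
    using homeo_\<kappa> unfolding homeomorphic_map_def by blast
  moreover have "limit_map E l n \<circ> \<kappa> n = e n" by (simp add: e_def fun_eq_iff)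
  ultimately show ?thesis by (simp flip: continuous_compose_quotient_map_eq)
qed

lemma continuous_e_\<tau>: "continuous_map (top_of_set (R n)) \<tau> (e n)"
  unfolding continuous_map_def
proof (intro conjI allI impI)
  show "e n \<in> topspace (top_of_set (R n)) \<rightarrow> topspace \<tau>" by (auto simp: topspace_\<tau>)
  fix W assume W: "openin \<tau> W"
  let ?P = "{a \<in> topspace (top_of_set (R n)). e n a \<in> W}"
  show "openin (top_of_set (R n)) ?P"
    unfolding openin_contains_ball
  proof (intro conjI ballI)
    fix a assume "a \<in> ?P"
    then have a: "a \<in> R n" "e n a \<in> W" by auto
    obtain \<epsilon> where \<epsilon>: "pos \<epsilon>" "\<And>z. z \<in> points V \<Longrightarrow> vdiff V z (e n a) \<in> U \<epsilon> \<Longrightarrow> z \<in> W"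
      using W a(2) unfolding openin_\<tau> by blast
    have "e n b \<in> W" if "b \<in> R n" "dist a b < \<epsilon> n" for b
    proof (rule \<epsilon>(2))
      have "norm (b - a) < \<epsilon> n" using that by (simp add: dist_norm norm_minus_commute)
      then have "e n (b - a) \<in> U \<epsilon>" by (rule U_ball[OF \<epsilon>(1) R_diff[OF that(1) a(1)]])
      then show "vdiff V (e n b) (e n a) \<in> U \<epsilon>" by (simp add: e_diff that a)
    qed (simp add: that)
    then show "\<exists>r>0. ball a r \<inter> R n \<subseteq> ?P" using \<epsilon>(1) by (intro exI[of _ "\<epsilon> n"]) auto
  qed auto
qed

lemma admissible_\<tau>: "admissible_topology E l \<tau>"
  unfolding admissible_topology_def linear_topology_def V_def[symmetric]
  using topspace_\<tau> continuous_vadd_\<tau> continuous_vscale_\<tau> continuous_e_\<tau>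
  by (simp add: continuous_limit_map_iff)

section \<open>Comparison with all admissible topologies\<close>

text \<open>Continuity of addition at zero yields neighbourhoods with
  \<open>Q (n + 1) + Q (n + 1)\<close> inside \<open>Q n\<close>, starting from
  \<open>Q 0 = P\<close>. If the ball of radius \<open>\<epsilon> n\<close> in step \<open>n\<close>
  is mapped into \<open>Q (n + 1)\<close>, then every finite sum from \<open>U \<epsilon>\<close>
  stays in \<open>P\<close>. This works for every linear topology, locally convex or not.\<close>

lemma openin_admissible_imp_\<tau>:
  assumes \<sigma>: "admissible_topology E l \<sigma>" and W: "openin \<sigma> W"
  shows "openin \<tau> W"
proof -
  have top: "topspace \<sigma> = points V" and add: "continuous_map (prod_topology \<sigma> \<sigma>) \<sigma> (\<lambda>(x, y). vadd V x y)"
    and cont: "continuous_map (top_of_set (R n)) \<sigma> (e n)" for n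
    using \<sigma> unfolding admissible_topology_def linear_topology_def V_def[symmetric]
    by (simp_all add: continuous_limit_map_iff)
  have split: "\<exists>P Q. openin \<sigma> P \<and> openin \<sigma> Q \<and> x \<in> P \<and> y \<in> Q \<and> (\<forall>x\<in>P. \<forall>y\<in>Q. vadd V x y \<in> W)"
    if W: "openin \<sigma> W" and xy: "x \<in> points V" "y \<in> points V" "vadd V x y \<in> W" for W x y
  proof -
    define Z where "Z = {p \<in> topspace (prod_topology \<sigma> \<sigma>). (case p of (x, y) \<Rightarrow> vadd V x y) \<in> W}"
    have "openin (prod_topology \<sigma> \<sigma>) Z"
      using add W unfolding continuous_map_def Z_def by blast
    moreover have "(x, y) \<in> Z" using xy top by (simp add: Z_def)
    ultimately have "\<exists>P Q. openin \<sigma> P \<and> openin \<sigma> Q \<and> x \<in> P \<and> y \<in> Q \<and> P \<times> Q \<subseteq> Z"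
      by (simp add: openin_prod_topology_alt)
    then obtain P Q where PQ: "openin \<sigma> P" "openin \<sigma> Q" "x \<in> P" "y \<in> Q" "P \<times> Q \<subseteq> Z"
      by (elim exE conjE)
    have "\<forall>x\<in>P. \<forall>y\<in>Q. vadd V x y \<in> W" using PQ(5) by (auto simp: Z_def)
    then show ?thesis using PQ(1-4) by blast
  qed
  have halve: "\<exists>Q. (openin \<sigma> Q \<and> vzero V \<in> Q) \<and> (\<forall>x\<in>Q. \<forall>y\<in>Q. vadd V x y \<in> P)"
    if P: "openin \<sigma> P \<and> vzero V \<in> P" for P
  proof -
    obtain Q1 Q2 where "openin \<sigma> Q1" "openin \<sigma> Q2" "vzero V \<in> Q1" "vzero V \<in> Q2"
      "\<forall>x\<in>Q1. \<forall>y\<in>Q2. vadd V x y \<in> P"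
      using split[of P "vzero V" "vzero V"] P by (auto simp: vadd_zero)
    then show ?thesis by (intro exI[of _ "Q1 \<inter> Q2"]) auto
  qed
  have "\<exists>\<epsilon>. pos \<epsilon> \<and> (\<forall>x\<in>points V. vdiff V x w \<in> U \<epsilon> \<longrightarrow> x \<in> W)" if w: "w \<in> W" for w
  proof -
    have w_V: "w \<in> points V" using w W openin_subset top by blast
    obtain P where P: "openin \<sigma> P" "vzero V \<in> P" "\<And>y. y \<in> P \<Longrightarrow> vadd V w y \<in> W"
      using split[OF W w_V zero_in_V] w by (auto simp: vadd_zero w_V)
    have "\<exists>Q. Q 0 = P \<and> (\<forall>n. (openin \<sigma> (Q n) \<and> vzero V \<in> Q n) \<and>
        (\<forall>x\<in>Q (Suc n). \<forall>y\<in>Q (Suc n). vadd V x y \<in> Q n))"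
    proof -
      have "\<exists>Q. \<forall>n. ((openin \<sigma> (Q n) \<and> vzero V \<in> Q n) \<and> (n = 0 \<longrightarrow> Q n = P)) \<and>
        (\<forall>x\<in>Q (Suc n). \<forall>y\<in>Q (Suc n). vadd V x y \<in> Q n)"
      proof (rule dependent_nat_choice)
        show "\<exists>Q. (openin \<sigma> Q \<and> vzero V \<in> Q) \<and> (0 = (0::nat) \<longrightarrow> Q = P)" using P(1,2) by blast
        fix Q and n :: nat assume "(openin \<sigma> Q \<and> vzero V \<in> Q) \<and> (n = 0 \<longrightarrow> Q = P)"
        then show "\<exists>Q'. ((openin \<sigma> Q' \<and> vzero V \<in> Q') \<and> (Suc n = 0 \<longrightarrow> Q' = P)) \<and>
            (\<forall>x\<in>Q'. \<forall>y\<in>Q'. vadd V x y \<in> Q)" using halve[of Q] by auto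
      qed
      then show ?thesis by blast
    qed
    then obtain Q where Q0: "Q 0 = P" and Q: "\<And>n. openin \<sigma> (Q n)" "\<And>n. vzero V \<in> Q n"
      "\<And>n x y. x \<in> Q (Suc n) \<Longrightarrow> y \<in> Q (Suc n) \<Longrightarrow> vadd V x y \<in> Q n" by blast
    have "\<exists>r>0. \<forall>a\<in>R n. norm a < r \<longrightarrow> e n a \<in> Q (Suc n)" for n
    proof -
      have "openin (top_of_set (R n)) {a \<in> topspace (top_of_set (R n)). e n a \<in> Q (Suc n)}"
        using cont Q(1) unfolding continuous_map_def by blast
      moreover have "0 \<in> {a \<in> topspace (top_of_set (R n)). e n a \<in> Q (Suc n)}"
        using Q(2) by (simp add: R_zero e_zero)
      ultimately obtain r where "r > 0" "ball 0 r \<inter> R n \<subseteq> {a \<in> topspace (top_of_set (R n)). e n a \<in> Q (Suc n)}"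
        unfolding openin_contains_ball by blast
      then show ?thesis by (intro exI[of _ r]) (auto simp: subset_iff)
    qed
    then obtain \<epsilon> where \<epsilon>: "\<And>n. \<epsilon> n > 0" "\<And>n a. a \<in> R n \<Longrightarrow> norm a < \<epsilon> n \<Longrightarrow> e n a \<in> Q (Suc n)"
      by metis
    have Q_V: "x \<in> points V" if "x \<in> Q n" for x n using that openin_subset[OF Q(1)] top by blast
    \<comment> \<open>The spare summand \<open>v\<close> carries the induction: the summand of the
      next step together with its own spare one lies in \<open>Q (Suc N)\<close> and takes the place
      of \<open>v\<close>.\<close>
    have "vadd V (e N s) v \<in> P" if "s \<in> S \<epsilon> N" "v \<in> Q (Suc N)" for s v N
      using that
    proof (induction N arbitrary: s v)
      case 0
      then show ?case using Q(3)[of "e 0 s" 0 v] \<epsilon>(2)[of s 0] by (simp add: Q0)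
    next
      case (Suc N)
      obtain t a where s: "s = B t + a" "t \<in> S \<epsilon> N" "a \<in> R (Suc N)" "norm a < \<epsilon> (Suc N)"
        using Suc.prems(1) by auto
      have "e (Suc N) s = vadd V (e N t) (e (Suc N) a)"
        using S_R[OF s(2)] s(1,3) by (simp add: e_add[symmetric] B_R e_Suc)
      then have "vadd V (e (Suc N) s) v = vadd V (e N t) (vadd V (e (Suc N) a) v)"
        using S_R[OF s(2)] s(3) Q_V[OF Suc.prems(2)] by (simp add: vadd_assoc)
      moreover have "vadd V (e (Suc N) a) v \<in> Q (Suc N)"
        by (rule Q(3)[OF \<epsilon>(2)[OF s(3,4)] Suc.prems(2)])
      ultimately show ?case using Suc.IH[OF s(2)] by simp
    qed
    then have "e N s \<in> P" if "s \<in> S \<epsilon> N" for N s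
      using that Q(2)[of "Suc N"] vadd_zero[OF e_in_V[OF S_R[OF that]]] by metis
    then have "U \<epsilon> \<subseteq> P" unfolding U_def by blast
    then have "x \<in> W" if "x \<in> points V" "vdiff V x w \<in> U \<epsilon>" for x
      using P(3)[of "vdiff V x w"] that by (auto simp: vadd_vdiff[OF w_V])
    then show ?thesis using \<epsilon>(1) by blast
  qed
  then show ?thesis unfolding openin_\<tau> using openin_subset[OF W] top by blast
qed

text \<open>The topology generated by all admissible ones is itself admissible, so the preceding
  comparison applies to it; conversely it contains the admissible topology
  \<open>\<tau>\<close>.\<close>

lemma limit_topology_eq: "limit_topology E l = \<tau>"
  unfolding topology_eq
  using openin_admissible_imp_\<tau>[OF limit_topology_admissible[OF admissible_\<tau>]]
    limit_topology_finest[OF admissible_\<tau>] by blast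

section \<open>Separation and completeness\<close>

text \<open>One step of the choice of radii. A closed set has positive distance \<open>r\<close>
  from the coordinate of \<open>d\<close>, so thickening it by half of \<open>r\<close> and taking
  the closure still leaves \<open>d\<close> out. The remaining properties of \<open>C\<close> are
  handed on so that the step can be repeated.\<close>

lemma enlarge_avoiding:
  assumes C: "closed C" "convex C" "bounded C" "C \<subseteq> R n" "0 \<in> C" and d: "d \<notin> e n ` C"
  obtains \<epsilon> C' where "\<epsilon> > 0" "closed C'" "convex C'" "bounded C'" "C' \<subseteq> R n" "0 \<in> C'" "d \<notin> e n ` C'"
    "\<forall>c\<in>C. \<forall>a\<in>R n. norm a < \<epsilon> \<longrightarrow> c + a \<in> C'"
proof -
  \<comment> \<open>If \<open>d\<close> has no coordinate in step \<open>n\<close>, there is nothing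
    to avoid and any radius serves.\<close>
  obtain r where r: "r > 0" "\<And>b c. b \<in> R n \<Longrightarrow> d = e n b \<Longrightarrow> c \<in> C \<Longrightarrow> r \<le> dist b c"
  proof (cases "\<exists>b\<in>R n. d = e n b")
    case True
    then obtain b where b: "b \<in> R n" "d = e n b" by blast
    have "b \<in> - C" using d b by blast
    then obtain r where "r > 0" "ball b r \<subseteq> - C"
      using C(1) by (meson open_Compl open_contains_ball)
    then show ?thesis using b by (intro that[of r]) (auto simp: e_inj subset_iff not_less[symmetric])
  next
    case False
    then show ?thesis by (intro that[of 1]) auto
  qed
  define Z where "Z = (\<Union>c\<in>C. \<Union>a\<in>cball 0 (r / 2) \<inter> R n. {c + a})"
  have Z_I: "c + a \<in> Z" if "c \<in> C" "a \<in> R n" "norm a \<le> r / 2" for c a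
    unfolding Z_def using that by (intro UN_I[of c] UN_I[of a]) simp_all
  have "convex Z"
    unfolding Z_def by (intro convex_sums C(2) convex_Int convex_cball convex_R)
  moreover have "bounded Z"
    unfolding Z_def by (intro bounded_sums C(3) bounded_Int) simp
  moreover have "Z \<subseteq> R n" using C(4) R_add by (auto simp: Z_def)
  moreover have "0 \<in> Z" using Z_I[OF C(5) R_zero] r(1) by simp
  moreover have "d \<notin> e n ` closure Z"
  proof
    assume "d \<in> e n ` closure Z"
    then obtain b where b: "b \<in> closure Z" "d = e n b" by blast
    have "b \<in> R n" using b(1) closure_minimal[OF \<open>Z \<subseteq> R n\<close> closed_R] by blast
    obtain z where z: "z \<in> Z" "dist z b < r / 2"
      using b(1) r(1) unfolding closure_approachable by (meson half_gt_zero)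
    then obtain c a where ca: "c \<in> C" "norm a \<le> r / 2" "z = c + a" unfolding Z_def by auto
    have "dist b c \<le> dist b z + dist z c" by (rule dist_triangle)
    also have "\<dots> < r" using z(2) ca by (simp add: dist_commute dist_norm)
    finally show False using r(2)[OF \<open>b \<in> R n\<close> b(2) ca(1)] by simp
  qed
  ultimately show ?thesis
    using r(1) Z_I closure_subset[of Z] closure_minimal[of Z "R n"] closed_R
    by (intro that[of "r / 2" "closure Z"]) (auto simp: convex_closure bounded_closure subset_iff)
qed

text \<open>The radii are chosen along with closed bounded convex sets \<open>C n\<close> that
  contain \<open>S \<epsilon> n\<close> and whose images avoid \<open>d\<close>. Reflexivity is used
  when passing to the next step, where the image of \<open>C n\<close> under \<open>B\<close> has to
  be closed before it can be thickened.\<close>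

lemma U_avoids_nonzero:
  assumes refl: "reflexive_space scl" and d: "d \<noteq> vzero V"
  obtains \<epsilon> where "pos \<epsilon>" "d \<notin> U \<epsilon>"
proof -
  \<comment> \<open>The last clause starts the induction: in step \<open>0\<close> the ball must lie
    in \<open>C 0\<close>, whereas the later balls are taken care of by the transition
    \<open>Q\<close>.\<close>
  define P where "P n p \<longleftrightarrow> (case p of (\<epsilon>, C) \<Rightarrow> 0 < \<epsilon> \<and> closed C \<and> convex C \<and> bounded C \<and>
      C \<subseteq> R n \<and> 0 \<in> C \<and> d \<notin> e n ` C \<and> (n = 0 \<longrightarrow> {a \<in> R 0. norm a < \<epsilon>} \<subseteq> C))"
    for n and p :: "real \<times> 'a set"
  define Q where "Q n p q \<longleftrightarrow> (case p of (\<epsilon>, C) \<Rightarrow> case q of (\<epsilon>', C') \<Rightarrow>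
      (\<forall>c\<in>C. \<forall>a\<in>R (Suc n). norm a < \<epsilon>' \<longrightarrow> B c + a \<in> C'))"
    for n and p q :: "real \<times> 'a set"
  have "\<exists>f. \<forall>n. P n (f n) \<and> Q n (f n) (f (Suc n))"
  proof (rule dependent_nat_choice)
    have "d \<notin> e 0 ` {0}" using d by (simp add: e_zero)
    moreover have "{0} \<subseteq> R 0" using R_zero by simp
    ultimately obtain \<epsilon> C where "\<epsilon> > 0" "closed C" "convex C" "bounded C" "C \<subseteq> R 0" "0 \<in> C" "d \<notin> e 0 ` C"
      "\<forall>c\<in>{0}. \<forall>a\<in>R 0. norm a < \<epsilon> \<longrightarrow> c + a \<in> C"
      using enlarge_avoiding[of "{0}" 0 d] by auto
    then have "P 0 (\<epsilon>, C)" unfolding P_def by auto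
    then show "\<exists>p. P 0 p" ..
    fix p n assume "P n p"
    then obtain \<epsilon> C where p: "p = (\<epsilon>, C)" "closed C" "convex C" "bounded C" "C \<subseteq> R n" "0 \<in> C" "d \<notin> e n ` C"
      unfolding P_def by (cases p) auto
    have "closed (B ` C)"
      by (rule closed_image_reflexive[OF normed_scalars_axioms refl bounded_linear_B p(2-4)])
    moreover have "convex (B ` C)"
      by (rule convex_linear_image[OF bounded_linear.linear[OF bounded_linear_B] p(3)])
    moreover have "bounded (B ` C)" by (rule bounded_linear_image[OF p(4) bounded_linear_B])
    moreover have "B ` C \<subseteq> R (Suc n)" using p(5) B_R by blast
    moreover have "0 \<in> B ` C" using p(6) B.zero by (metis image_eqI)
    \<comment> \<open>Passing to the next step does not move points of the limit:
      \<open>e (Suc n) (B c) = e n c\<close>.\<close>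
    moreover have "d \<notin> e (Suc n) ` B ` C"
      using p(5,7) e_Suc by (auto simp: subset_iff)
    ultimately obtain \<epsilon>' C' where "\<epsilon>' > 0" "closed C'" "convex C'" "bounded C'" "C' \<subseteq> R (Suc n)" "0 \<in> C'"
      "d \<notin> e (Suc n) ` C'"
      "\<forall>c\<in>B ` C. \<forall>a\<in>R (Suc n). norm a < \<epsilon>' \<longrightarrow> c + a \<in> C'"
      by (rule enlarge_avoiding)
    then have "P (Suc n) (\<epsilon>', C') \<and> Q n p (\<epsilon>', C')" unfolding P_def Q_def p(1) by auto
    then show "\<exists>q. P (Suc n) q \<and> Q n p q" ..
  qed
  then obtain f where f: "\<And>n. P n (f n)" "\<And>n. Q n (f n) (f (Suc n))" by blast
  define \<epsilon> where "\<epsilon> n = fst (f n)" for n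
  define C where "C n = snd (f n)" for n
  have fC: "f n = (\<epsilon> n, C n)" for n by (simp add: \<epsilon>_def C_def)
  have P: "0 < \<epsilon> n" "d \<notin> e n ` C n" "{a \<in> R 0. norm a < \<epsilon> 0} \<subseteq> C 0" for n
    using f(1)[of n] f(1)[of 0] unfolding P_def fC by auto
  have Q: "B c + a \<in> C (Suc n)" if "c \<in> C n" "a \<in> R (Suc n)" "norm a < \<epsilon> (Suc n)" for c a n
    using f(2)[of n] that unfolding Q_def fC by auto
  have "S \<epsilon> N \<subseteq> C N" for N
  proof (induction N)
    case 0
    show ?case using P(3) by simp
  next
    case (Suc N)
    then show ?case using Q by auto
  qed
  then have "d \<notin> U \<epsilon>" unfolding U_def using P(2) by blast
  then show ?thesis using P(1) that by blast
qed

lemma vdiff_zero: "x \<in> points V \<Longrightarrow> vdiff V x (vzero V) = x"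
  using e_diff[OF _ R_zero] by (elim obtain_rep) (simp add: e_zero)

lemma vdiff_eq_zero:
  assumes "x \<in> points V" "y \<in> points V"
  shows "vdiff V x y = vzero V \<longleftrightarrow> x = y"
  using assms vadd_vdiff[of y x] vadd_zero[of y] vdiff_self[of y] by auto

theorem Hausdorff_\<tau>:
  assumes refl: "reflexive_space scl"
  shows "Hausdorff_space \<tau>"
  unfolding Hausdorff_space_def topspace_\<tau>
proof (intro allI impI)
  fix x y assume xy: "x \<in> points V \<and> y \<in> points V \<and> x \<noteq> y"
  then have x: "x \<in> points V" and y: "y \<in> points V" and "vdiff V x y \<noteq> vzero V"
    by (auto simp: vdiff_eq_zero)
  then obtain \<epsilon> where \<epsilon>: "pos \<epsilon>" "vdiff V x y \<notin> U \<epsilon>" using U_avoids_nonzero[OF refl] by blast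
  have half: "pos (\<lambda>n. \<epsilon> n / 2)" using \<epsilon>(1) by simp
  obtain X where X: "openin \<tau> X" "x \<in> X" "\<And>z. z \<in> X \<Longrightarrow> vdiff V z x \<in> U (\<lambda>n. \<epsilon> n / 2)"
    using \<tau>_neighbourhood[OF half x] by blast
  obtain Y where Y: "openin \<tau> Y" "y \<in> Y" "\<And>z. z \<in> Y \<Longrightarrow> vdiff V z y \<in> U (\<lambda>n. \<epsilon> n / 2)"
    using \<tau>_neighbourhood[OF half y] by blast
  have "disjnt X Y"
    unfolding disjnt_iff
  proof (intro allI notI)
    fix z assume z: "z \<in> X \<and> z \<in> Y"
    have z_V: "z \<in> points V" using z X(1) openin_subset topspace_\<tau> by blast
    have "vdiff V x z \<in> U (\<lambda>n. \<epsilon> n / 2)" using z by (intro U_sym[OF z_V x] X(3)) blast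
    moreover have "vdiff V z y \<in> U (\<lambda>n. \<epsilon> n / 2)" using Y(3) z by blast
    ultimately show False using U_triangle[OF \<epsilon>(1) x z_V y] \<epsilon>(2) by blast
  qed
  then show "\<exists>U V. openin \<tau> U \<and> openin \<tau> V \<and> x \<in> U \<and> y \<in> V \<and> disjnt U V"
    using X(1,2) Y(1,2) by blast
qed

abbreviation L :: "('k, (nat \<times> 'v) set) top_space" where
  "L \<equiv> inductive_limit E l"

lemma L_simps [simp]:
  "points L = points V" "vzero L = vzero V" "vadd L = vadd V" "vscale L = vscale V" "vtop L = \<tau>"
  by (simp_all add: inductive_limit_def V_def limit_topology_eq)

lemma vdiff_L [simp]: "vdiff L = vdiff V"
  by (simp add: vdiff_def fun_eq_iff)

section \<open>Completeness of the limit\<close>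

lemma Cauchy_filter_small:
  assumes F: "Cauchy_filter L F" and \<epsilon>: "pos \<epsilon>"
  obtains Q where "eventually Q F" "\<And>x. Q x \<Longrightarrow> x \<in> points V"
    "\<And>x y. Q x \<Longrightarrow> Q y \<Longrightarrow> vdiff V x y \<in> U \<epsilon>"
proof -
  obtain W where W: "openin \<tau> W" "vzero V \<in> W" "\<And>x. x \<in> W \<Longrightarrow> vdiff V x (vzero V) \<in> U \<epsilon>"
    using \<tau>_neighbourhood[OF \<epsilon> zero_in_V] by blast
  have "x \<in> points V" if "x \<in> W" for x using that W(1) openin_subset topspace_\<tau> by blast
  then have W_U: "W \<subseteq> U \<epsilon>" using W(3) vdiff_zero by auto
  have "eventually (\<lambda>(x, y). vdiff V x y \<in> W) (F \<times>\<^sub>F F)" "eventually (\<lambda>x. x \<in> points V) F"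
    using F W(1,2) unfolding Cauchy_filter_def by simp_all
  then obtain Q where Q: "eventually Q F" "\<And>x y. Q x \<Longrightarrow> Q y \<Longrightarrow> vdiff V x y \<in> W"
    unfolding eventually_prod_same by auto
  show ?thesis
  proof (rule that)
    show "eventually (\<lambda>x. Q x \<and> x \<in> points V) F"
      using Q(1) \<open>eventually (\<lambda>x. x \<in> points V) F\<close> by (rule eventually_conj)
    show "vdiff V x y \<in> U \<epsilon>" if "Q x \<and> x \<in> points V" "Q y \<and> y \<in> points V" for x y
      using Q(2) W_U that by blast
  qed simp
qed

text \<open>The summands of the steps up to \<open>k\<close> form \<open>s'\<close>, all later ones
  form \<open>t\<close>. The bound \<open>\<eta> j \<le> \<delta> j\<close> is therefore demanded
  for \<open>j\<close> beyond \<open>k\<close> only, which is all that a diagonal sequence can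
  provide.\<close>

lemma S_split:
  assumes \<delta>: "pos \<delta>" and le: "\<And>j. k < j \<Longrightarrow> \<eta> j \<le> \<delta> j"
  shows "s \<in> S \<eta> (k + i) \<Longrightarrow> \<exists>s'\<in>S \<eta> k. \<exists>t\<in>S \<delta> (k + i). s = (B ^^ i) s' + t"
proof (induction i arbitrary: s)
  case 0
  then show ?case using S_zero[OF \<delta>, of k] by (intro bexI[of _ s] bexI[of _ "0 :: 'a"]) simp_all
next
  case (Suc i)
  obtain s1 a where s1: "s = B s1 + a" "s1 \<in> S \<eta> (k + i)" "a \<in> R (Suc (k + i))" "norm a < \<eta> (Suc (k + i))"
    using Suc.prems by auto
  obtain s' t where st: "s' \<in> S \<eta> k" "t \<in> S \<delta> (k + i)" "s1 = (B ^^ i) s' + t"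
    using Suc.IH[OF s1(2)] by blast
  have "norm a < \<delta> (Suc (k + i))" using s1(4) le[of "Suc (k + i)"] by simp
  then have "B t + a \<in> S \<delta> (k + Suc i)"
    using st(2) s1(3) unfolding add_Suc_right S.simps by blast
  moreover have "s = (B ^^ Suc i) s' + (B t + a)" by (simp add: s1(1) st(3) B.add)
  ultimately show ?case using st(1) by blast
qed

lemma bounded_S: "bounded (S \<epsilon> N)"
proof (induction N)
  case 0
  show ?case by (rule bounded_subset[OF bounded_ball[of 0 "\<epsilon> 0"]]) auto
next
  case (Suc N)
  have "bounded (B ` S \<epsilon> N)" using Suc bounded_linear_B by (rule bounded_linear_image)
  then have "bounded (\<Union>x\<in>B ` S \<epsilon> N. \<Union>a\<in>ball 0 (\<epsilon> (Suc N)). {x + a})"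
    using bounded_ball by (rule bounded_sums)
  then show ?case by (rule bounded_subset) auto
qed

text \<open>Because of \<open>1 \<le> K\<close>, the factor \<open>K ^ k\<close> covers all powers
  of \<open>B\<close> up to the \<open>k\<close>-th at once.\<close>

lemma norm_pow_bound:
  obtains K where "1 \<le> K" "\<And>i k a. i \<le> k \<Longrightarrow> norm ((B ^^ i) a) \<le> K ^ k * norm a"
proof -
  obtain K0 where K0: "\<And>a. norm (B a) \<le> norm a * K0"
    using bounded_linear.bounded[OF bounded_linear_B] by blast
  define K where "K = max 1 K0"
  have "norm ((B ^^ i) a) \<le> K ^ i * norm a" for i a
  proof (induction i)
    case (Suc i)
    have "norm ((B ^^ Suc i) a) \<le> norm ((B ^^ i) a) * K0" using K0 by simp
    also have "\<dots> \<le> norm ((B ^^ i) a) * K" by (intro mult_left_mono) (auto simp: K_def)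
    also have "\<dots> \<le> (K ^ i * norm a) * K" using Suc by (intro mult_right_mono) (auto simp: K_def)
    finally show ?case by (simp add: mult_ac)
  qed simp
  moreover have "K ^ i * norm a \<le> K ^ k * norm a" if "i \<le> k" for i k and a :: 'a
    using that by (intro mult_right_mono power_increasing) (auto simp: K_def)
  ultimately have "norm ((B ^^ i) a) \<le> K ^ k * norm a" if "i \<le> k" for i k a
    using that order_trans by blast
  then show ?thesis by (intro that[of K]) (auto simp: K_def)
qed

text \<open>Suppose that for each \<open>k\<close> the filter eventually avoids the ball of step
  \<open>k\<close> up to an error from \<open>U (\<delta> k)\<close>. A diagonal sequence
  \<open>\<eta>\<close> lies below every \<open>\<delta> k\<close> from index \<open>k\<close> on. A
  member of the filter that is small of order \<open>\<eta>\<close> lies in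
  \<open>x0 + U \<eta>\<close>, and for large \<open>k\<close> this is contained in the ball of step
  \<open>k\<close> plus \<open>U (\<delta> k)\<close>, a contradiction.\<close>

lemma Cauchy_filter_near_step:
  assumes F: "Cauchy_filter L F"
  obtains k r where "\<And>\<epsilon>. pos \<epsilon> \<Longrightarrow>
    frequently (\<lambda>x. x \<in> points V \<and> (\<exists>b\<in>R k. norm b \<le> r \<and> vdiff V x (e k b) \<in> U \<epsilon>)) F"
proof (rule ccontr)
  assume not_thesis: "\<not> thesis"
  obtain K where K: "1 \<le> K" "\<And>i k a. i \<le> k \<Longrightarrow> norm ((B ^^ i) a) \<le> K ^ k * norm a"
    using norm_pow_bound by blast
  have "\<exists>\<rho>. \<forall>s\<in>S (\<lambda>_. 1) k. norm s \<le> \<rho>" for k using bounded_S[of "\<lambda>_. 1" k] unfolding bounded_iff .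
  then obtain \<rho> where \<rho>: "\<And>k s. s \<in> S (\<lambda>_. 1) k \<Longrightarrow> norm s \<le> \<rho> k" by metis
  \<comment> \<open>The radius covers an arbitrary fixed element plus \<open>S (\<lambda>_. 1) k\<close> as soon as \<open>k\<close> is large.\<close>
  define near where "near k \<epsilon> x \<longleftrightarrow> x \<in> points V \<and>
    (\<exists>b\<in>R k. norm b \<le> K ^ k * real k + \<rho> k \<and> vdiff V x (e k b) \<in> U \<epsilon>)" for k \<epsilon> x
  have "\<exists>\<epsilon>. pos \<epsilon> \<and> eventually (\<lambda>x. \<not> near k \<epsilon> x) F" for k
  proof (rule ccontr)
    assume "\<not> ?thesis"
    then have "frequently (near k \<epsilon>) F" if "pos \<epsilon>" for \<epsilon> using that unfolding frequently_def by blast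
    then show False using not_thesis that[of k "K ^ k * real k + \<rho> k"] unfolding near_def by blast
  qed
  then obtain \<delta> where \<delta>: "\<And>k. pos (\<delta> k)" "\<And>k. eventually (\<lambda>x. \<not> near k (\<delta> k) x) F" by metis
  \<comment> \<open>Steps up to \<open>k\<close> of an element of \<open>U \<eta>\<close> stay bounded in step \<open>k\<close>; the later ones lie in \<open>U (\<delta> k)\<close>.\<close>
  define \<eta> where "\<eta> j = Min (insert 1 ((\<lambda>k. \<delta> k j) ` {..j}))" for j
  have \<eta>_pos: "pos \<eta>" unfolding \<eta>_def using \<delta>(1) by (auto simp: Min_gr_iff)
  have \<eta>_le: "\<eta> j \<le> 1" "k \<le> j \<Longrightarrow> \<eta> j \<le> \<delta> k j" for j k unfolding \<eta>_def by (rule Min_le; simp)+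
  obtain Q where Q: "eventually Q F" "\<And>x. Q x \<Longrightarrow> x \<in> points V"
    "\<And>x y. Q x \<Longrightarrow> Q y \<Longrightarrow> vdiff V x y \<in> U \<eta>"
    using Cauchy_filter_small[OF F \<eta>_pos] by blast
  have "F \<noteq> bot" using F unfolding Cauchy_filter_def by blast
  obtain x0 where x0: "Q x0" using eventually_happens'[OF \<open>F \<noteq> bot\<close> Q(1)] by blast
  obtain m a where a: "a \<in> R m" "x0 = e m a" using Q(2)[OF x0] by (rule obtain_rep)
  obtain k0 where k0: "norm a \<le> real k0" using real_arch_simple by blast
  \<comment> \<open>From \<open>m\<close> on, the fixed element \<open>x0\<close> has a coordinate
    in step \<open>k\<close>; from \<open>k0\<close> on, the radius has outgrown the norm of that
    coordinate.\<close>
  define k where "k = max m k0"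
  obtain x where x: "Q x" "\<not> near k (\<delta> k) x"
    using eventually_happens'[OF \<open>F \<noteq> bot\<close> eventually_conj[OF Q(1) \<delta>(2)[of k]]] by blast
  obtain N where N: "\<And>M. N \<le> M \<Longrightarrow> \<exists>s\<in>S \<eta> M. vdiff V x x0 = e M s"
    using U_rep[OF \<eta>_pos Q(3)[OF x(1) x0]] by blast
  obtain s where s: "s \<in> S \<eta> (k + N)" "vdiff V x x0 = e (k + N) s" using N[of "k + N"] by auto
  obtain s' t where st: "s' \<in> S \<eta> k" "t \<in> S (\<delta> k) (k + N)" "s = (B ^^ N) s' + t"
    using S_split[OF \<delta>(1), of k \<eta> k s N] \<eta>_le(2) s(1) by auto
  define b where "b = (B ^^ (k - m)) a + s'"
  have a_k: "(B ^^ (k - m)) a \<in> R k" using pow_R[OF a(1), of "k - m"] by (simp add: k_def)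
  have x0_k: "x0 = e k ((B ^^ (k - m)) a)" using e_up[OF a(1), of "k - m"] a(2) by (simp add: k_def)
  have "b \<in> R k" unfolding b_def using a_k S_R[OF st(1)] by (rule R_add)
  moreover have "norm b \<le> K ^ k * real k + \<rho> k"
  proof -
    have "norm ((B ^^ (k - m)) a) \<le> K ^ k * norm a" by (rule K(2)) simp
    also have "\<dots> \<le> K ^ k * real k" using k0 K(1) by (intro mult_left_mono) (auto simp: k_def)
    finally have "norm ((B ^^ (k - m)) a) \<le> K ^ k * real k" .
    moreover have "norm s' \<le> \<rho> k" using S_mono[OF _ st(1), of "\<lambda>_. 1"] \<eta>_le(1) by (intro \<rho>) simp
    ultimately show ?thesis unfolding b_def using norm_triangle_ineq[of "(B ^^ (k - m)) a" s'] by linarith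
  qed
  moreover have "vdiff V x (e k b) \<in> U (\<delta> k)"
  proof -
    have b_up: "(B ^^ N) b \<in> R (k + N)" using \<open>b \<in> R k\<close> by (rule pow_R)
    have "x = vadd V x0 (vdiff V x x0)" using Q(2) x(1) x0 by (simp add: vadd_vdiff)
    also have "\<dots> = e (k + N) ((B ^^ N) ((B ^^ (k - m)) a) + s)"
      unfolding s(2) using x0_k e_up[OF a_k, of N] pow_R[OF a_k, of N] S_R[OF s(1)] by (simp flip: e_add)
    also have "(B ^^ N) ((B ^^ (k - m)) a) + s = (B ^^ N) b + t"
      by (simp add: st(3) b_def pow_add add.assoc)
    finally have "x = e (k + N) ((B ^^ N) b + t)" .
    then have "vdiff V x (e k b) = e (k + N) t"
      using e_up[OF \<open>b \<in> R k\<close>, of N] e_diff[OF R_add[OF b_up S_R[OF st(2)]] b_up] by simp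
    then show ?thesis using U_I[OF st(2)] by simp
  qed
  ultimately have "near k (\<delta> k) x" unfolding near_def using Q(2)[OF x(1)] by blast
  then show False using x(2) by blast
qed

lemma linear_pow: "linear (B ^^ i)"
proof (rule linearI)
  show "(B ^^ i) (r *\<^sub>R a) = r *\<^sub>R (B ^^ i) a" for r a
    using pow_scl[of i "of_real r" a] by (simp add: scl_of_real)
qed (rule pow_add)

text \<open>The point \<open>y\<close> may have coordinates only in steps after \<open>k\<close>,
  and membership in \<open>U \<epsilon>\<close> may show only later still. Convexity is thus taken
  from a set \<open>S\<close> in a late step and pulled back along a power of
  \<open>B\<close>.\<close>

lemma convex_near:
  assumes \<epsilon>: "pos \<epsilon>" and y: "y \<in> points V"
  shows "convex {b \<in> R k. vdiff V y (e k b) \<in> U \<epsilon>}"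
proof (rule convexI)
  fix b b' and u v :: real
  assume b: "b \<in> {b \<in> R k. vdiff V y (e k b) \<in> U \<epsilon>}" and b': "b' \<in> {b \<in> R k. vdiff V y (e k b) \<in> U \<epsilon>}"
    and uv: "0 \<le> u" "0 \<le> v" "u + v = 1"
  have "eventually (\<lambda>N. (\<exists>a\<in>R N. y = e N a) \<and> k \<le> N) sequentially"
    using eventually_representable[OF y] eventually_ge_at_top by (rule eventually_conj)
  then obtain N c where c: "c \<in> R N" "y = e N c" "k \<le> N"
    using eventually_happens'[OF sequentially_bot] by blast
  define j where "j = N - k"
  have N: "N = k + j" using c(3) by (simp add: j_def)
  have diff: "vdiff V y (e k b) = e N (c - (B ^^ j) b)" "c - (B ^^ j) b \<in> R N" if "b \<in> R k" for b
    using e_up[OF that, of j] pow_R[OF that, of j] c(1,2) e_diff[of c N "(B ^^ j) b"] R_diff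
    by (simp_all add: N)
  have "\<exists>i. (B ^^ i) (c - (B ^^ j) b) \<in> S \<epsilon> (N + i)" if "b \<in> {b \<in> R k. vdiff V y (e k b) \<in> U \<epsilon>}" for b
    using that diff[of b] U_e_iff[OF \<epsilon>, of "c - (B ^^ j) b" N] by simp
  then obtain i i' where i: "(B ^^ i) (c - (B ^^ j) b) \<in> S \<epsilon> (N + i)" "(B ^^ i') (c - (B ^^ j) b') \<in> S \<epsilon> (N + i')"
    using b b' by blast
  \<comment> \<open>The two memberships become visible after \<open>i\<close> and \<open>i'\<close>
    further steps; after \<open>K\<close> steps both are, so that convexity of one and the same set
    applies.\<close>
  define K where "K = i + i'"
  have comp: "(B ^^ m) ((B ^^ n) a) = (B ^^ (m + n)) a" for m n a by (simp add: funpow_add)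
  have "(B ^^ K) (c - (B ^^ j) b) \<in> S \<epsilon> (N + K)"
    using S_pow[OF \<epsilon> i(1), of i'] by (simp only: comp K_def add_ac)
  moreover have "(B ^^ K) (c - (B ^^ j) b') \<in> S \<epsilon> (N + K)"
    using S_pow[OF \<epsilon> i(2), of i] by (simp only: comp K_def add_ac)
  ultimately have "u *\<^sub>R (B ^^ K) (c - (B ^^ j) b) + v *\<^sub>R (B ^^ K) (c - (B ^^ j) b') \<in> S \<epsilon> (N + K)"
    using convexD[OF convex_S _ _ uv] by blast
  also have "u *\<^sub>R (B ^^ K) (c - (B ^^ j) b) + v *\<^sub>R (B ^^ K) (c - (B ^^ j) b') =
      (B ^^ K) (u *\<^sub>R (c - (B ^^ j) b) + v *\<^sub>R (c - (B ^^ j) b'))"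
    by (simp add: linear_add[OF linear_pow] linear_cmul[OF linear_pow])
  also have "u *\<^sub>R (c - (B ^^ j) b) + v *\<^sub>R (c - (B ^^ j) b') =
      (u + v) *\<^sub>R c - (B ^^ j) (u *\<^sub>R b + v *\<^sub>R b')"
    by (simp add: linear_add[OF linear_pow] linear_cmul[OF linear_pow] algebra_simps)
  finally have *: "(B ^^ K) (c - (B ^^ j) (u *\<^sub>R b + v *\<^sub>R b')) \<in> S \<epsilon> (N + K)" by (simp add: uv)
  have R: "u *\<^sub>R b + v *\<^sub>R b' \<in> R k" using b b' by (simp add: R_add R_scaleR)
  have "vdiff V y (e k (u *\<^sub>R b + v *\<^sub>R b')) \<in> U \<epsilon>"
    unfolding diff(1)[OF R] U_e_iff[OF \<epsilon> diff(2)[OF R]] using * by blast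
  then show "u *\<^sub>R b + v *\<^sub>R b' \<in> {b \<in> R k. vdiff V y (e k b) \<in> U \<epsilon>}" using R by blast
qed

text \<open>Points of the fixed ball that are close to members of the filter need not form closed or
  convex sets, so closed convex hulls are taken before a common point is chosen. The hull does no
  harm because the points of step \<open>k\<close> close to a given \<open>y\<close> form a convex
  set; the closure costs one more halving of the radii.\<close>

theorem complete_L:
  assumes refl: "reflexive_space scl"
  shows "complete_tvs L"
  unfolding complete_tvs_def
proof (intro allI impI)
  fix F assume F: "Cauchy_filter L F"
  then have "F \<noteq> bot" unfolding Cauchy_filter_def by blast
  obtain k r where near: "\<And>\<epsilon>. pos \<epsilon> \<Longrightarrow>
    frequently (\<lambda>x. x \<in> points V \<and> (\<exists>b\<in>R k. norm b \<le> r \<and> vdiff V x (e k b) \<in> U \<epsilon>)) F"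
    using Cauchy_filter_near_step[OF F] by blast
  \<comment> \<open>Nonempty for every \<open>\<epsilon>\<close> and every predicate
    \<open>P\<close> that holds eventually, since the filter is frequently near the ball of radius
    \<open>r\<close> in step \<open>k\<close>.\<close>
  define M where "M \<epsilon> P = {b \<in> R k. norm b \<le> r \<and> (\<exists>x. P x \<and> x \<in> points V \<and> vdiff V x (e k b) \<in> U \<epsilon>)}"
    for \<epsilon> P
  define H where "H \<epsilon> P = closure (convex hull M \<epsilon> P)" for \<epsilon> P
  define \<C> where "\<C> = {H \<epsilon> P | \<epsilon> P. pos \<epsilon> \<and> eventually P F}"
  have M_mono: "M \<epsilon> P \<subseteq> M \<delta> Q" if "\<And>n. \<epsilon> n \<le> \<delta> n" "\<And>x. P x \<Longrightarrow> Q x" for \<epsilon> \<delta> P Q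
    using that U_mono[of \<epsilon> \<delta>] unfolding M_def by blast
  have "\<Inter>\<C> \<noteq> {}"
  proof (rule reflexive_common_point[OF normed_scalars_axioms refl])
    have "H (\<lambda>_. 1) (\<lambda>_. True) \<in> \<C>"
      unfolding \<C>_def mem_Collect_eq by (intro exI[of _ "\<lambda>_. 1"] exI[of _ "\<lambda>_. True"]) simp
    then show "\<C> \<noteq> {}" by blast
    fix C assume "C \<in> \<C>"
    then obtain \<epsilon> P where C: "C = H \<epsilon> P" and \<epsilon>: "pos \<epsilon>" and P: "eventually P F" unfolding \<C>_def by blast
    have "bounded (M \<epsilon> P)" by (rule bounded_subset[OF bounded_cball[of 0 r]]) (auto simp: M_def)
    moreover have "M \<epsilon> P \<noteq> {}"
      using frequently_ex[OF frequently_eventually_conj[OF near[OF \<epsilon>] P]] unfolding M_def by blast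
    ultimately show "closed C \<and> convex C \<and> bounded C \<and> C \<noteq> {}"
      unfolding C H_def by (simp add: convex_closure bounded_closure bounded_convex_hull)
    fix D assume "D \<in> \<C>"
    then obtain \<delta> Q where D: "D = H \<delta> Q" and \<delta>: "pos \<delta>" and Q: "eventually Q F" unfolding \<C>_def by blast
    let ?E = "H (\<lambda>n. min (\<epsilon> n) (\<delta> n)) (\<lambda>x. P x \<and> Q x)"
    have "?E \<subseteq> C" "?E \<subseteq> D"
      unfolding C D H_def by (intro closure_mono hull_mono M_mono; simp)+
    moreover have "?E \<in> \<C>"
      unfolding \<C>_def mem_Collect_eq using \<epsilon> \<delta> eventually_conj[OF P Q]
      by (intro exI[of _ "\<lambda>n. min (\<epsilon> n) (\<delta> n)"] exI[of _ "\<lambda>x. P x \<and> Q x"]) simp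
    ultimately show "\<exists>E\<in>\<C>. E \<subseteq> C \<inter> D" by blast
  qed
  then obtain a where a: "\<And>\<epsilon> P. pos \<epsilon> \<Longrightarrow> eventually P F \<Longrightarrow> a \<in> H \<epsilon> P" unfolding \<C>_def by blast
  have "a \<in> R k"
  proof -
    have "H (\<lambda>_. 1) (\<lambda>_. True) \<subseteq> R k"
      unfolding H_def by (intro closure_minimal hull_minimal closed_R convex_R) (auto simp: M_def)
    then show ?thesis using a[of "\<lambda>_. 1" "\<lambda>_. True"] by auto
  qed
  have "limitin \<tau> (\<lambda>y. y) (e k a) F"
    unfolding limitin_def topspace_\<tau>
  proof (intro conjI allI impI)
    show "e k a \<in> points V" using \<open>a \<in> R k\<close> by simp
    fix W assume W: "openin \<tau> W \<and> e k a \<in> W"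
    then obtain \<epsilon> where \<epsilon>: "pos \<epsilon>" "\<And>y. y \<in> points V \<Longrightarrow> vdiff V y (e k a) \<in> U \<epsilon> \<Longrightarrow> y \<in> W"
      unfolding openin_\<tau> by blast
    \<comment> \<open>Two errors of size \<open>\<delta>\<close>, from \<open>y\<close> to
      \<open>x\<close> and from \<open>x\<close> to the ball, make up \<open>\<epsilon>2\<close>;
      the passage from the closure to a point of \<open>G\<close> adds another
      \<open>\<epsilon>2\<close>.\<close>
    define \<epsilon>2 where "\<epsilon>2 = (\<lambda>n. \<epsilon> n / 2)"
    define \<delta> where "\<delta> = (\<lambda>n. \<epsilon>2 n / 2)"
    have \<epsilon>2: "pos \<epsilon>2" and \<delta>: "pos \<delta>" using \<epsilon>(1) by (simp_all add: \<epsilon>2_def \<delta>_def)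
    obtain Q where Q: "eventually Q F" "\<And>x. Q x \<Longrightarrow> x \<in> points V"
      "\<And>x y. Q x \<Longrightarrow> Q y \<Longrightarrow> vdiff V x y \<in> U \<delta>"
      using Cauchy_filter_small[OF F \<delta>] by blast
    have "y \<in> W" if y: "Q y" for y
    proof (rule \<epsilon>(2))
      show y_V: "y \<in> points V" using Q(2) y by blast
      define G where "G = {b \<in> R k. vdiff V y (e k b) \<in> U \<epsilon>2}"
      have "M \<delta> Q \<subseteq> G"
      proof
        fix b assume "b \<in> M \<delta> Q"
        then obtain x where x: "b \<in> R k" "Q x" "x \<in> points V" "vdiff V x (e k b) \<in> U \<delta>"
          unfolding M_def by blast
        have "vdiff V y (e k b) \<in> U \<epsilon>2"
          by (rule U_triangle[OF \<epsilon>2 y_V x(3) e_in_V[OF x(1)]])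
            (use Q(3)[OF y x(2)] x(4) in \<open>simp_all add: \<delta>_def\<close>)
        then show "b \<in> G" using x(1) unfolding G_def by blast
      qed
      then have "convex hull M \<delta> Q \<subseteq> G"
        unfolding G_def by (intro hull_minimal convex_near[OF \<epsilon>2 y_V])
      then have "a \<in> closure G" using a[OF \<delta> Q(1)] closure_mono unfolding H_def by blast
      then obtain b where b: "b \<in> G" "dist b a < \<epsilon>2 k"
        using \<epsilon>2 unfolding closure_approachable by blast
      have b_R: "b \<in> R k" using b(1) unfolding G_def by blast
      have "e k (b - a) \<in> U \<epsilon>2"
        using b(2) by (intro U_ball[OF \<epsilon>2 R_diff[OF b_R \<open>a \<in> R k\<close>]]) (simp add: dist_norm)
      then have "vdiff V (e k b) (e k a) \<in> U \<epsilon>2" by (simp add: e_diff b_R \<open>a \<in> R k\<close>)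
      moreover have "vdiff V y (e k b) \<in> U \<epsilon>2" using b(1) unfolding G_def by blast
      ultimately show "vdiff V y (e k a) \<in> U \<epsilon>"
        using U_triangle[OF \<epsilon>(1) y_V e_in_V[OF b_R] e_in_V[OF \<open>a \<in> R k\<close>]] unfolding \<epsilon>2_def by blast
    qed
    then show "eventually (\<lambda>y. y \<in> W) F" using Q(1) by (rule eventually_mono[rotated])
  qed
  then show "\<exists>x. limitin (vtop L) (\<lambda>y. y) x F" by auto
qed

end


section \<open>Completion of a complete Hausdorff space\<close>

lemma filterlim_nhdsin_prod:
  assumes f: "continuous_map (prod_topology X Y) Z f" and xy: "x \<in> topspace X" "y \<in> topspace Y"
  shows "filterlim f (nhdsin Z (f (x, y))) (nhdsin X x \<times>\<^sub>F nhdsin Y y)"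
  unfolding filterlim_iff
proof (intro allI impI)
  fix P assume P: "eventually P (nhdsin Z (f (x, y)))"
  have "f (x, y) \<in> topspace Z" using f xy unfolding continuous_map_def by auto
  then obtain W where W: "openin Z W" "f (x, y) \<in> W" "\<forall>z\<in>W. P z"
    using P unfolding eventually_nhdsin by blast
  define Q where "Q = {p \<in> topspace (prod_topology X Y). f p \<in> W}"
  have "openin (prod_topology X Y) Q" using f W(1) unfolding continuous_map_def Q_def by blast
  moreover have "(x, y) \<in> Q" using xy W(2) by (simp add: Q_def)
  ultimately have "\<exists>U V. openin X U \<and> openin Y V \<and> x \<in> U \<and> y \<in> V \<and> U \<times> V \<subseteq> Q"
    by (simp add: openin_prod_topology_alt)
  then obtain U V where UV: "openin X U" "openin Y V" "x \<in> U" "y \<in> V" "U \<times> V \<subseteq> Q" by (elim exE conjE)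
  have "eventually (\<lambda>u. u \<in> U) (nhdsin X x)" "eventually (\<lambda>v. v \<in> V) (nhdsin Y y)"
    using UV unfolding eventually_nhdsin by blast+
  moreover have "P (f (u, v))" if "u \<in> U" "v \<in> V" for u v
    using that UV(5) W(3) by (auto simp: Q_def)
  ultimately show "eventually (\<lambda>p. P (f p)) (nhdsin X x \<times>\<^sub>F nhdsin Y y)"
    unfolding eventually_prod_filter by blast
qed

lemma eventually_nhdsin_self: "eventually P (nhdsin X x) \<Longrightarrow> x \<in> topspace X \<Longrightarrow> P x"
  unfolding eventually_nhdsin by blast

lemma nhdsin_neq_bot: "x \<in> topspace X \<Longrightarrow> nhdsin X x \<noteq> bot"
  using eventually_nhdsin_self[of "\<lambda>_. False" X x] by (auto simp: trivial_limit_def)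

lemma limitin_id_iff: "limitin X (\<lambda>y. y) x F \<longleftrightarrow> x \<in> topspace X \<and> F \<le> nhdsin X x"
proof (cases "x \<in> topspace X")
  case True
  have "(\<forall>U. openin X U \<and> x \<in> U \<longrightarrow> eventually (\<lambda>y. y \<in> U) F) \<longleftrightarrow> F \<le> nhdsin X x"
    unfolding le_filter_def
  proof (intro iffI allI impI)
    fix P assume nb: "\<forall>U. openin X U \<and> x \<in> U \<longrightarrow> eventually (\<lambda>y. y \<in> U) F" and P: "eventually P (nhdsin X x)"
    obtain S where S: "openin X S" "x \<in> S" "\<forall>y\<in>S. P y" using P True unfolding eventually_nhdsin by blast
    then have "eventually (\<lambda>y. y \<in> S) F" using nb by blast
    then show "eventually P F" using S(3) by (auto elim: eventually_mono)
  next
    fix U assume le: "\<forall>P. eventually P (nhdsin X x) \<longrightarrow> eventually P F" and U: "openin X U \<and> x \<in> U"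
    then show "eventually (\<lambda>y. y \<in> U) F"
      by (intro le[rule_format]) (auto simp: eventually_nhdsin)
  qed
  then show ?thesis unfolding limitin_def using True by simp
qed (simp add: limitin_def)

lemma nhdsin_le_imp_eq:
  assumes "Hausdorff_space X" "x \<in> topspace X" "y \<in> topspace X" "nhdsin X x \<le> nhdsin X y"
  shows "x = y"
proof (rule ccontr)
  assume "x \<noteq> y"
  then obtain U V where UV: "openin X U" "openin X V" "x \<in> U" "y \<in> V" "disjnt U V"
    using assms(1-3) unfolding Hausdorff_space_def by blast
  then have "eventually (\<lambda>z. z \<in> V) (nhdsin X y)" unfolding eventually_nhdsin by blast
  then have "x \<in> V" using assms(2,4) by (intro eventually_nhdsin_self[of "\<lambda>z. z \<in> V"]) (auto simp: le_filter_def)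
  then show False using UV unfolding disjnt_iff by blast
qed

locale complete_Hausdorff_tvs =
  fixes L :: "('k::real_normed_field, 'v, 'm) top_space_scheme"
  assumes linear_top: "linear_topology L (vtop L)"
    and zero_in: "vzero L \<in> points L"
    and add_zero: "x \<in> points L \<Longrightarrow> vadd L x (vzero L) = x"
    and add_diff: "x \<in> points L \<Longrightarrow> y \<in> points L \<Longrightarrow> vadd L x (vdiff L y x) = y"
    and diff_self: "x \<in> points L \<Longrightarrow> vdiff L x x = vzero L"
    and complete: "complete_tvs L"
    and Hausdorff: "Hausdorff_space (vtop L)"
begin

abbreviation nh :: "'v \<Rightarrow> 'v filter" where
  "nh \<equiv> nhdsin (vtop L)"

lemma top: "topspace (vtop L) = points L"
  using linear_top unfolding linear_topology_def by blast

lemma continuous_add: "continuous_map (prod_topology (vtop L) (vtop L)) (vtop L) (\<lambda>(x, y). vadd L x y)"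
  using linear_top unfolding linear_topology_def by blast

lemma continuous_scale: "continuous_map (prod_topology euclidean (vtop L)) (vtop L) (\<lambda>(c, x). vscale L c x)"
  using linear_top unfolding linear_topology_def by blast

lemma continuous_diff: "continuous_map (prod_topology (vtop L) (vtop L)) (vtop L) (\<lambda>(x, y). vdiff L x y)"
proof -
  let ?P = "prod_topology (vtop L) (vtop L)"
  have "continuous_map ?P (prod_topology euclidean (vtop L)) (\<lambda>p. (- 1, snd p))"
    by (intro continuous_map_pairedI continuous_map_snd) simp
  from continuous_map_compose[OF this continuous_scale]
  have "continuous_map ?P (vtop L) (\<lambda>p. vscale L (- 1) (snd p))" by (simp add: comp_def)
  then have "continuous_map ?P ?P (\<lambda>p. (fst p, vscale L (- 1) (snd p)))"
    by (intro continuous_map_pairedI continuous_map_fst)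
  from continuous_map_compose[OF this continuous_add]
  show ?thesis by (simp add: comp_def case_prod_unfold vdiff_def)
qed

lemma add_in: "x \<in> points L \<Longrightarrow> y \<in> points L \<Longrightarrow> vadd L x y \<in> points L"
  using funcset_mem[OF continuous_map_funspace[OF continuous_add], of "(x, y)"] by (simp add: top)

lemma scale_in: "x \<in> points L \<Longrightarrow> vscale L c x \<in> points L"
  using funcset_mem[OF continuous_map_funspace[OF continuous_scale], of "(c, x)"] by (simp add: top)

lemma eventually_points: "eventually (\<lambda>y. y \<in> points L) (nh x)"
  unfolding eventually_nhdsin top using openin_topspace[of "vtop L"] by (auto simp: top)

lemma Cauchy_nh:
  assumes x: "x \<in> points L"
  shows "Cauchy_filter L (nh x)"
  unfolding Cauchy_filter_def
proof (intro conjI allI impI)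
  show "nh x \<noteq> bot" using x by (simp add: nhdsin_neq_bot top)
  show "eventually (\<lambda>y. y \<in> points L) (nh x)" by (rule eventually_points)
  fix U assume U: "openin (vtop L) U \<and> vzero L \<in> U"
  have "filterlim (\<lambda>(x, y). vdiff L x y) (nh (vzero L)) (nh x \<times>\<^sub>F nh x)"
    using filterlim_nhdsin_prod[OF continuous_diff, of x x] x by (simp add: diff_self top)
  moreover have "eventually (\<lambda>z. z \<in> U) (nh (vzero L))" using U unfolding eventually_nhdsin by blast
  ultimately show "eventually (\<lambda>(x, y). vdiff L x y \<in> U) (nh x \<times>\<^sub>F nh x)"
    using eventually_compose_filterlim by (fastforce simp: case_prod_unfold)
qed

text \<open>A minimal Cauchy filter converges by completeness, hence is finer than a neighbourhood
  filter and by minimality equal to it. Conversely, a Cauchy filter coarser than \<open>nh x\<close>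
  converges to some \<open>y\<close> with \<open>nh x \<le> nh y\<close>, and the Hausdorff property
  forces \<open>x = y\<close>.\<close>

lemma minimal_Cauchy_iff: "minimal_Cauchy_filter L F \<longleftrightarrow> (\<exists>x\<in>points L. F = nh x)"
proof
  assume F: "minimal_Cauchy_filter L F"
  then obtain x where "limitin (vtop L) (\<lambda>y. y) x F"
    using complete unfolding minimal_Cauchy_filter_def complete_tvs_def by blast
  then have "x \<in> points L" "F \<le> nh x" by (simp_all add: limitin_id_iff top)
  then show "\<exists>x\<in>points L. F = nh x"
    using F Cauchy_nh unfolding minimal_Cauchy_filter_def by metis
next
  assume "\<exists>x\<in>points L. F = nh x"
  then obtain x where x: "x \<in> points L" "F = nh x" by blast
  have "G = nh x" if G: "Cauchy_filter L G" "nh x \<le> G" for G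
  proof -
    obtain y where "limitin (vtop L) (\<lambda>y. y) y G"
      using complete G(1) unfolding complete_tvs_def by blast
    then have y: "y \<in> points L" "G \<le> nh y" by (simp_all add: limitin_id_iff top)
    then have "x = y"
      using nhdsin_le_imp_eq[OF Hausdorff, of x y] x(1) order_trans[OF G(2) y(2)] by (simp add: top)
    then show ?thesis using y(2) G(2) by (simp add: antisym)
  qed
  then show "minimal_Cauchy_filter L F"
    unfolding minimal_Cauchy_filter_def x(2) using Cauchy_nh[OF x(1)] by blast
qed

text \<open>Serves both operations of the completion. The image of neighbourhood filters under
  addition or scaling converges to the right point \<open>z\<close> but can be strictly finer than
  \<open>nh z\<close>, as with the factor zero in a vector space. Adding the neighbourhood filter of
  zero fills it up again, provided that \<open>z\<close> belongs to every set of the image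
  filter.\<close>

lemma minimal_hull_eq:
  assumes z: "z \<in> points L" and G: "G \<le> nh z" "\<And>P. eventually P G \<Longrightarrow> P z"
  shows "minimal_hull L G = nh z"
proof (rule antisym)
  have "filterlim (\<lambda>(x, y). vadd L x y) (nh z) (nh z \<times>\<^sub>F nh (vzero L))"
    using filterlim_nhdsin_prod[OF continuous_add, of z "vzero L"] z zero_in by (simp add: add_zero top)
  then have "filterlim (\<lambda>(x, y). vadd L x y) (nh z) (G \<times>\<^sub>F nh (vzero L))"
    by (rule filterlim_mono[OF _ order_refl prod_filter_mono[OF G(1) order_refl]])
  then show "minimal_hull L G \<le> nh z"
    unfolding minimal_hull_def filter_add_def filterlim_def .
  show "nh z \<le> minimal_hull L G"
    unfolding le_filter_def
  proof (intro allI impI)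
    fix P assume "eventually P (minimal_hull L G)"
    then have "eventually (\<lambda>(x, y). P (vadd L x y)) (G \<times>\<^sub>F nh (vzero L))"
      unfolding minimal_hull_def filter_add_def eventually_filtermap by (simp add: case_prod_unfold)
    then obtain Pf Pg where P: "eventually Pf G" "eventually Pg (nh (vzero L))"
      "\<And>x y. Pf x \<Longrightarrow> Pg y \<Longrightarrow> P (vadd L x y)" unfolding eventually_prod_filter by auto
    have "filterlim (\<lambda>(x, y). vdiff L x y) (nh (vzero L)) (nh z \<times>\<^sub>F nh z)"
      using filterlim_nhdsin_prod[OF continuous_diff, of z z] z by (simp add: diff_self top)
    then have "eventually (\<lambda>(x, y). Pg (vdiff L x y)) (nh z \<times>\<^sub>F nh z)"
      using P(2) unfolding filterlim_iff by (simp add: case_prod_unfold)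
    then obtain Qf Qg where Q: "eventually Qf (nh z)" "eventually Qg (nh z)"
      "\<And>x y. Qf x \<Longrightarrow> Qg y \<Longrightarrow> Pg (vdiff L x y)" unfolding eventually_prod_filter by auto
    have "Qg z" using eventually_nhdsin_self[OF Q(2)] z by (simp add: top)
    have "eventually (\<lambda>w. Qf w \<and> w \<in> points L) (nh z)"
      using Q(1) eventually_points by (rule eventually_conj)
    then show "eventually P (nh z)"
    proof (rule eventually_mono)
      fix w assume "Qf w \<and> w \<in> points L"
      then show "P w" using P(3)[OF G(2)[OF P(1)] Q(3)[OF _ \<open>Qg z\<close>], of w] by (simp add: add_diff z)
    qed
  qed
qed

lemma completion_add:
  assumes "x \<in> points L" "y \<in> points L"
  shows "minimal_hull L (filter_add L (nh x) (nh y)) = nh (vadd L x y)"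
proof (rule minimal_hull_eq[OF add_in[OF assms]])
  show "filter_add L (nh x) (nh y) \<le> nh (vadd L x y)"
    using filterlim_nhdsin_prod[OF continuous_add, of x y] assms
    by (simp add: top filter_add_def filterlim_def)
  fix P assume "eventually P (filter_add L (nh x) (nh y))"
  then obtain Pf Pg where P: "eventually Pf (nh x)" "eventually Pg (nh y)"
    "\<And>x y. Pf x \<Longrightarrow> Pg y \<Longrightarrow> P (vadd L x y)"
    unfolding filter_add_def eventually_filtermap eventually_prod_filter by auto
  then show "P (vadd L x y)" using assms eventually_nhdsin_self by (metis top)
qed

lemma completion_scale:
  assumes "x \<in> points L"
  shows "minimal_hull L (filtermap (vscale L c) (nh x)) = nh (vscale L c x)"
proof (rule minimal_hull_eq[OF scale_in[OF assms]])
  show "filtermap (vscale L c) (nh x) \<le> nh (vscale L c x)"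
    unfolding le_filter_def eventually_filtermap
  proof (intro allI impI)
    fix P assume P: "eventually P (nh (vscale L c x))"
    have "filterlim (\<lambda>(c, x). vscale L c x) (nh (vscale L c x)) (nhdsin euclidean c \<times>\<^sub>F nh x)"
      using filterlim_nhdsin_prod[OF continuous_scale, of c x] assms by (simp add: top)
    then have "eventually (\<lambda>(c, x). P (vscale L c x)) (nhdsin euclidean c \<times>\<^sub>F nh x)"
      using P unfolding filterlim_iff by (simp add: case_prod_unfold)
    then obtain Pf Pg where Q: "eventually Pf (nhdsin euclidean c)" "eventually Pg (nh x)"
      "\<And>c x. Pf c \<Longrightarrow> Pg x \<Longrightarrow> P (vscale L c x)" unfolding eventually_prod_filter by auto
    have "Pf c" using eventually_nhdsin_self[OF Q(1)] by simp
    then show "eventually (\<lambda>x. P (vscale L c x)) (nh x)" using Q(2,3) by (auto elim: eventually_mono)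
  qed
  fix P assume "eventually P (filtermap (vscale L c) (nh x))"
  then show "P (vscale L c x)"
    using eventually_nhdsin_self[of "\<lambda>x. P (vscale L c x)" "vtop L" x] assms
    by (simp add: eventually_filtermap top)
qed

lemma inj_nh: "inj_on nh (points L)"
  by (rule inj_onI) (metis nhdsin_le_imp_eq[OF Hausdorff] order_refl top)

text \<open>On neighbourhood filters, "eventually in \<open>U\<close>" means that the base point
  lies in the open set \<open>U\<close>, so the generating sets are the images of open sets. As
  \<open>nh\<close> is injective, these images are closed under finite intersections and arbitrary
  unions and already form the whole topology.\<close>

lemma openin_completion: "openin (vtop (tvs_completion L)) W \<longleftrightarrow> (\<exists>U. openin (vtop L) U \<and> W = nh ` U)"
proof -
  define \<S> where "\<S> = {{F. minimal_Cauchy_filter L F \<and> (\<forall>\<^sub>F x in F. x \<in> U)} | U. openin (vtop L) U}"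
  have basic: "{F. minimal_Cauchy_filter L F \<and> (\<forall>\<^sub>F x in F. x \<in> U)} = nh ` U" if U: "openin (vtop L) U" for U
  proof -
    have sub: "U \<subseteq> points L" using openin_subset[OF U] by (simp add: top)
    have "eventually (\<lambda>y. y \<in> U) (nh x) \<longleftrightarrow> x \<in> U" if "x \<in> points L" for x
      using that U eventually_nhdsin_self[of "\<lambda>y. y \<in> U" "vtop L" x]
      by (auto simp: top eventually_nhdsin)
    then show ?thesis using sub by (auto simp: minimal_Cauchy_iff)
  qed
  have "generate_topology_on \<S> W \<longleftrightarrow> (\<exists>U. openin (vtop L) U \<and> W = nh ` U)"
  proof
    assume "generate_topology_on \<S> W"
    then show "\<exists>U. openin (vtop L) U \<and> W = nh ` U"
    proof induction
      case Empty
      then show ?case by (intro exI[of _ "{}"]) simp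
    next
      case (Int a b)
      then obtain U U' where U: "openin (vtop L) U" "a = nh ` U" "openin (vtop L) U'" "b = nh ` U'" by blast
      have "a \<inter> b = nh ` (U \<inter> U')"
        using inj_on_image_Int[OF inj_nh, of U U'] openin_subset[OF U(1)] openin_subset[OF U(3)] U(2,4)
        by (simp add: top)
      then show ?case using openin_Int[OF U(1,3)] by blast
    next
      case (UN K)
      define J where "J = {U. openin (vtop L) U \<and> nh ` U \<in> K}"
      have "\<Union>K = nh ` \<Union>J" using UN.IH unfolding J_def by blast
      moreover have "openin (vtop L) (\<Union>J)" unfolding J_def by (intro openin_Union) blast
      ultimately show ?case by blast
    next
      case (Basis s)
      then show ?case unfolding \<S>_def using basic by blast
    qed
  next
    assume "\<exists>U. openin (vtop L) U \<and> W = nh ` U"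
    then have "W \<in> \<S>" unfolding \<S>_def using basic by blast
    then show "generate_topology_on \<S> W" by (rule generate_topology_on.Basis)
  qed
  then show ?thesis
    by (simp add: tvs_completion_def \<S>_def openin_topology_generated_by_iff)
qed

theorem completion_isomorphism: "tvs_isomorphism L (tvs_completion L) (tvs_completion_embedding L)"
  unfolding tvs_isomorphism_def tvs_completion_embedding_def
proof (intro conjI)
  have points: "points (tvs_completion L) = nh ` points L"
    by (auto simp: tvs_completion_def minimal_Cauchy_iff)
  show "linear_on L (tvs_completion L) nh"
    unfolding linear_on_def points
    by (auto simp: tvs_completion_def completion_add completion_scale)
  show "bij_betw nh (points L) (points (tvs_completion L))"
    unfolding points by (rule inj_on_imp_bij_betw[OF inj_nh])
  have topspace: "topspace (vtop (tvs_completion L)) = nh ` points L"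
  proof (rule antisym)
    show "topspace (vtop (tvs_completion L)) \<subseteq> nh ` points L"
      using openin_topspace[of "vtop (tvs_completion L)"] openin_subset[of "vtop L"]
      unfolding openin_completion top by blast
    have "openin (vtop (tvs_completion L)) (nh ` points L)"
      unfolding openin_completion using openin_topspace[of "vtop L"] by (auto simp: top)
    then show "nh ` points L \<subseteq> topspace (vtop (tvs_completion L))" by (rule openin_subset)
  qed
  show "homeomorphic_map (vtop L) (vtop (tvs_completion L)) nh"
  proof (rule bijective_open_imp_homeomorphic_map)
    show "continuous_map (vtop L) (vtop (tvs_completion L)) nh"
      unfolding continuous_map_def
    proof (intro conjI allI impI)
      fix W assume "openin (vtop (tvs_completion L)) W"
      then obtain U where U: "openin (vtop L) U" "W = nh ` U" unfolding openin_completion by blast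
      have "{x \<in> topspace (vtop L). nh x \<in> W} = U"
        using openin_subset[OF U(1)] inj_on_image_mem_iff[OF inj_nh] unfolding U(2) top by blast
      then show "openin (vtop L) {x \<in> topspace (vtop L). nh x \<in> W}" using U(1) by simp
    qed (simp add: topspace top)
    show "open_map (vtop L) (vtop (tvs_completion L)) nh"
      unfolding open_map_def openin_completion by blast
  qed (simp_all add: topspace top inj_nh)
qed

end

section \<open>The extrapolation spaces of an invertible generator\<close>

theorem corollary8:
  fixes scl :: "'k::{real_normed_field,euclidean_space} \<Rightarrow> 'a::banach \<Rightarrow> 'a"
    and D :: "'a set"
    and A :: "'a \<Rightarrow> 'a"
  assumes "normed_scalars scl"
    and "reflexive_space scl"
    and "generates_C0_semigroup scl D A"
    and "bij_betw A D UNIV"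
    and "the_inv_into D A \<in> bounded_maps scl scl"
  shows "complete_tvs (extrapolation_limit scl D A) \<and>
    Hausdorff_space (vtop (extrapolation_limit scl D A)) \<and>
    tvs_isomorphism (extrapolation_limit scl D A) (universal_extrapolation_space scl D A)
      (tvs_completion_embedding (extrapolation_limit scl D A))"
proof -
  define B where "B = the_inv_into D A"
  interpret injective_operator scl B
  proof (intro injective_operator.intro injective_operator_axioms.intro assms(1))
    show "B \<in> bounded_maps scl scl" unfolding B_def by (rule assms(5))
    show "inj B"
      unfolding B_def by (rule bij_betw_imp_inj_on[OF bij_betw_the_inv_into[OF assms(4)]])
  qed
  have space: "extrapolation_space scl D A n = pw.E n" for n
    unfolding extrapolation_space_def extrapolation_norm_def B_def[symmetric] pw.p_def ..
  \<comment> \<open>The limit begins with the first extrapolation space, so step \<open>n\<close> of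
    the abstract sequence is extrapolation space \<open>Suc n\<close>; the operator on coordinates
    is \<open>B\<close> in every step.\<close>
  interpret injective_sequence scl B "\<lambda>n. pw.R (Suc n)" "\<lambda>n. extrapolation_space scl D A (Suc n)"
    "\<lambda>n. extrapolation_link scl D A (Suc n)" "\<lambda>n. pw.cls (Suc n)"
  proof
    show "closed (pw.R (Suc n))" for n unfolding pw.R_def by (rule closed_closure)
  qed (use B inj_B extrapolation_link_cls[OF B_def[symmetric]] in \<open>simp_all only: space pw.R_subspace
      B_in_R pw.points_E pw.homeomorphic_cls pw.vadd_E pw.vscale_E pw.vzero_E\<close>)
  have L: "extrapolation_limit scl D A = L"
    unfolding extrapolation_limit_def ..
  interpret L: complete_Hausdorff_tvs L
  proof
    show "linear_topology L (vtop L)"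
      using admissible_\<tau> unfolding admissible_topology_def linear_topology_def V_def[symmetric] by simp
    show "complete_tvs L" by (rule complete_L[OF assms(2)])
    show "Hausdorff_space (vtop L)" using Hausdorff_\<tau>[OF assms(2)] by simp
  qed (simp_all add: vadd_zero vadd_vdiff vdiff_self)
  show ?thesis
    unfolding universal_extrapolation_space_def L
    using L.complete L.Hausdorff L.completion_isomorphism by blast
qed

end
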